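(* Let $X$ be a nonzero complex Banach space with open unit ball $\mathbb{B}$. Let $\beta_1\approx0.559376$ be the root near this value of $16\beta^3+69\beta^2-15\beta-16=0$, and let $\beta\in(0,1]$. Let $f:\mathbb{B}\to\mathbb{C}$ be holomorphic with $f(0)=1$ and suppose $F(z)=zf(z)$ belongs to $\mathcal{SS}^*_\beta(\mathbb{B})$. Then for every $z\in X\setminus\{0\}$ and $l_z\in T(z)$, $$|A_2A_3-A_4|\le\begin{cases}\dfrac{2\beta}{3}&\text{if }\beta\in(0,\beta_1],\\[2mm]\dfrac{2\sqrt2\,\beta(2\beta+1)^{3/2}}{9\sqrt{2+3\beta-5\beta^2}}&\text{if }\beta\in\left[\beta_1,\frac{2+\sqrt{34}}{10}\right],\\[2mm]\dfrac{2\beta(10\beta^2-1)}{9}&\text{if }\beta\in\left[\frac{2+\sqrt{34}}{10},1\right],\end{cases}$$ where $$A_2=\frac{l_z(D^2F(0)(z^2))}{2!\,\|z\|^2},\quad A_3=\frac{l_z(D^3F(0)(z^3))}{3!\,\|z\|^3},\quad A_4=\frac{l_z(D^4F(0)(z^4))}{4!\,\|z\|^4}.$$ Let $u\in X$ with $\|u\|=1$ and $l_u\in T(u)$. For $\beta\in(0,\beta_1]$, one has $(q_5,q_6)\in\Theta_1\cup\Theta_2$ and equality is attained by $$\tilde F_1(z)=z\exp\int_0^{l_u(z)}\frac1t\left(\left(\frac{1+t^3}{1-t^3}\right)^\beta-1\right)dt.$$ For $\beta\in[\beta_1,(2+\sqrt{34})/10]$, one has $(q_5,q_6)\in\Theta_8$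 and equality is attained by $$\tilde F_3(z)=z\exp\int_0^{l_u(z)}\frac1t\left(\left(\frac{1-t^2}{1+t^2-2\rho t}\right)^\beta-1\right)dt,\qquad\rho=\sqrt{\frac{1+2\beta}{4+6\beta-10\beta^2}}.$$ For $\beta\in[(2+\sqrt{34})/10,1]$, one has $(q_5,q_6)\in\Theta_4$ and equality is attained by $$\tilde F_2(z)=z\exp\int_0^{l_u(z)}\frac1t\left(\left(\frac{1+t}{1-t}\right)^\beta-1\right)dt.$$ Hence the estimate is sharp for all $\beta\in(0,1]$.
   Context: For $z\in X\setminus\{0\}$, $T(z)=\{l_z\in L(X,\mathbb{C}): l_z(z)=\|z\|,\ \|l_z\|=1\}$, where $L(X,\mathbb{C})$ is the space of continuous linear functionals on $X$. $D^nF(0)$ is the $n$-th Fréchet derivative at $0$ and $D^nF(0)(z^n)=D^nF(0)(z,\dots,z)$. A holomorphic mapping $F:\mathbb{B}\to X$ is normalized if $F(0)=0$ and $DF(0)=I$, and locally biholomorphic if $DF(z)$ is invertible with bounded inverse for each $z\in\mathbb{B}$. For $\beta\in(0,1]$, $\mathcal{SS}^*_\beta(\mathbb{B})$ (strongly starlike mappings of order $\beta$) is the class of normalized locally biholomorphic $F$ with $$\left|\arg l_z([DF(z)]^{-1}F(z))\right|<\frac\pi2\beta\quad\text{for all }z\in\mathbb{B}\setminus\{0\},\ l_z\in T(z)$$ (in particular $l_z([DF(z)]^{-1}F(z))\neq0$). Equivalently, $\dfrac{\|z\|}{l_z([DF(z)]^{-1}F(z))}\in\Phi(\mathbb{U})$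 for all such $z,l_z$, where $\mathbb{U}$ is the open unit disk and $\Phi(\zeta)=\left(\frac{1+\zeta}{1-\zeta}\right)^\beta$ with the branch equal to $1$ at $\zeta=0$. Writing $\Phi(\zeta)=1+B_1\zeta+B_2\zeta^2+B_3\zeta^3+\cdots$ for this $\Phi$ (so $B_1=2\beta$, $B_2=2\beta^2$, $B_3=\frac23\beta+\frac43\beta^3$), $q_5=\frac{2B_2}{B_1}$ and $q_6=\frac{B_3-B_1^3}{B_1}$. In $\mathbb{R}^2$ (points $(a,b)$): $\Theta_1=\{|a|\le\frac12,\ |b|\le1\}$; $\Theta_2=\{\frac12\le|a|\le2,\ \frac4{27}(|a|+1)^3-(|a|+1)\le b\le1\}$; $\Theta_4=\{|a|\ge\frac12,\ b\le-\frac23(|a|+1)\}$; $\Theta_8=\{\frac12\le|a|\le2,\ -\frac23(|a|+1)\le b\le\frac4{27}(|a|+1)^3-(|a|+1)\}$. Powers use the branch equal to $1$ at $t=0$; integrals are along any path in $\mathbb{U}$ from $0$ to $l_u(z)$ (the integrand has a removable singularity at $t=0$). "Equality is attained by" a mapping means that the mapping satisfies the hypotheses on $F$ and that equality holds for it at some $z\in X\setminus\{0\}$ (namely $z=ru$, $0<r<1$). *)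

theory Defs
  imports "HOL-Complex_Analysis.Complex_Analysis"
begin

section \<open>Complex Banach spaces\<close>

class complex_normed_space = real_normed_vector +
  fixes scaleC :: "complex \<Rightarrow> 'a \<Rightarrow> 'a" (infixr "*\<^sub>C" 75)
  assumes scaleR_scaleC: "scaleR r x = complex_of_real r *\<^sub>C x"
    and scaleC_add_right: "c *\<^sub>C (x + y) = c *\<^sub>C x + c *\<^sub>C y"
    and scaleC_add_left: "(c + d) *\<^sub>C x = c *\<^sub>C x + d *\<^sub>C x"
    and scaleC_scaleC: "c *\<^sub>C d *\<^sub>C x = (c * d) *\<^sub>C x"
    and norm_scaleC: "norm (c *\<^sub>C x) = cmod c * norm x"

class complex_banach = complex_normed_space + complete_space

instantiation complex :: complex_banach
begin

definition "scaleC c (x::complex) = c * x"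

instance
  by standard (simp_all add: scaleC_complex_def scaleR_conv_of_real algebra_simps norm_mult)

end

definition bounded_clinear :: "('a::complex_normed_space \<Rightarrow> 'b::complex_normed_space) \<Rightarrow> bool" where
  "bounded_clinear L \<longleftrightarrow> bounded_linear L \<and> (\<forall>c x. L (c *\<^sub>C x) = c *\<^sub>C L x)"

definition support_functionals :: "'a::complex_normed_space \<Rightarrow> ('a \<Rightarrow> complex) set" where
  "support_functionals z =
     {l. bounded_clinear l \<and> l z = complex_of_real (norm z) \<and> onorm l = 1}"


section \<open>Frechet derivatives and holomorphic mappings\<close>

text \<open>The derivative is a map into the Banach space of bounded linear operators with the
  operator norm, so iterating \<open>fderiv\<close> gives the higher Frechet derivatives:
  \<open>fderiv (fderiv F) z\<close> is the second derivative in curried form, and so on.  The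
  operators in \<open>'a \<Rightarrow>\<^sub>L 'b\<close> are only real-linear by type; complex linearity of the
  derivative is part of \<open>holomorphic_map\<close>.\<close>

definition fderiv ::
    "('a::real_normed_vector \<Rightarrow> 'b::real_normed_vector) \<Rightarrow> 'a \<Rightarrow> 'a \<Rightarrow>\<^sub>L 'b" where
  "fderiv F z = Blinfun (frechet_derivative F (at z))"

definition holomorphic_map ::
    "('a::complex_normed_space \<Rightarrow> 'b::complex_normed_space) \<Rightarrow> 'a set \<Rightarrow> bool" where
  "holomorphic_map F S \<longleftrightarrow>
     open S \<and> (\<forall>z\<in>S. \<exists>L. bounded_clinear L \<and> (F has_derivative L) (at z))"

definition normalized_map :: "('a::complex_banach \<Rightarrow> 'a) \<Rightarrow> bool" where
  "normalized_map F \<longleftrightarrow>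
     holomorphic_map F (ball 0 1) \<and> F 0 = 0 \<and> fderiv F 0 = id_blinfun"

definition locally_biholomorphic :: "('a::complex_banach \<Rightarrow> 'a) \<Rightarrow> bool" where
  "locally_biholomorphic F \<longleftrightarrow>
     holomorphic_map F (ball 0 1) \<and>
     (\<forall>z\<in>ball 0 1. \<exists>G::'a \<Rightarrow>\<^sub>L 'a.
        G o\<^sub>L fderiv F z = id_blinfun \<and> fderiv F z o\<^sub>L G = id_blinfun)"

text \<open>Since \<open>Arg 0 = 0\<close>, the condition that the number is nonzero has to be stated
  separately.\<close>

definition strongly_starlike :: "real \<Rightarrow> ('a::complex_banach \<Rightarrow> 'a) set" where
  "strongly_starlike \<beta> =
     {F. normalized_map F \<and> locally_biholomorphic F \<and>
         (\<forall>z\<in>ball 0 1 - {0}. \<forall>l\<in>support_functionals z.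
            (let w = l (inv (blinfun_apply (fderiv F z)) (F z))
             in w \<noteq> 0 \<and> \<bar>Arg w\<bar> < pi / 2 * \<beta>))}"

definition starlike_product ::
    "real \<Rightarrow> ('a::complex_banach \<Rightarrow> complex) \<Rightarrow> ('a \<Rightarrow> 'a) \<Rightarrow> bool" where
  "starlike_product \<beta> f F \<longleftrightarrow>
     holomorphic_map f (ball 0 1) \<and> f 0 = 1 \<and>
     (\<forall>z\<in>ball 0 1. F z = f z *\<^sub>C z) \<and> F \<in> strongly_starlike \<beta>"

definition A2 :: "('a::complex_banach \<Rightarrow> complex) \<Rightarrow> ('a \<Rightarrow> 'a) \<Rightarrow> 'a \<Rightarrow> complex" where
  "A2 l F z = l (blinfun_apply (blinfun_apply (fderiv (fderiv F) 0) z) z)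
     / (fact 2 * complex_of_real (norm z) ^ 2)"

definition A3 :: "('a::complex_banach \<Rightarrow> complex) \<Rightarrow> ('a \<Rightarrow> 'a) \<Rightarrow> 'a \<Rightarrow> complex" where
  "A3 l F z = l (blinfun_apply (blinfun_apply (blinfun_apply
       (fderiv (fderiv (fderiv F)) 0) z) z) z)
     / (fact 3 * complex_of_real (norm z) ^ 3)"

definition A4 :: "('a::complex_banach \<Rightarrow> complex) \<Rightarrow> ('a \<Rightarrow> 'a) \<Rightarrow> 'a \<Rightarrow> complex" where
  "A4 l F z = l (blinfun_apply (blinfun_apply (blinfun_apply (blinfun_apply
       (fderiv (fderiv (fderiv (fderiv F))) 0) z) z) z) z)
     / (fact 4 * complex_of_real (norm z) ^ 4)"


section \<open>Parameters\<close>

definition \<beta>\<^sub>1 :: real where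
  "\<beta>\<^sub>1 = (THE b. 16 * b^3 + 69 * b^2 - 15 * b - 16 = 0 \<and> \<bar>b - 0.559376\<bar> < 1 / 10^6)"

lemma ex1_\<beta>\<^sub>1:
  "\<exists>!b::real. 16 * b^3 + 69 * b^2 - 15 * b - 16 = 0 \<and> \<bar>b - 0.559376\<bar> < 1 / 10^6"
proof -
  let ?p = "\<lambda>b::real. 16 * b^3 + 69 * b^2 - 15 * b - 16"
  have "\<exists>b\<ge>0.5593755. b \<le> 0.559376 \<and> ?p b = 0"
    by (rule IVT') (auto simp: power2_eq_square power3_eq_cube intro!: continuous_intros)
  then obtain b where b: "b \<ge> 0.5593755" "b \<le> 0.559376" "?p b = 0" by auto
  show ?thesis
  proof (rule ex1I[of _ b])
    show "?p b = 0 \<and> \<bar>b - 0.559376\<bar> < 1 / 10^6" using b by (simp add: abs_if)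
  next
    fix c assume c: "?p c = 0 \<and> \<bar>c - 0.559376\<bar> < 1 / 10^6"
    then have c0: "c > 0.5" by (simp add: abs_if split: if_splits)
    have "?p c - ?p b = (c - b) * (16 * (c * c + c * b + b * b) + 69 * (c + b) - 15)"
      by (simp add: algebra_simps power2_eq_square power3_eq_cube)
    moreover have "16 * (c * c + c * b + b * b) + 69 * (c + b) - 15 > 0"
    proof -
      have "c * c + c * b + b * b > 0" using c0 b by (intro add_pos_pos mult_pos_pos) auto
      moreover have "c + b > 1" using c0 b by simp
      moreover have "16 * x + 69 * y - 15 > 0" if "x > 0" "y > 1" for x y :: real
        using that by linarith
      ultimately show ?thesis by blast
    qed
    ultimately show "c = b" using b c by simp
  qed
qed

text \<open>For \<open>\<zeta>\<close> in the unit disk the base has positive real part, so the principal power is the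
  branch with value 1 at 0.\<close>

definition \<Phi> :: "real \<Rightarrow> complex \<Rightarrow> complex" where
  "\<Phi> \<beta> \<zeta> = ((1 + \<zeta>) / (1 - \<zeta>)) powr complex_of_real \<beta>"

text \<open>The Taylor coefficients of \<open>\<Phi> \<beta>\<close> at 0 are real; \<open>Re\<close> only adjusts the type.\<close>

definition \<Phi>_coeff :: "real \<Rightarrow> nat \<Rightarrow> real" where
  "\<Phi>_coeff \<beta> n = Re ((deriv ^^ n) (\<Phi> \<beta>) 0 / fact n)"

definition q5 :: "real \<Rightarrow> real" where
  "q5 \<beta> = 2 * \<Phi>_coeff \<beta> 2 / \<Phi>_coeff \<beta> 1"

definition q6 :: "real \<Rightarrow> real" where
  "q6 \<beta> = (\<Phi>_coeff \<beta> 3 - \<Phi>_coeff \<beta> 1 ^ 3) / \<Phi>_coeff \<beta> 1"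

definition \<Theta>1 :: "(real \<times> real) set" where
  "\<Theta>1 = {(a, b). \<bar>a\<bar> \<le> 1/2 \<and> \<bar>b\<bar> \<le> 1}"

definition \<Theta>2 :: "(real \<times> real) set" where
  "\<Theta>2 = {(a, b). 1/2 \<le> \<bar>a\<bar> \<and> \<bar>a\<bar> \<le> 2 \<and>
             4/27 * (\<bar>a\<bar> + 1)^3 - (\<bar>a\<bar> + 1) \<le> b \<and> b \<le> 1}"

definition \<Theta>4 :: "(real \<times> real) set" where
  "\<Theta>4 = {(a, b). 1/2 \<le> \<bar>a\<bar> \<and> b \<le> - (2/3) * (\<bar>a\<bar> + 1)}"

definition \<Theta>8 :: "(real \<times> real) set" where
  "\<Theta>8 = {(a, b). 1/2 \<le> \<bar>a\<bar> \<and> \<bar>a\<bar> \<le> 2 \<and>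
             - (2/3) * (\<bar>a\<bar> + 1) \<le> b \<and> b \<le> 4/27 * (\<bar>a\<bar> + 1)^3 - (\<bar>a\<bar> + 1)}"

definition M1 :: "real \<Rightarrow> real" where
  "M1 \<beta> = 2 * \<beta> / 3"

definition M2 :: "real \<Rightarrow> real" where
  "M2 \<beta> = 2 * sqrt 2 * \<beta> * (2 * \<beta> + 1) powr (3/2) / (9 * sqrt (2 + 3 * \<beta> - 5 * \<beta>^2))"

definition M3 :: "real \<Rightarrow> real" where
  "M3 \<beta> = 2 * \<beta> * (10 * \<beta>^2 - 1) / 9"


section \<open>Extremal mappings\<close>

text \<open>The integrand extends holomorphically to the unit disk, so the integral does not depend
  on the path and the segment from 0 may be used; the value at \<open>t = 0\<close> is irrelevant.\<close>

definition exp_integral_map ::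
    "(complex \<Rightarrow> complex) \<Rightarrow> ('a::complex_banach \<Rightarrow> complex) \<Rightarrow> 'a \<Rightarrow> 'a" where
  "exp_integral_map p l z =
     exp (contour_integral (linepath 0 (l z)) (\<lambda>t. 1 / t * (p t - 1))) *\<^sub>C z"

text \<open>The bases of the powers below have positive real part for \<open>t\<close> in the unit disk
  (in \<open>F3\<close> for \<open>\<beta>\<close> between \<open>\<beta>\<^sub>1\<close> and \<open>(2 + sqrt 34) / 10\<close>, where \<open>0 < \<rho> \<beta> \<le> 1\<close>), so the
  principal power is the branch with value 1 at \<open>t = 0\<close>.\<close>

definition F1 :: "real \<Rightarrow> ('a::complex_banach \<Rightarrow> complex) \<Rightarrow> 'a \<Rightarrow> 'a" where
  "F1 \<beta> = exp_integral_map (\<lambda>t. ((1 + t^3) / (1 - t^3)) powr complex_of_real \<beta>)"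

definition F2 :: "real \<Rightarrow> ('a::complex_banach \<Rightarrow> complex) \<Rightarrow> 'a \<Rightarrow> 'a" where
  "F2 \<beta> = exp_integral_map (\<lambda>t. ((1 + t) / (1 - t)) powr complex_of_real \<beta>)"

definition \<rho> :: "real \<Rightarrow> real" where
  "\<rho> \<beta> = sqrt ((1 + 2 * \<beta>) / (4 + 6 * \<beta> - 10 * \<beta>^2))"

definition F3 :: "real \<Rightarrow> ('a::complex_banach \<Rightarrow> complex) \<Rightarrow> 'a \<Rightarrow> 'a" where
  "F3 \<beta> = exp_integral_map
     (\<lambda>t. ((1 - t^2) / (1 + t^2 - 2 * complex_of_real (\<rho> \<beta>) * t)) powr complex_of_real \<beta>)"

text \<open>\<open>F\<close> satisfies the hypotheses of the estimate and attains the value \<open>M\<close> at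
  all points \<open>r u\<close>, \<open>0 < r < 1\<close>, with every support functional there.  The set of these
  functionals is required to be nonempty, so that the statement cannot hold vacuously.\<close>

definition equality_attained_by ::
    "real \<Rightarrow> real \<Rightarrow> 'a::complex_banach \<Rightarrow> ('a \<Rightarrow> 'a) \<Rightarrow> bool" where
  "equality_attained_by \<beta> M u F \<longleftrightarrow>
     (\<exists>f. starlike_product \<beta> f F) \<and>
     (\<forall>r\<in>{0<..<1}. support_functionals (r *\<^sub>R u) \<noteq> {} \<and>
        (\<forall>l\<in>support_functionals (r *\<^sub>R u).
           cmod (A2 l F (r *\<^sub>R u) * A3 l F (r *\<^sub>R u) - A4 l F (r *\<^sub>R u)) = M))"

end

theory Submission
  imports Defs
begin

text \<open>For \<open>F z = f z *\<^sub>C z\<close> the starlikeness condition only involves the radial behaviour of \<open>f\<close>: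
  \<open>DF(z)\<close> maps \<open>z\<close> to \<open>(f z + Df(z) z) *\<^sub>C z\<close>, so that \<open>[DF(z)]\<^sup>-\<^sup>1 F(z)\<close> is \<open>z\<close> divided by
  \<open>p = (f z + Df(z) z) / f z\<close>.  On a complex line through the origin, \<open>z = t *\<^sub>C u\<close>, this becomes the
  one-variable condition that \<open>p(t) = t h'(t) / h(t)\<close> lies in the sector \<open>\<bar>Arg p\<bar> < pi \<beta> / 2\<close>, where
  \<open>h(t) = t f(t *\<^sub>C u)\<close> (\<open>starlike_product_radial\<close>, \<open>starlike_productI\<close>).  The numbers \<open>A2\<close>, \<open>A3\<close>, \<open>A4\<close>
  are the Taylor coefficients of \<open>h\<close> (\<open>A_eq_taylor_coeffs\<close>), and comparing coefficients in
  \<open>t h' = p h\<close> gives \<open>A2 A3 - A4 = (c1^3 - c3) / 3\<close> with \<open>p(t) = 1 + c1 t + c2 t^2 + \<dots>\<close>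
  (\<open>starlike_coefficient_identity\<close>).

  Membership of \<open>p\<close> in the sector means \<open>p = \<Phi> \<beta> \<circ> \<omega>\<close> with a holomorphic self-map \<open>\<omega>\<close> of the disc
  that fixes 0 (\<open>subordinate_to_Phi\<close>).  The differential equation
  \<open>(1 - \<zeta>\<^sup>2) \<Phi>' = 2 \<beta> \<Phi>\<close> turns this into
  \<open>c3 - c1^3 = 2 \<beta> (w3 + q5 w1 w2 + q6 w1^3)\<close> with \<open>q5 = 2 \<beta>\<close> and \<open>q6 = (1 - 10 \<beta>\<^sup>2) / 3\<close>.
  Schur's parametrisation of \<open>w1, w2, w3\<close> and the triangle inequality bound the bracket by an
  elementary function of \<open>\<bar>w1\<bar>\<close> and a second parameter in \<open>[0, 1]\<close>, and the maximum of that
  function is governed by the cubic \<open>(1 + 2 \<beta>) (t - t^3) + \<bar>q6\<bar> t^3\<close> on \<open>[0, 1]\<close>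
  (\<open>schur_triangle_bound\<close>).  The triangle inequality loses nothing where it matters: for
  \<open>q6 \<le> 0\<close> real parameters of suitable sign align all terms.  The three ranges of \<open>\<beta>\<close> record whether the bound
  is 1 (the value at \<open>w1 = 0\<close>, attained by \<open>\<omega> = t^3\<close>), the interior maximum of the cubic at
  \<open>t = \<rho> \<beta>\<close> (attained by a Blaschke product with zeros 0 and \<open>\<rho> \<beta>\<close>), or its value \<open>\<bar>q6\<bar>\<close> at
  \<open>t = 1\<close> (attained by \<open>\<omega> = t\<close>).

  Two pieces of functional analysis support this.  The Hahn-Banach theorem, in the form
  \<open>support_functionals_nonempty\<close>, shows that the starlikeness condition is not vacuous and reduces
  vector-valued Cauchy estimates to scalar ones.  With these estimates, Frechet derivatives of
  holomorphic maps are again holomorphic in the operator norm (\<open>holomorphic_fderiv\<close>), so the iterated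
  derivatives in \<open>A2\<close>, \<open>A3\<close>, \<open>A4\<close> exist and can be computed along lines.\<close>

section \<open>Norming functionals\<close>

definition sublinear :: "('a::real_vector \<Rightarrow> real) \<Rightarrow> bool" where
  "sublinear q \<longleftrightarrow> (\<forall>x y. q (x + y) \<le> q x + q y) \<and> (\<forall>c x. c \<ge> 0 \<longrightarrow> q (c *\<^sub>R x) = c * q x)"

lemma sublinear_add: "sublinear q \<Longrightarrow> q (x + y) \<le> q x + q y"
  and sublinear_scale: "sublinear q \<Longrightarrow> c \<ge> 0 \<Longrightarrow> q (c *\<^sub>R x) = c * q x"
  unfolding sublinear_def by auto

lemma sublinear_zero: "sublinear q \<Longrightarrow> q 0 = 0"
  using sublinear_scale[of q 0 0] by simp

lemma sublinear_minus: "sublinear q \<Longrightarrow> - q (- x) \<le> q x"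
  using sublinear_add[of q x "- x"] sublinear_zero[of q] by simp

lemma sublinear_norm: "sublinear norm"
  unfolding sublinear_def by (simp add: norm_triangle_ineq)

text \<open>The infimum over a chain stays subadditive because two members can be replaced by the smaller
  one; the lower bound \<open>b\<close> keeps all infima finite.\<close>
lemma sublinear_chain_Inf:
  fixes C :: "('a::real_vector \<Rightarrow> real) set"
  assumes ne: "C \<noteq> {}" and sub: "\<And>q. q \<in> C \<Longrightarrow> sublinear q"
    and bdd: "\<And>q x. q \<in> C \<Longrightarrow> b x \<le> q x"
    and chain: "\<And>q r. q \<in> C \<Longrightarrow> r \<in> C \<Longrightarrow> q \<le> r \<or> r \<le> q"
  shows "sublinear (\<lambda>x. INF q\<in>C. q x)"
proof -
  let ?m = "\<lambda>x. INF q\<in>C. q x"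
  have bb: "bdd_below ((\<lambda>q. q x) ` C)" for x
    using bdd by (auto intro!: bdd_belowI)
  have le: "?m x \<le> q x" if "q \<in> C" for q x
    using that bb by (auto intro: cINF_lower)
  show ?thesis
    unfolding sublinear_def
  proof (intro conjI allI impI)
    fix x y
    show "?m (x + y) \<le> ?m x + ?m y"
    proof -
      have "?m (x + y) - q x \<le> r y" if qC: "q \<in> C" and rC: "r \<in> C" for q r
      proof -
        have "q \<le> r \<or> r \<le> q" using chain qC rC by blast
        then obtain s where s: "s \<in> C" "s \<le> q" "s \<le> r"
          using qC rC by blast
        have "?m (x + y) \<le> s (x + y)" using le s by auto
        also have "\<dots> \<le> s x + s y" using sublinear_add sub s by auto
        also have "\<dots> \<le> q x + r y" using s by (auto simp: le_fun_def intro: add_mono)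
        finally show ?thesis by simp
      qed
      then have "?m (x + y) - q x \<le> ?m y" if "q \<in> C" for q
        using that ne by (intro cINF_greatest) auto
      then have "?m (x + y) - ?m y \<le> ?m x"
        using ne by (intro cINF_greatest) (auto simp: algebra_simps)
      then show ?thesis by simp
    qed
  next
    fix c :: real and x
    assume c: "c \<ge> 0"
    show "?m (c *\<^sub>R x) = c * ?m x"
    proof (cases "c = 0")
      case True
      have "(\<lambda>q. q 0) ` C = {0}"
        using ne sublinear_zero sub by (auto simp: image_iff) 
      then show ?thesis using True by simp
    next
      case False
      then have c: "c > 0" using c by simp
      show ?thesis
      proof (rule antisym)
        have "?m (c *\<^sub>R x) / c \<le> ?m x"
        proof (rule cINF_greatest[OF ne])
          fix q assume q: "q \<in> C"
          have "?m (c *\<^sub>R x) \<le> c * q x"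
            using le[OF q, of "c *\<^sub>R x"] sublinear_scale[OF sub[OF q]] c by simp
          then show "?m (c *\<^sub>R x) / c \<le> q x" using c by (simp add: field_simps)
        qed
        then show "?m (c *\<^sub>R x) \<le> c * ?m x" using c by (simp add: field_simps)
        show "c * ?m x \<le> ?m (c *\<^sub>R x)"
        proof (rule cINF_greatest[OF ne])
          fix q assume q: "q \<in> C"
          show "c * ?m x \<le> q (c *\<^sub>R x)"
            using le[OF q, of x] sublinear_scale[OF sub[OF q]] c by simp
        qed
      qed
    qed
  qed
qed

text \<open>Zorn's lemma for the reversed pointwise order.  Members below \<open>p\<close> are bounded below by
  \<open>\<lambda>x. - p (- x)\<close>, since \<open>0 = q 0 \<le> q x + q (- x)\<close>.\<close>
lemma minimal_sublinear_exists:
  fixes p :: "'a::real_vector \<Rightarrow> real"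
  assumes p: "sublinear p"
  obtains q where "sublinear q" "q \<le> p" "\<And>r. sublinear r \<Longrightarrow> r \<le> q \<Longrightarrow> r = q"
proof -
  define A where "A = {q. sublinear q \<and> q \<le> p}"
  have "\<exists>m\<in>A. \<forall>a\<in>A. a \<le> m \<longrightarrow> a = m"
  proof (rule predicate_Zorn[of A "\<lambda>q r. r \<le> q"])
    show "partial_order_on A (relation_of (\<lambda>q r. r \<le> q) A)"
      by (rule partial_order_on_relation_ofI) auto
  next
    fix C assume C: "C \<in> Chains (relation_of (\<lambda>q r. r \<le> q) A)"
    then have CA: "q \<in> A" if "q \<in> C" for q
      using that by (auto simp: Chains_def relation_of_def)
    have ch: "q \<le> r \<or> r \<le> q" if "q \<in> C" "r \<in> C" for q r
      using that C by (auto simp: Chains_def relation_of_def)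
    show "\<exists>u\<in>A. \<forall>a\<in>C. u \<le> a"
    proof (cases "C = {}")
      case True
      then show ?thesis using p by (auto simp: A_def)
    next
      case False
      have lower: "- p (- x) \<le> q x" if "q \<in> C" for q x
        using sublinear_minus[of q x] CA[OF that] 
        by (auto simp: A_def le_fun_def intro: order_trans[of "- p (-x)" "- q (- x)"])
      let ?m = "\<lambda>x. INF q\<in>C. q x"
      have le: "?m \<le> q" if "q \<in> C" for q
        using lower that by (auto simp: le_fun_def intro!: cINF_lower bdd_belowI)
      have "sublinear ?m"
        using False CA ch lower by (intro sublinear_chain_Inf[of C "\<lambda>x. - p (- x)"]) (auto simp: A_def)
      moreover have "?m \<le> p"
        using False le CA by (auto simp: A_def intro: order_trans)
      ultimately show ?thesis using le by (auto simp: A_def)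
    qed
  qed
  then show ?thesis
    using that by (auto simp: A_def intro: order_trans)
qed

text \<open>The largest sublinear functional \<open>r \<le> q\<close> with \<open>r (- x) \<le> - q x\<close>, hence one that is additive
  along \<open>x\<close>.\<close>
definition tilt :: "('a::real_vector \<Rightarrow> real) \<Rightarrow> 'a \<Rightarrow> 'a \<Rightarrow> real" where
  "tilt q x y = (INF t\<in>{0..}. q (y + t *\<^sub>R x) - t * q x)"

lemma tilt:
  assumes q: "sublinear q"
  shows sublinear_tilt: "sublinear (tilt q x)"
    and tilt_le: "t \<ge> 0 \<Longrightarrow> tilt q x y \<le> q (y + t *\<^sub>R x) - t * q x"
proof -
  let ?g = "\<lambda>y t. q (y + t *\<^sub>R x) - t * q x"
  have lower: "- q (- y) \<le> ?g y t" if "t \<ge> 0" for y t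
    using sublinear_add[OF q, of "y + t *\<^sub>R x" "- y"] sublinear_scale[OF q that, of x] by simp
  then have bb: "bdd_below (?g y ` {0..})" for y
    by (auto intro!: bdd_belowI)
  have le: "tilt q x y \<le> ?g y t" if "t \<ge> 0" for y t
    unfolding tilt_def using that by (intro cINF_lower bb) auto
  show "t \<ge> 0 \<Longrightarrow> tilt q x y \<le> ?g y t" by (rule le)
  have great: "a \<le> tilt q x y" if "\<And>t. t \<ge> 0 \<Longrightarrow> a \<le> ?g y t" for a y
    unfolding tilt_def using that by (intro cINF_greatest) auto
  show "sublinear (tilt q x)"
    unfolding sublinear_def
  proof (intro conjI allI impI)
    fix y z
    have "tilt q x (y + z) - ?g y s \<le> ?g z t" if "s \<ge> 0" "t \<ge> 0" for s t
      using le[of "s + t" "y + z"] that sublinear_add[OF q, of "y + s *\<^sub>R x" "z + t *\<^sub>R x"]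
      by (simp add: algebra_simps)
    then have "tilt q x (y + z) - ?g y s \<le> tilt q x z" if "s \<ge> 0" for s
      using that by (intro great) auto
    then have "tilt q x (y + z) - tilt q x z \<le> tilt q x y"
      by (intro great) (auto simp: algebra_simps)
    then show "tilt q x (y + z) \<le> tilt q x y + tilt q x z" by simp
  next
    fix c :: real and y
    assume c: "c \<ge> 0"
    show "tilt q x (c *\<^sub>R y) = c * tilt q x y"
    proof (cases "c = 0")
      case True
      have "tilt q x 0 = 0"
        using le[of 0 0] great[of 0 0] sublinear_zero[OF q] sublinear_scale[OF q]
        by (auto intro: antisym)
      then show ?thesis using True by simp
    next
      case False
      then have c: "c > 0" using c by simp
      have scale: "?g (c *\<^sub>R y) (c * t) = c * ?g y t" if "t \<ge> 0" for t
      proof -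
        have "c *\<^sub>R y + (c * t) *\<^sub>R x = c *\<^sub>R (y + t *\<^sub>R x)" by (simp add: algebra_simps)
        then have "q (c *\<^sub>R y + (c * t) *\<^sub>R x) = c * q (y + t *\<^sub>R x)"
          using sublinear_scale[OF q, of c "y + t *\<^sub>R x"] c by simp
        then show ?thesis by (simp add: right_diff_distrib)
      qed
      show ?thesis
      proof (rule antisym)
        have "tilt q x (c *\<^sub>R y) / c \<le> tilt q x y"
          using le[of "c * _" "c *\<^sub>R y"] scale c
          by (intro great) (metis divide_le_eq mult.commute mult_nonneg_nonneg order_less_imp_le)
        then show "tilt q x (c *\<^sub>R y) \<le> c * tilt q x y" using c by (simp add: field_simps)
        show "c * tilt q x y \<le> tilt q x (c *\<^sub>R y)"
        proof (rule great)
          fix t :: real assume t: "t \<ge> 0"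
          have "c * tilt q x y \<le> c * ?g y (t / c)"
            using le[of "t / c" y] c t by simp
          also have "\<dots> = ?g (c *\<^sub>R y) t" using scale[of "t / c"] c t by simp
          finally show "c * tilt q x y \<le> ?g (c *\<^sub>R y) t" .
        qed
      qed
    qed
  qed
qed

text \<open>Minimality forces \<open>q\<close> to coincide with all its tilts, and being its own tilt in direction \<open>x\<close>
  says \<open>q x + q y \<le> q (x + y)\<close>.  This replaces the usual extension by one dimension at a time.\<close>
lemma minimal_sublinear_linear:
  assumes q: "sublinear q" and min: "\<And>r. sublinear r \<Longrightarrow> r \<le> q \<Longrightarrow> r = q"
  shows "linear q"
proof -
  have tq: "tilt q x = q" for x
    using tilt_le[OF q, of 0 x] by (intro min sublinear_tilt[OF q]) (auto simp: le_fun_def)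
  have add: "q (x + y) = q x + q y" for x y
    using tilt_le[OF q, of 1 x y] sublinear_add[OF q, of x y] by (simp add: tq add.commute)
  have neg: "q (- x) = - q x" for x
    using add[of x "- x"] sublinear_zero[OF q] by simp
  show ?thesis
  proof (rule linearI[OF add])
    fix c x
    show "q (c *\<^sub>R x) = c *\<^sub>R q x"
    proof (cases "c \<ge> 0")
      case True
      then show ?thesis using sublinear_scale[OF q] by simp
    next
      case False
      then show ?thesis using sublinear_scale[OF q, of "- c" x] neg[of "c *\<^sub>R x"] by simp
    qed
  qed
qed

text \<open>A minimal functional below the norm tilted towards \<open>z\<close> satisfies \<open>q (- z) \<le> - norm z\<close>.\<close>
lemma real_norming_functional:
  fixes z :: "'a::real_normed_vector"
  obtains \<phi> where "linear \<phi>" "\<And>x. \<phi> x \<le> norm x" "\<phi> z = norm z"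
proof -
  obtain q where q: "sublinear q" "q \<le> tilt norm z" "\<And>r. sublinear r \<Longrightarrow> r \<le> q \<Longrightarrow> r = q"
    using minimal_sublinear_exists[OF sublinear_tilt[OF sublinear_norm]] by blast
  have lin: "linear q" using minimal_sublinear_linear q by blast
  have le: "q x \<le> norm x" for x
    using tilt_le[OF sublinear_norm, of 0 z x] q(2) by (auto simp: le_fun_def intro: order_trans)
  have "q (- z) \<le> - norm z"
    using tilt_le[OF sublinear_norm, of 1 z "- z"] q(2) by (auto simp: le_fun_def intro: order_trans)
  then have "q z = norm z"
    using le[of z] linear_neg[OF lin, of z] by simp
  then show ?thesis using that lin le by blast
qed

lemma scaleC_of_real: "complex_of_real r *\<^sub>C x = r *\<^sub>R x"
  by (simp add: scaleR_scaleC)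

lemma scaleC_one [simp]: "1 *\<^sub>C x = x"
  using scaleC_of_real[of 1 x] by simp

lemma scaleC_zero_left [simp]: "0 *\<^sub>C x = 0"
  using scaleC_of_real[of 0 x] by simp

lemma scaleC_minus_left: "(- c) *\<^sub>C x = - (c *\<^sub>C x)"
  using scaleC_add_left[of c "- c" x] by (simp add: eq_neg_iff_add_eq_0 add.commute)

lemma scaleC_diff_right: "c *\<^sub>C (x - y) = c *\<^sub>C x - c *\<^sub>C y"
  using scaleC_add_right[of c "x - y" y] by (simp add: algebra_simps)

lemma scaleC_scaleR: "c *\<^sub>C r *\<^sub>R x = r *\<^sub>R c *\<^sub>C x"
  by (simp add: scaleR_scaleC scaleC_scaleC mult.commute)

lemma bounded_clinear_linear:
  assumes "bounded_clinear l"
  shows "bounded_linear l" "l (c *\<^sub>C x) = c *\<^sub>C l x"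
  using assms by (auto simp: bounded_clinear_def)

lemma support_functionalI:
  fixes z :: "'a::complex_normed_space"
  assumes l: "bounded_clinear l" and le: "\<And>x. cmod (l x) \<le> norm x"
    and lz: "l z = complex_of_real (norm z)" and z: "z \<noteq> 0"
  shows "l \<in> support_functionals z"
proof -
  have "onorm l = 1"
  proof (rule antisym)
    show "onorm l \<le> 1" by (rule onorm_bound) (simp_all add: le)
    have "norm (l z) \<le> onorm l * norm z" by (rule onorm[OF bounded_clinear_linear(1)[OF l]])
    then show "1 \<le> onorm l" using z by (simp add: lz)
  qed
  then show ?thesis using l lz by (simp add: support_functionals_def)
qed

text \<open>Hahn-Banach over the complex numbers: a real norming functional \<open>\<phi>\<close> is the real part of the
  complex functional \<open>\<phi> x - \<i> \<phi> (\<i> x)\<close>, which has the same norm.\<close>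
theorem support_functionals_nonempty:
  fixes z :: "'a::complex_normed_space"
  assumes z: "z \<noteq> 0"
  shows "support_functionals z \<noteq> {}"
proof -
  obtain \<phi> where \<phi>: "linear \<phi>" "\<And>x. \<phi> x \<le> norm x" "\<phi> z = norm z"
    using real_norming_functional[of z] by blast
  define l where "l x = Complex (\<phi> x) (- \<phi> (\<i> *\<^sub>C x))" for x
  have l_add: "l (x + y) = l x + l y" for x y
    by (simp add: l_def scaleC_add_right linear_add[OF \<phi>(1)] complex_eq_iff)
  have l_R: "l (r *\<^sub>R x) = r *\<^sub>R l x" for r x
    by (simp add: l_def scaleC_scaleR linear_scale[OF \<phi>(1)] complex_eq_iff)
  have l_i: "l (\<i> *\<^sub>C x) = \<i> * l x" for x
    by (simp add: l_def scaleC_scaleC scaleC_minus_left linear_neg[OF \<phi>(1)] complex_eq_iff)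
  have l_C: "l (c *\<^sub>C x) = c * l x" for c x
  proof -
    have "c *\<^sub>C x = Re c *\<^sub>R x + Im c *\<^sub>R \<i> *\<^sub>C x"
      by (subst complex_eq[of c]) (simp add: scaleC_add_left scaleR_scaleC scaleC_scaleC mult.commute)
    then have "l (c *\<^sub>C x) = Re c * l x + Im c * (\<i> * l x)"
      by (simp add: l_add l_R l_i scaleR_conv_of_real)
    also have "\<dots> = c * l x" by (subst (3) complex_eq[of c]) (simp add: algebra_simps)
    finally show ?thesis .
  qed
  have l_le: "cmod (l x) \<le> norm x" for x
  proof (cases "l x = 0")
    case False
    \<comment> \<open>rotate \<open>l x\<close> onto the positive axis, where \<open>l\<close> agrees with the real functional\<close>
    define c where "c = cnj (l x) / cmod (l x)"
    have "l (c *\<^sub>C x) = cmod (l x)"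
      using False by (simp add: l_C c_def mult.commute divide_eq_eq power2_eq_square
          flip: complex_norm_square)
    then have "cmod (l x) = \<phi> (c *\<^sub>C x)" by (simp add: l_def complex_eq_iff)
    also have "\<dots> \<le> norm (c *\<^sub>C x)" by (rule \<phi>)
    also have "\<dots> = norm x" using False by (simp add: norm_scaleC c_def norm_divide)
    finally show ?thesis .
  qed auto
  have bl: "bounded_linear l"
    by (rule bounded_linear_intro[where K = 1]) (auto simp: l_add l_R l_le)
  have Re_lz: "Re (l z) = norm z" by (simp add: l_def \<phi>)
  have lz: "l z = norm z"
  proof -
    have "(Re (l z))\<^sup>2 + (Im (l z))\<^sup>2 \<le> (norm z)\<^sup>2"
      using l_le[of z] by (metis cmod_power2 norm_ge_zero power_mono)
    then show ?thesis using Re_lz by (simp add: complex_eq_iff)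
  qed
  have "bounded_clinear l"
    using bl l_C by (simp add: bounded_clinear_def scaleC_complex_def)
  then have "l \<in> support_functionals z" by (rule support_functionalI[OF _ l_le lz z])
  then show ?thesis by blast
qed

lemma support_functional_norm_le:
  assumes "l \<in> support_functionals z"
  shows "cmod (l x) \<le> norm x"
  using assms onorm[of l x] by (auto simp: support_functionals_def bounded_clinear_def)

text \<open>This is how estimates for scalar holomorphic functions are transferred to vector-valued ones.\<close>
lemma norm_le_by_functionals:
  fixes y :: "'a::complex_normed_space"
  assumes "0 \<le> B"
    and "\<And>l. bounded_clinear l \<Longrightarrow> (\<And>x. cmod (l x) \<le> norm x) \<Longrightarrow> cmod (l y) \<le> B"
  shows "norm y \<le> B"
proof (cases "y = 0")
  case False
  then obtain l where l: "l \<in> support_functionals y"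
    using support_functionals_nonempty by blast
  then have "cmod (l y) \<le> B"
    using assms(2)[of l] support_functional_norm_le[OF l] by (auto simp: support_functionals_def)
  then show ?thesis using l by (simp add: support_functionals_def)
qed (use assms in auto)

section \<open>Derivatives of holomorphic maps\<close>

subclass (in complex_banach) banach ..

lemma bounded_linear_scaleC: "bounded_linear (\<lambda>x::'a::complex_normed_space. c *\<^sub>C x)"
  by (rule bounded_linear_intro[where K = "cmod c"])
    (simp_all add: scaleC_add_right scaleC_scaleR norm_scaleC)

text \<open>The operators in the type \<open>'a \<Rightarrow>\<^sub>L 'b\<close> are real-linear, but complex multiplication on the codomain
  makes them a complex Banach space.  Thus \<open>fderiv F\<close> is again a map between complex normed spaces, and
  holomorphy can be iterated.\<close>
instantiation blinfun :: (real_normed_vector, complex_normed_space) complex_normed_space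
begin

definition scaleC_blinfun :: "complex \<Rightarrow> ('a \<Rightarrow>\<^sub>L 'b) \<Rightarrow> 'a \<Rightarrow>\<^sub>L 'b" where
  "scaleC_blinfun c T = Blinfun (\<lambda>x. c *\<^sub>C blinfun_apply T x)"

lemma scaleC_blinfun_apply [simp]: "blinfun_apply (c *\<^sub>C T) x = c *\<^sub>C blinfun_apply T x"
  unfolding scaleC_blinfun_def
  by (subst bounded_linear_Blinfun_apply)
    (auto intro: bounded_linear_compose[OF bounded_linear_scaleC] blinfun.bounded_linear_right)

instance
proof
  show "norm (c *\<^sub>C T) = cmod c * norm T" for c and T :: "'a \<Rightarrow>\<^sub>L 'b"
  proof -
    have le: "norm (c *\<^sub>C T) \<le> cmod c * norm T" for c and T :: "'a \<Rightarrow>\<^sub>L 'b"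
      by (rule norm_blinfun_bound)
        (auto simp: norm_scaleC mult.assoc norm_blinfun intro!: mult_left_mono)
    show ?thesis
    proof (cases "c = 0")
      case True
      then show ?thesis using le[of 0 T] by simp
    next
      case False
      have "T = (1 / c) *\<^sub>C c *\<^sub>C T"
        using False by (intro blinfun_eqI) (simp add: scaleC_scaleC)
      then have "norm T \<le> cmod (1 / c) * norm (c *\<^sub>C T)"
        using le[of "1 / c" "c *\<^sub>C T"] by simp
      then show ?thesis
        using le[of c T] False by (simp add: norm_divide field_simps)
    qed
  qed
qed (auto intro!: blinfun_eqI
    simp: scaleR_scaleC blinfun.bilinear_simps scaleC_add_right scaleC_add_left scaleC_scaleC)

end

instance blinfun :: (real_normed_vector, complex_banach) complex_banach ..

lemma holomorphic_map_fderiv: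
  assumes "holomorphic_map F S" "z \<in> S"
  shows "(F has_derivative blinfun_apply (fderiv F z)) (at z)"
    and "blinfun_apply (fderiv F z) (c *\<^sub>C x) = c *\<^sub>C blinfun_apply (fderiv F z) x"
proof -
  obtain L where L: "bounded_clinear L" "(F has_derivative L) (at z)"
    using assms by (auto simp: holomorphic_map_def)
  have "blinfun_apply (fderiv F z) = L"
    using frechet_derivative_at[OF L(2)] bounded_clinear_linear(1)[OF L(1)]
    by (simp add: fderiv_def bounded_linear_Blinfun_apply)
  then show "(F has_derivative blinfun_apply (fderiv F z)) (at z)"
    "blinfun_apply (fderiv F z) (c *\<^sub>C x) = c *\<^sub>C blinfun_apply (fderiv F z) x"
    using L bounded_clinear_linear by auto
qed

lemma fderiv_eqI:
  assumes "(F has_derivative L) (at z)"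
  shows "blinfun_apply (fderiv F z) = L"
  using frechet_derivative_at[OF assms] has_derivative_bounded_linear[OF assms]
  by (simp add: fderiv_def bounded_linear_Blinfun_apply)

lemma holomorphic_mapI:
  assumes "open S" "\<And>z. z \<in> S \<Longrightarrow> (F has_derivative L z) (at z)"
    "\<And>z c k. z \<in> S \<Longrightarrow> L z (c *\<^sub>C k) = c *\<^sub>C L z k"
  shows "holomorphic_map F S"
  unfolding holomorphic_map_def bounded_clinear_def
  using assms has_derivative_bounded_linear by blast

lemma holomorphic_map_slice:
  assumes F: "holomorphic_map F S" and l: "bounded_clinear l" and w: "z + t *\<^sub>C k \<in> S"
  shows "((\<lambda>t. l (F (z + t *\<^sub>C k)) :: complex) has_field_derivative
           l (blinfun_apply (fderiv F (z + t *\<^sub>C k)) k)) (at t)"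
proof -
  have line: "((\<lambda>t. z + t *\<^sub>C k) has_derivative (\<lambda>h. h *\<^sub>C k)) (at t)"
  proof -
    have "bounded_linear (\<lambda>h. h *\<^sub>C k)"
      by (rule bounded_linear_intro[where K = "norm k"])
        (simp_all add: scaleC_add_left scaleR_scaleC scaleC_scaleC norm_scaleC
          scaleC_complex_def)
    then show ?thesis
      by (auto intro!: derivative_eq_intros bounded_linear_imp_has_derivative)
  qed
  have "((\<lambda>t. l (F (z + t *\<^sub>C k))) has_derivative
           (\<lambda>h. l (blinfun_apply (fderiv F (z + t *\<^sub>C k)) (h *\<^sub>C k)))) (at t)"
    using has_derivative_compose[OF line holomorphic_map_fderiv(1)[OF F w]]
    by (rule bounded_linear.has_derivative[OF bounded_clinear_linear(1)[OF l]])
  then show ?thesis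
    by (simp add: has_field_derivative_def holomorphic_map_fderiv(2)[OF F w]
        bounded_clinear_linear(2)[OF l] scaleC_complex_def mult.commute[of _ "l _"])
qed

text \<open>Cauchy's inequality on discs of radius \<open>r / 2\<close> and \<open>r / 4\<close> bounds the first and second
  derivatives; Taylor's formula gives the quadratic remainder at 1.\<close>
lemma Cauchy_remainder_bounds:
  assumes g: "g holomorphic_on ball 0 r" and r: "r > 0"
    and M: "\<And>x. x \<in> ball 0 r \<Longrightarrow> cmod (g x) \<le> M"
  shows "cmod (deriv g 0) \<le> 2 * M / r"
    and "2 \<le> r \<Longrightarrow> cmod (g 1 - g 0 - deriv g 0) \<le> 32 * M / r\<^sup>2"
proof -
  have bound: "cmod ((deriv ^^ n) g x) \<le> fact n * M / s ^ n"
    if "s > 0" "norm x + s < r" for x n s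
  proof (rule Cauchy_inequality)
    have sub: "cball x s \<subseteq> ball 0 r"
      using that by (auto simp: cball_subset_ball_iff dist_norm norm_minus_commute)
    then show "g holomorphic_on ball x s" "continuous_on (cball x s) g"
      using g holomorphic_on_subset[OF g] holomorphic_on_imp_continuous_on[OF g] ball_subset_cball
      by (blast, blast intro: continuous_on_subset)
    show "cmod (g y) \<le> M" if "norm (x - y) = s" for y
      using that sub by (intro M) (auto simp: dist_norm)
  qed (use that in auto)
  show "cmod (deriv g 0) \<le> 2 * M / r"
    using bound[of "r / 2" 0 1] r by (simp add: field_simps)
  show "cmod (g 1 - g 0 - deriv g 0) \<le> 32 * M / r\<^sup>2" if "2 \<le> r"
  proof -
    have "cmod ((deriv ^^ 0) g 1 - (\<Sum>i\<le>1. (deriv ^^ i) g 0 * (1 - 0) ^ i / fact i))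
        \<le> (32 * M / r\<^sup>2) * cmod (1 - 0) ^ Suc 1 / fact 1"
    proof (rule complex_Taylor[of "cball 0 (r / 2)"])
      fix i x assume x: "x \<in> cball (0::complex) (r / 2)"
      then have "((deriv ^^ i) g has_field_derivative deriv ((deriv ^^ i) g) x) (at x)"
        using holomorphic_higher_deriv[OF g open_ball] r
        by (intro holomorphic_derivI[of _ "ball 0 r"]) auto
      then show "((deriv ^^ i) g has_field_derivative (deriv ^^ Suc i) g x) (at x within cball 0 (r / 2))"
        by (auto intro: has_field_derivative_at_within)
    next
      fix x assume x: "x \<in> cball (0::complex) (r / 2)"
      then have "cmod ((deriv ^^ 2) g x) \<le> fact 2 * M / (r / 4) ^ 2"
        using r by (intro bound) auto
      then show "cmod ((deriv ^^ Suc 1) g x) \<le> 32 * M / r\<^sup>2"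
        by (simp add: numeral_2_eq_2 power2_eq_square)
    qed (use that in auto)
    then show ?thesis by (simp add: algebra_simps)
  qed
qed

text \<open>The scalar bounds applied to \<open>t \<mapsto> l (F (z + t *\<^sub>C k))\<close>, which is holomorphic in the disc of radius
  \<open>R / norm k\<close>, for all functionals \<open>l\<close> of norm at most 1.\<close>
lemma holomorphic_map_bounds:
  fixes F :: "'a::complex_normed_space \<Rightarrow> 'b::complex_normed_space"
  assumes F: "holomorphic_map F S" and S: "ball z R \<subseteq> S" and R: "R > 0"
    and M: "\<And>w. w \<in> ball z R \<Longrightarrow> norm (F w) \<le> M"
  shows "norm (blinfun_apply (fderiv F z) k) \<le> 2 * M / R * norm k"
    and "norm k \<le> R / 2 \<Longrightarrow>
      norm (F (z + k) - F z - blinfun_apply (fderiv F z) k) \<le> 32 * M / R\<^sup>2 * (norm k)\<^sup>2"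
proof -
  have M0: "M \<ge> 0"
    by (rule order_trans[OF norm_ge_zero M[of z]]) (use R in simp)
  define r where "r = R / norm k"
  have *: "cmod (l (blinfun_apply (fderiv F z) k)) \<le> 2 * M / r \<and>
      (2 \<le> r \<longrightarrow> cmod (l (F (z + k) - F z - blinfun_apply (fderiv F z) k)) \<le> 32 * M / r\<^sup>2)"
    if l: "bounded_clinear l" "\<And>x. cmod (l x) \<le> norm x" and k: "k \<noteq> 0" for l
  proof -
    let ?g = "\<lambda>t. l (F (z + t *\<^sub>C k))"
    have r: "r > 0" using k R by (simp add: r_def)
    have in_ball: "z + t *\<^sub>C k \<in> ball z R" if "t \<in> ball 0 r" for t
      using that k by (simp add: dist_norm norm_scaleC r_def pos_less_divide_eq)
    have der: "(?g has_field_derivative l (blinfun_apply (fderiv F (z + t *\<^sub>C k)) k)) (at t)"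
      if "t \<in> ball 0 r" for t
      using in_ball[OF that] S by (intro holomorphic_map_slice[OF F l(1)]) auto
    have hol: "?g holomorphic_on ball 0 r"
      unfolding holomorphic_on_open[OF open_ball] by (intro ballI exI) (rule der)
    have bd: "cmod (?g t) \<le> M" if "t \<in> ball 0 r" for t
      using l(2) M[OF in_ball[OF that]] by (rule order_trans)
    have "deriv ?g 0 = l (blinfun_apply (fderiv F z) k)"
      using DERIV_imp_deriv[OF der[of 0]] r by simp
    moreover have "l (F (z + k) - F z - blinfun_apply (fderiv F z) k)
        = ?g 1 - ?g 0 - l (blinfun_apply (fderiv F z) k)"
      by (simp add: linear_diff[OF bounded_linear.linear[OF bounded_clinear_linear(1)[OF l(1)]]])
    ultimately show ?thesis
      using Cauchy_remainder_bounds[OF hol r bd] by metis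
  qed
  show "norm (blinfun_apply (fderiv F z) k) \<le> 2 * M / R * norm k"
  proof (cases "k = 0")
    case False
    have "norm (blinfun_apply (fderiv F z) k) \<le> 2 * M / r"
    proof (rule norm_le_by_functionals)
      show "0 \<le> 2 * M / r" using M0 R by (simp add: r_def)
    qed (rule conjunct1[OF *[OF _ _ False]])
    then show ?thesis by (simp add: r_def)
  qed simp
  show "norm (F (z + k) - F z - blinfun_apply (fderiv F z) k) \<le> 32 * M / R\<^sup>2 * (norm k)\<^sup>2"
    if "norm k \<le> R / 2"
  proof (cases "k = 0")
    case False
    then have r: "2 \<le> r" using that by (simp add: r_def field_simps)
    have "norm (F (z + k) - F z - blinfun_apply (fderiv F z) k) \<le> 32 * M / r\<^sup>2"
    proof (rule norm_le_by_functionals)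
      show "0 \<le> 32 * M / r\<^sup>2" using M0 by simp
    qed (rule mp[OF conjunct2[OF *[OF _ _ False]] r])
    then show ?thesis by (simp add: r_def power_divide)
  qed simp
qed

lemma has_derivative_quadratic:
  fixes f :: "'a::real_normed_vector \<Rightarrow> 'b::real_normed_vector"
  assumes L: "bounded_linear L" and d: "d > 0"
    and bound: "\<And>k. norm k \<le> d \<Longrightarrow> norm (f (z + k) - f z - L k) \<le> C * (norm k)\<^sup>2"
  shows "(f has_derivative L) (at z)"
  unfolding has_derivative_at
proof (intro conjI L)
  show "(\<lambda>k. norm (f (z + k) - f z - L k) / norm k) \<midarrow>0\<rightarrow> 0"
  proof (rule Lim_null_comparison)
    have "\<forall>\<^sub>F k in at 0. norm k < d"
      using d unfolding eventually_at by (intro exI[of _ d]) (auto simp: dist_norm)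
    then show "\<forall>\<^sub>F k in at 0. norm (norm (f (z + k) - f z - L k) / norm k) \<le> C * norm k"
    proof eventually_elim
      case (elim k)
      then show ?case
        using bound[of k] by (cases "k = 0") (auto simp: divide_simps power2_eq_square)
    qed
    show "(\<lambda>k. C * norm k) \<midarrow>0\<rightarrow> 0"
      by (auto intro!: tendsto_eq_intros)
  qed
qed

lemma convergent_if_null_differences:
  fixes X :: "nat \<Rightarrow> 'a::banach"
  assumes bound: "\<And>m n. norm (X m - X n) \<le> e m + e n" and e: "e \<longlonglongrightarrow> 0"
  shows "convergent X"
  unfolding Cauchy_convergent_iff[symmetric]
proof (rule CauchyI)
  fix d :: real assume "d > 0"
  then obtain N where N: "\<And>n. n \<ge> N \<Longrightarrow> \<bar>e n\<bar> < d / 2"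
    using LIMSEQ_D[OF e, of "d / 2"] by auto
  have "norm (X m - X n) < d" if "m \<ge> N" "n \<ge> N" for m n
    using bound[of m n] N[OF that(1)] N[OF that(2)] by linarith
  then show "\<exists>N. \<forall>m\<ge>N. \<forall>n\<ge>N. norm (X m - X n) < d" by blast
qed

text \<open>For a fixed direction \<open>h\<close>, the map \<open>w \<mapsto> DF(w) h\<close> is a uniform limit of the difference quotients
  \<open>G n w = (F (w + s n *\<^sub>R h) - F w) / s n\<close>.  These are holomorphic and bounded by a multiple of
  \<open>norm h\<close>, uniformly in \<open>n\<close>, so \<open>holomorphic_map_bounds\<close> makes their derivatives a Cauchy sequence
  and gives a quadratic remainder with a constant that does not depend on \<open>n\<close>; both survive the limit.
  The dependence of the constants on \<open>norm h\<close> is what later yields convergence in the operator norm.\<close>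
lemma fderiv_direction_differentiable:
  fixes F :: "'a::complex_normed_space \<Rightarrow> 'b::complex_banach"
  assumes F: "holomorphic_map F S" and S: "ball z (4 * R) \<subseteq> S" and R: "R > 0"
    and M: "\<And>w. w \<in> ball z (4 * R) \<Longrightarrow> norm (F w) \<le> M"
  obtains L where "bounded_linear L" "\<And>c k. L (c *\<^sub>C k) = c *\<^sub>C L k"
    "\<And>k. norm (L k) \<le> 18 * M / R\<^sup>2 * norm h * norm k"
    "\<And>k. norm k \<le> R / 2 \<Longrightarrow>
      norm (blinfun_apply (fderiv F (z + k)) h - blinfun_apply (fderiv F z) h - L k)
        \<le> 288 * M / R ^ 3 * norm h * (norm k)\<^sup>2"
proof -
  have M0: "M \<ge> 0"
    by (rule order_trans[OF norm_ge_zero M[of z]]) (use R in simp)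
  have bounds: "norm (blinfun_apply (fderiv F w) k) \<le> M / R * norm k"
      "norm k \<le> R \<Longrightarrow>
        norm (F (w + k) - F w - blinfun_apply (fderiv F w) k) \<le> 8 * M / R\<^sup>2 * (norm k)\<^sup>2"
    if w: "w \<in> ball z R" for w k
  proof -
    have sub: "ball w (2 * R) \<subseteq> ball z (4 * R)"
    proof
      fix y assume "y \<in> ball w (2 * R)"
      then show "y \<in> ball z (4 * R)"
        using w dist_triangle[of z y w] R by (auto simp: dist_commute)
    qed
    show "norm (blinfun_apply (fderiv F w) k) \<le> M / R * norm k"
      "norm k \<le> R \<Longrightarrow>
        norm (F (w + k) - F w - blinfun_apply (fderiv F w) k) \<le> 8 * M / R\<^sup>2 * (norm k)\<^sup>2"
      using holomorphic_map_bounds[OF F, of w "2 * R" M k] sub S M R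
      by (auto simp: power_mult_distrib subset_eq)
  qed
  \<comment> \<open>step sizes tending to 0 with \<open>norm (s n *\<^sub>R h) \<le> R\<close>, so that every quotient lives on \<open>ball z R\<close>\<close>
  define s where "s n = R / (real (Suc n) * (1 + norm h))" for n
  have h1: "1 + norm h > 0" by (rule add_pos_nonneg) auto
  have s: "s n > 0" for n
    unfolding s_def using R h1 by (intro divide_pos_pos mult_pos_pos) auto
  have sh: "norm (s n *\<^sub>R h) \<le> R" for n
  proof -
    have "norm h \<le> real (Suc n) * (1 + norm h)"
      using mult_mono[of 1 "real (Suc n)" "norm h" "1 + norm h"] by simp
    then have "norm h / (real (Suc n) * (1 + norm h)) \<le> 1"
      by (rule divide_le_eq_1_pos[THEN iffD2, rotated]) (rule mult_pos_pos, simp, rule h1)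
    then have "R * (norm h / (real (Suc n) * (1 + norm h))) \<le> R * 1"
      using R by (intro mult_left_mono) auto
    also have "R * (norm h / (real (Suc n) * (1 + norm h))) = s n * norm h"
      by (simp only: s_def times_divide_eq_left times_divide_eq_right)
    finally show ?thesis
      using s[of n] by simp
  qed
  have s0: "s \<longlonglongrightarrow> 0"
  proof -
    have "s = (\<lambda>n. R / (1 + norm h) * inverse (real (Suc n)))"
      by (auto simp: s_def field_simps)
    then show ?thesis
      using tendsto_mult_right_zero[OF LIMSEQ_inverse_real_of_nat, of "R / (1 + norm h)"] by simp
  qed
  define G where "G n w = (1 / s n) *\<^sub>R (F (w + s n *\<^sub>R h) - F w)" for n w
  define D where "D n w = (1 / s n) *\<^sub>R (fderiv F (w + s n *\<^sub>R h) - fderiv F w)" for n w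
  have wS: "w \<in> S" "w + s n *\<^sub>R h \<in> S" if "w \<in> ball z R" for w n
  proof -
    have "dist z (w + s n *\<^sub>R h) \<le> dist z w + norm (s n *\<^sub>R h)"
      by (metis add_diff_cancel_left' dist_norm dist_triangle norm_minus_commute)
    then have "w + s n *\<^sub>R h \<in> ball z (4 * R)"
      using that sh[of n] R by simp
    then show "w + s n *\<^sub>R h \<in> S" using S by blast
    show "w \<in> S" using that R by (intro subsetD[OF S]) simp
  qed
  have G_der: "(G n has_derivative blinfun_apply (D n w)) (at w)" if "w \<in> ball z R" for n w
  proof -
    have "((\<lambda>w. F (w + s n *\<^sub>R h)) has_derivative blinfun_apply (fderiv F (w + s n *\<^sub>R h))) (at w)"
      by (rule has_derivative_compose[where f = "\<lambda>w. w + s n *\<^sub>R h" and f' = "\<lambda>k. k" and g = F,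
            OF _ holomorphic_map_fderiv(1)[OF F wS(2)[OF that]]])
        (auto intro!: derivative_eq_intros)
    then show ?thesis
      unfolding G_def D_def
      using holomorphic_map_fderiv(1)[OF F wS(1)[OF that]]
      by (auto intro!: derivative_eq_intros simp: blinfun.bilinear_simps)
  qed
  have D_C: "blinfun_apply (D n w) (c *\<^sub>C k) = c *\<^sub>C blinfun_apply (D n w) k"
    if "w \<in> ball z R" for n w c k
    by (simp add: D_def blinfun.bilinear_simps scaleC_scaleR scaleC_diff_right
        holomorphic_map_fderiv(2)[OF F wS(1)[OF that]] holomorphic_map_fderiv(2)[OF F wS(2)[OF that]])
  define K where "K = 8 * M / R\<^sup>2 * (norm h)\<^sup>2"
  have G_approx: "norm (G n w - blinfun_apply (fderiv F w) h) \<le> K * s n" if "w \<in> ball z R" for n w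
  proof -
    have "G n w - blinfun_apply (fderiv F w) h
        = (1 / s n) *\<^sub>R (F (w + s n *\<^sub>R h) - F w - blinfun_apply (fderiv F w) (s n *\<^sub>R h))"
      using s[of n] by (simp add: G_def blinfun.bilinear_simps scaleR_diff_right)
    then have "norm (G n w - blinfun_apply (fderiv F w) h)
        \<le> (1 / s n) * (8 * M / R\<^sup>2 * (norm (s n *\<^sub>R h))\<^sup>2)"
      using mult_left_mono[OF bounds(2)[OF that sh[of n]], of "1 / s n"] s[of n] by simp
    then show ?thesis
      using s[of n] by (simp add: K_def power_mult_distrib power2_eq_square mult_ac)
  qed
  have G_bound: "norm (G n w) \<le> 9 * M / R * norm h" if "w \<in> ball z R" for n w
  proof -
    have "K * s n = 8 * M / R\<^sup>2 * norm h * norm (s n *\<^sub>R h)"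
      using s[of n] by (simp add: K_def power2_eq_square)
    also have "\<dots> \<le> 8 * M / R\<^sup>2 * norm h * R"
      using M0 sh by (intro mult_left_mono) auto
    also have "\<dots> = 8 * (M / R * norm h)" using R by (simp add: power2_eq_square)
    finally have "K * s n \<le> 8 * (M / R * norm h)" .
    moreover have "9 * M / R * norm h = 9 * (M / R * norm h)" by simp
    ultimately show ?thesis
      using G_approx[OF that, of n] bounds(1)[OF that, of h]
        norm_triangle_ineq[of "G n w - blinfun_apply (fderiv F w) h" "blinfun_apply (fderiv F w) h"]
      unfolding diff_add_cancel by linarith
  qed
  have z: "z \<in> ball z R" using R by simp
  have GG: "norm (blinfun_apply (D m z) k - blinfun_apply (D n z) k)
      \<le> 2 * (K * (s m + s n)) / R * norm k" for m n k
  proof -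
    let ?H = "\<lambda>w. G m w - G n w"
    have der: "(?H has_derivative blinfun_apply (D m w - D n w)) (at w)" if "w \<in> ball z R" for w
      using G_der[OF that] by (auto intro!: derivative_eq_intros simp: blinfun.bilinear_simps)
    have hol: "holomorphic_map ?H (ball z R)"
      by (rule holomorphic_mapI[OF open_ball der])
        (simp_all add: blinfun.bilinear_simps D_C scaleC_diff_right)
    have bd: "norm (?H w) \<le> K * (s m + s n)" if "w \<in> ball z R" for w
      using G_approx[OF that, of m] G_approx[OF that, of n]
        norm_triangle_ineq4[of "G m w - blinfun_apply (fderiv F w) h" "G n w - blinfun_apply (fderiv F w) h"]
      by (simp add: algebra_simps)
    show ?thesis
      using holomorphic_map_bounds(1)[OF hol subset_refl R bd, of k]
      by (simp add: fderiv_eqI[OF der[OF z]] blinfun.bilinear_simps)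
  qed
  have G_hol: "holomorphic_map (G n) (ball z R)" for n
    by (rule holomorphic_mapI[OF open_ball G_der D_C])
  note G_bounds = holomorphic_map_bounds[OF G_hol subset_refl R G_bound,
      unfolded fderiv_eqI[OF G_der[OF z]]]
  have "convergent (\<lambda>n. blinfun_apply (D n z) k)" for k
  proof (rule convergent_if_null_differences)
    show "norm (blinfun_apply (D m z) k - blinfun_apply (D n z) k)
        \<le> 2 * K / R * norm k * s m + 2 * K / R * norm k * s n" for m n
      using GG[of m k n] by (simp add: algebra_simps add_divide_distrib)
    show "(\<lambda>n. 2 * K / R * norm k * s n) \<longlonglongrightarrow> 0"
      using tendsto_mult_right_zero[OF s0] .
  qed
  then obtain L where L: "\<And>k. (\<lambda>n. blinfun_apply (D n z) k) \<longlonglongrightarrow> L k"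
    unfolding convergent_def by metis
  have L_add: "L (x + y) = L x + L y" for x y
    using L[of "x + y"] tendsto_add[OF L[of x] L[of y]]
    by (simp add: blinfun.bilinear_simps LIMSEQ_unique)
  have L_C: "L (c *\<^sub>C k) = c *\<^sub>C L k" for c k
    using L[of "c *\<^sub>C k"] bounded_linear.tendsto[OF bounded_linear_scaleC L[of k], of c]
    by (simp add: D_C[OF z] LIMSEQ_unique)
  have L_R: "L (c *\<^sub>R k) = c *\<^sub>R L k" for c k
    using L_C by (simp add: scaleR_scaleC)
  have L_bound: "norm (L k) \<le> 18 * M / R\<^sup>2 * norm h * norm k" for k
  proof (rule LIMSEQ_le_const2[OF tendsto_norm[OF L[of k]]], intro exI allI impI)
    fix n
    show "norm (blinfun_apply (D n z) k) \<le> 18 * M / R\<^sup>2 * norm h * norm k"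
      using G_bounds(1)[of n k] by (simp add: power2_eq_square)
  qed
  have G_lim: "(\<lambda>n. G n w) \<longlonglongrightarrow> blinfun_apply (fderiv F w) h" if "w \<in> ball z R" for w
  proof (rule LIM_zero_cancel, rule Lim_null_comparison)
    show "\<forall>\<^sub>F n in sequentially. norm (G n w - blinfun_apply (fderiv F w) h) \<le> K * s n"
      using G_approx[OF that] by simp
    show "(\<lambda>n. K * s n) \<longlonglongrightarrow> 0" using tendsto_mult_right_zero[OF s0] .
  qed
  have L_rem: "norm (blinfun_apply (fderiv F (z + k)) h - blinfun_apply (fderiv F z) h - L k)
        \<le> 288 * M / R ^ 3 * norm h * (norm k)\<^sup>2" if k: "norm k \<le> R / 2" for k
  proof -
    have zk: "z + k \<in> ball z R" using k R by (simp add: dist_norm)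
    have "(\<lambda>n. norm (G n (z + k) - G n z - blinfun_apply (D n z) k)) \<longlonglongrightarrow>
        norm (blinfun_apply (fderiv F (z + k)) h - blinfun_apply (fderiv F z) h - L k)"
      by (intro tendsto_intros G_lim zk z L)
    then show ?thesis
    proof (rule LIMSEQ_le_const2, intro exI allI impI)
      fix n
      show "norm (G n (z + k) - G n z - blinfun_apply (D n z) k)
          \<le> 288 * M / R ^ 3 * norm h * (norm k)\<^sup>2"
        using G_bounds(2)[OF _ k, of n] by (simp add: power2_eq_square power3_eq_cube mult.assoc)
    qed
  qed
  have "bounded_linear L"
    by (rule bounded_linear_intro[where K = "18 * M / R\<^sup>2 * norm h"])
      (auto simp: L_add L_R mult.commute[of "norm _"] intro: order_trans[OF L_bound])
  then show ?thesis using that L_C L_bound L_rem by blast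
qed

text \<open>Continuity bounds \<open>F\<close> near each point, and the directional derivatives from
  \<open>fderiv_direction_differentiable\<close> assemble to a bounded bilinear map, because the constants there are
  linear in \<open>norm h\<close>.\<close>
theorem holomorphic_fderiv:
  fixes F :: "'a::complex_normed_space \<Rightarrow> 'b::complex_banach"
  assumes F: "holomorphic_map F S"
  shows "holomorphic_map (fderiv F) S"
  unfolding holomorphic_map_def
proof (intro conjI ballI)
  show "open S" using F by (simp add: holomorphic_map_def)
  fix z assume z: "z \<in> S"
  obtain d1 where d1: "d1 > 0" "ball z d1 \<subseteq> S"
    using \<open>open S\<close> z open_contains_ball by blast
  have "isCont F z"
    using holomorphic_map_fderiv(1)[OF F z] has_derivative_continuous by blast
  then obtain d2 where d2: "d2 > 0" "\<And>w. dist w z < d2 \<Longrightarrow> dist (F w) (F z) < 1"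
    unfolding continuous_at_eps_delta using zero_less_one by blast
  define R where "R = min d1 d2 / 4"
  define M where "M = norm (F z) + 1"
  have R: "R > 0" "ball z (4 * R) \<subseteq> S"
    using d1 d2 by (auto simp: R_def subset_eq)
  have M: "norm (F w) \<le> M" if "w \<in> ball z (4 * R)" for w
    using d2(2)[of w] that norm_triangle_ineq2[of "F w" "F z"]
    by (simp add: R_def M_def dist_norm norm_minus_commute)
  have M0: "M \<ge> 0" by (simp add: M_def)
  have "\<forall>h. \<exists>L. bounded_linear L \<and> (\<forall>c k. L (c *\<^sub>C k) = c *\<^sub>C L k) \<and>
      (\<forall>k. norm (L k) \<le> 18 * M / R\<^sup>2 * norm h * norm k) \<and>
      (\<forall>k. norm k \<le> R / 2 \<longrightarrow>
        norm (blinfun_apply (fderiv F (z + k)) h - blinfun_apply (fderiv F z) h - L k)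
          \<le> 288 * M / R ^ 3 * norm h * (norm k)\<^sup>2)"
    using fderiv_direction_differentiable[OF F R(2,1) M] by metis
  then obtain B where B: "\<And>h. bounded_linear (B h)" "\<And>h c k. B h (c *\<^sub>C k) = c *\<^sub>C B h k"
      "\<And>h k. norm (B h k) \<le> 18 * M / R\<^sup>2 * norm h * norm k"
      "\<And>h k. norm k \<le> R / 2 \<Longrightarrow>
        norm (blinfun_apply (fderiv F (z + k)) h - blinfun_apply (fderiv F z) h - B h k)
          \<le> 288 * M / R ^ 3 * norm h * (norm k)\<^sup>2"
    by metis
  \<comment> \<open>\<open>B h\<close> is the derivative of \<open>w \<mapsto> DF(w) h\<close>; linearity in \<open>h\<close> comes from uniqueness of derivatives\<close>
  have B_der: "((\<lambda>w. blinfun_apply (fderiv F w) h) has_derivative B h) (at z)" for h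
  proof (rule has_derivative_quadratic[OF B(1)])
    show "R / 2 > 0" using R(1) by simp
  qed (rule B(4))
  have B_add: "B (h + h') = (\<lambda>k. B h k + B h' k)" for h h'
    using has_derivative_add[OF B_der[of h] B_der[of h']] B_der[of "h + h'"]
    by (simp add: blinfun.bilinear_simps has_derivative_unique)
  have B_R: "B (r *\<^sub>R h) = (\<lambda>k. r *\<^sub>R B h k)" for r h
    using has_derivative_scaleR_right[OF B_der[of h], of r] B_der[of "r *\<^sub>R h"]
    by (simp add: blinfun.bilinear_simps has_derivative_unique)
  define D where "D k = Blinfun (\<lambda>h. B h k)" for k
  have D: "blinfun_apply (D k) h = B h k" for k h
    unfolding D_def
    by (subst bounded_linear_Blinfun_apply)
      (auto intro!: bounded_linear_intro[where K = "18 * M / R\<^sup>2 * norm k"]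
        order_trans[OF B(3)] simp: B_add B_R mult_ac)
  have D_bound: "norm (D k) \<le> norm k * (18 * M / R\<^sup>2)" for k
    using B(3) M0 by (intro norm_blinfun_bound) (auto simp: D mult_ac)
  have D_lin: "bounded_linear D"
    by (rule bounded_linear_intro[OF _ _ D_bound])
      (auto intro!: blinfun_eqI simp: D blinfun.bilinear_simps
        linear_add[OF bounded_linear.linear[OF B(1)]] linear_scale[OF bounded_linear.linear[OF B(1)]])
  have "bounded_clinear D"
    unfolding bounded_clinear_def using D_lin B(2) by (auto intro!: blinfun_eqI simp: D)
  moreover have "(fderiv F has_derivative D) (at z)"
  proof (rule has_derivative_quadratic[OF D_lin])
    show "R / 2 > 0" using R by simp
    show "norm (fderiv F (z + k) - fderiv F z - D k) \<le> 288 * M / R ^ 3 * (norm k)\<^sup>2"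
      if "norm k \<le> R / 2" for k
      using B(4)[OF that] M0 R(1)
      by (intro norm_blinfun_bound) (auto simp: D blinfun.bilinear_simps mult_ac)
  qed
  ultimately show "\<exists>L. bounded_clinear L \<and> (fderiv F has_derivative L) (at z)" by blast
qed

section \<open>Coefficients of holomorphic self-maps of the disc\<close>

lemma cmod_moebius_le:
  assumes "cmod a \<le> 1" "cmod b \<le> 1"
  shows "cmod (b - a) \<le> cmod (1 - cnj a * b)"
proof (rule power2_le_imp_le)
  have "(cmod (1 - cnj a * b))\<^sup>2 - (cmod (b - a))\<^sup>2 = (1 - (cmod a)\<^sup>2) * (1 - (cmod b)\<^sup>2)"
    unfolding cmod_power2 by (simp add: power2_eq_square algebra_simps)
  moreover have "\<dots> \<ge> 0"
    using assms by (intro mult_nonneg_nonneg) (simp_all add: power_le_one)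
  ultimately show "(cmod (b - a))\<^sup>2 \<le> (cmod (1 - cnj a * b))\<^sup>2" by linarith
qed simp

text \<open>One step of Schur's algorithm: the Moebius map sending \<open>f 0\<close> to 0 keeps the values of \<open>f\<close> in the
  closed disc, and by the maximum principle a factor \<open>z\<close> can be divided out without leaving it.
  The relation is stated without division, so that it can be read off on power series.\<close>
lemma schur_step:
  assumes f: "f holomorphic_on ball 0 1" and bd: "\<And>z. z \<in> ball 0 1 \<Longrightarrow> cmod (f z) \<le> 1"
    and f0: "cmod (f 0) < 1"
  obtains g where "g holomorphic_on ball 0 1" "\<And>z. z \<in> ball 0 1 \<Longrightarrow> cmod (g z) \<le> 1"
    "\<And>z. z \<in> ball 0 1 \<Longrightarrow> f z - f 0 = z * g z * (1 - cnj (f 0) * f z)"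
proof -
  have pos: "1 - cnj (f 0) * f z \<noteq> 0" if "z \<in> ball 0 1" for z
  proof
    assume "1 - cnj (f 0) * f z = 0"
    then have "cmod (f 0) * cmod (f z) = 1"
      by (metis complex_mod_cnj norm_mult norm_one right_minus_eq)
    moreover have "cmod (f 0) * cmod (f z) \<le> cmod (f 0) * 1"
      using bd[OF that] by (intro mult_left_mono) auto
    ultimately show False using f0 by simp
  qed
  define h where "h z = (f z - f 0) / (1 - cnj (f 0) * f z)" for z
  have h: "h holomorphic_on ball 0 1"
    unfolding h_def using f pos by (intro holomorphic_intros) auto
  have hbd: "cmod (h z) \<le> 1" if "z \<in> ball 0 1" for z
  proof -
    have "cmod (f z - f 0) \<le> cmod (1 - cnj (f 0) * f z)"
      using bd[OF that] f0 by (intro cmod_moebius_le) simp_all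
    then show ?thesis using pos[OF that] by (simp add: h_def norm_divide)
  qed
  obtain g where g: "g holomorphic_on ball 0 1" "\<And>z. cmod z < 1 \<Longrightarrow> h z = z * g z"
    using Schwarz3[OF h] by (auto simp: h_def)
  \<comment> \<open>on the circle of radius \<open>s\<close> the quotient is at most \<open>1 / s\<close>; let \<open>s\<close> tend to 1\<close>
  have gbd: "cmod (g z) \<le> 1" if z: "z \<in> ball 0 1" for z
  proof (rule field_le_mult_one_interval)
    fix t :: real assume t: "0 < t" "t < 1"
    define s where "s = max t (cmod z)"
    have s: "0 < s" "s < 1" "cmod z \<le> s" "t \<le> s" using t z by (auto simp: s_def)
    have "cmod (g z) \<le> 1 / s"
    proof (rule maximum_modulus_frontier[of g "cball 0 s"])
      show "g holomorphic_on interior (cball 0 s)"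
        using s by (intro holomorphic_on_subset[OF g(1)]) auto
      show "continuous_on (closure (cball 0 s)) g"
        using s by (intro continuous_on_subset[OF holomorphic_on_imp_continuous_on[OF g(1)]]) auto
      fix w assume "w \<in> frontier (cball (0::complex) s)"
      then have w: "cmod w = s" using s by (simp add: frontier_cball)
      then have "s * cmod (g w) \<le> 1"
        using hbd[of w] g(2)[of w] s by (simp add: norm_mult)
      then show "cmod (g w) \<le> 1 / s" using s by (simp add: field_simps)
    qed (use s in auto)
    then have "s * cmod (g z) \<le> 1" using s by (simp add: field_simps)
    then show "t * cmod (g z) \<le> 1"
      using mult_right_mono[OF s(4), of "cmod (g z)"] by simp
  qed
  show ?thesis
  proof (rule that[OF g(1) gbd])
    show "f z - f 0 = z * g z * (1 - cnj (f 0) * f z)" if "z \<in> ball 0 1" for z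
      using g(2)[of z] pos[OF that] that by (simp add: h_def divide_eq_eq)
  qed auto
qed

lemma unimodular_value_constant:
  assumes f: "f holomorphic_on ball 0 1" and bd: "\<And>z. z \<in> ball 0 1 \<Longrightarrow> cmod (f z) \<le> 1"
    and f0: "cmod (f 0) = 1" and z: "z \<in> ball 0 1"
  shows "f z = f 0"
proof -
  have "f constant_on ball 0 1"
    by (rule maximum_modulus_principle[OF f, where U = "ball 0 1" and \<xi> = 0]) (use bd f0 in auto)
  then show ?thesis using z by (auto simp: constant_on_def)
qed

definition taylor_coeff :: "(complex \<Rightarrow> complex) \<Rightarrow> nat \<Rightarrow> complex" where
  "taylor_coeff f n = fps_nth (fps_expansion f 0) n"

lemma has_fps_expansion_disc:
  assumes "f holomorphic_on ball 0 r" "r > 0"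
  shows "f has_fps_expansion fps_expansion f 0"
  using assms analytic_at_ball[of f 0] 
  by (intro analytic_at_imp_has_fps_expansion_0) auto

lemma taylor_coeff_eq_fps_nth: "f has_fps_expansion F \<Longrightarrow> taylor_coeff f n = fps_nth F n"
  by (simp add: taylor_coeff_def fps_expansion_def fps_nth_fps_expansion)

lemma fps_expansion_unique_on_disc:
  fixes f g :: "complex \<Rightarrow> complex"
  assumes r: "r > 0" and f: "f has_fps_expansion F" and g: "g has_fps_expansion G"
    and eq: "\<And>z. z \<in> ball 0 r \<Longrightarrow> f z = g z"
  shows "F = G"
proof -
  have "eventually (\<lambda>z. f z = g z) (nhds (0::complex))"
    using eq r by (intro eventually_nhds_in_open[of "ball 0 r", THEN eventually_mono]) auto
  then show ?thesis
    using f g fps_expansion_unique_complex has_fps_expansion_cong by metis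
qed

text \<open>The Schwarz-Pick inequality at 0.\<close>
lemma disc_self_map_coeff_le:
  assumes f: "f holomorphic_on ball 0 1" and bd: "\<And>z. z \<in> ball 0 1 \<Longrightarrow> cmod (f z) \<le> 1"
  shows "cmod (taylor_coeff f 1) \<le> 1 - (cmod (taylor_coeff f 0))\<^sup>2"
proof -
  define P where "P = fps_expansion f 0"
  have P: "f has_fps_expansion P" unfolding P_def by (rule has_fps_expansion_disc[OF f]) simp
  have P0: "fps_nth P 0 = f 0" using has_fps_expansion_imp_0_eq_fps_nth_0[OF P] by simp
  show ?thesis
  proof (cases "cmod (f 0) < 1")
    case True
    obtain g where g: "g holomorphic_on ball 0 1" "\<And>z. z \<in> ball 0 1 \<Longrightarrow> cmod (g z) \<le> 1"
      "\<And>z. z \<in> ball 0 1 \<Longrightarrow> f z - f 0 = z * g z * (1 - cnj (f 0) * f z)"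
      using schur_step[OF f bd True] by blast
    define Q where "Q = fps_expansion g 0"
    have Q: "g has_fps_expansion Q" unfolding Q_def by (rule has_fps_expansion_disc[OF g(1)]) simp
    have "P - fps_const (f 0) = fps_X * Q * (1 - fps_const (cnj (f 0)) * P)"
      by (rule fps_expansion_unique_on_disc[OF zero_less_one
            has_fps_expansion_diff[OF P has_fps_expansion_const]
            has_fps_expansion_mult[OF has_fps_expansion_mult[OF has_fps_expansion_fps_X Q]
              has_fps_expansion_diff[OF has_fps_expansion_1 has_fps_expansion_cmult_left[OF P]]]
            g(3)])
    then have "fps_nth P 1 = fps_nth Q 0 * (1 - cnj (f 0) * f 0)"
      by (auto dest!: arg_cong[of _ _ "\<lambda>F. fps_nth F 1"] simp: fps_mult_nth P0 mult.assoc)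
    also have "1 - cnj (f 0) * f 0 = complex_of_real (1 - (cmod (f 0))\<^sup>2)"
      by (simp add: complex_norm_square[symmetric] mult.commute)
    finally have "cmod (fps_nth P 1) = cmod (fps_nth Q 0) * \<bar>1 - (cmod (f 0))\<^sup>2\<bar>"
      by (simp only: norm_mult norm_of_real)
    moreover have "cmod (fps_nth Q 0) \<le> 1"
      using g(2)[of 0] has_fps_expansion_imp_0_eq_fps_nth_0[OF Q] by simp
    moreover have "1 - (cmod (f 0))\<^sup>2 \<ge> 0" using True by (simp add: power_le_one)
    ultimately show ?thesis
      unfolding taylor_coeff_def P_def[symmetric] P0
      using mult_right_mono[of "cmod (fps_nth Q 0)" 1 "1 - (cmod (f 0))\<^sup>2"] by simp
  next
    case False
    then have one: "cmod (f 0) = 1" using bd[of 0] by simp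
    have "P = fps_const (f 0)"
      by (rule fps_expansion_unique_on_disc[OF zero_less_one P has_fps_expansion_const])
        (rule unimodular_value_constant[OF f bd one])
    then show ?thesis
      unfolding taylor_coeff_def P_def[symmetric] by (simp add: one)
  qed
qed

text \<open>Two Schur steps.  With \<open>x = f 0\<close>, the first step produces a self-map \<open>g\<close> whose coefficients are
  \<open>y\<close> and \<open>s\<close>, and the bound on \<open>s\<close> is \<open>disc_self_map_coeff_le\<close> for \<open>g\<close>.  If \<open>\<bar>x\<bar> = 1\<close>, then \<open>f\<close> is
  constant.\<close>
lemma schur_parameters:
  assumes f: "f holomorphic_on ball 0 1" and bd: "\<And>z. z \<in> ball 0 1 \<Longrightarrow> cmod (f z) \<le> 1"
  defines "x \<equiv> taylor_coeff f 0"
  obtains y s :: complex where "cmod x \<le> 1" "cmod y \<le> 1" "cmod s \<le> 1 - (cmod y)\<^sup>2"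
    "taylor_coeff f 1 = (1 - (cmod x)\<^sup>2) * y"
    "taylor_coeff f 2 = (1 - (cmod x)\<^sup>2) * (s - cnj x * y\<^sup>2)"
proof -
  define P where "P = fps_expansion f 0"
  have P: "f has_fps_expansion P" unfolding P_def by (rule has_fps_expansion_disc[OF f]) simp
  have P0: "fps_nth P 0 = f 0" using has_fps_expansion_imp_0_eq_fps_nth_0[OF P] by simp
  have x: "x = f 0" by (simp add: x_def taylor_coeff_def P_def[symmetric] P0)
  have x1: "cmod x \<le> 1" using bd[of 0] by (simp add: x)
  show ?thesis
  proof (cases "cmod (f 0) < 1")
    case True
    obtain g where g: "g holomorphic_on ball 0 1" "\<And>z. z \<in> ball 0 1 \<Longrightarrow> cmod (g z) \<le> 1"
      "\<And>z. z \<in> ball 0 1 \<Longrightarrow> f z - f 0 = z * g z * (1 - cnj (f 0) * f z)"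
      using schur_step[OF f bd True] by blast
    define Q where "Q = fps_expansion g 0"
    have Q: "g has_fps_expansion Q" unfolding Q_def by (rule has_fps_expansion_disc[OF g(1)]) simp
    have eq: "P - fps_const (f 0) = fps_X * Q * (1 - fps_const (cnj (f 0)) * P)"
      by (rule fps_expansion_unique_on_disc[OF zero_less_one
            has_fps_expansion_diff[OF P has_fps_expansion_const]
            has_fps_expansion_mult[OF has_fps_expansion_mult[OF has_fps_expansion_fps_X Q]
              has_fps_expansion_diff[OF has_fps_expansion_1 has_fps_expansion_cmult_left[OF P]]]
            g(3)])
    have n: "1 - cnj x * x = 1 - (complex_of_real (cmod x))\<^sup>2"
      by (simp add: complex_norm_square[symmetric] mult.commute)
    have "fps_nth P 1 = fps_nth Q 0 * (1 - cnj x * x)"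
      using arg_cong[OF eq, of "\<lambda>F. fps_nth F 1"] by (simp add: fps_mult_nth P0 x mult.assoc)
    then have P1: "fps_nth P 1 = (1 - (cmod x)\<^sup>2) * fps_nth Q 0"
      unfolding n by simp
    have "fps_nth P 2 = fps_nth Q 1 * (1 - cnj x * x) - fps_nth Q 0 * cnj x * fps_nth P 1"
      using arg_cong[OF eq, of "\<lambda>F. fps_nth F 2"]
      by (simp add: fps_mult_nth P0 x mult.assoc numeral_2_eq_2)
    then have P2: "fps_nth P 2 = (1 - (cmod x)\<^sup>2) * (fps_nth Q 1 - cnj x * (fps_nth Q 0)\<^sup>2)"
      unfolding n P1 by (simp add: algebra_simps power2_eq_square)
    show ?thesis
    proof (rule that[of "fps_nth Q 0" "fps_nth Q 1", OF x1])
      show "cmod (fps_nth Q 0) \<le> 1"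
        using g(2)[of 0] has_fps_expansion_imp_0_eq_fps_nth_0[OF Q] by simp
      show "cmod (fps_nth Q 1) \<le> 1 - (cmod (fps_nth Q 0))\<^sup>2"
        using disc_self_map_coeff_le[OF g(1,2)] by (simp add: taylor_coeff_def Q_def)
    qed (use P1 P2 in \<open>simp_all add: taylor_coeff_def P_def\<close>)
  next
    case False
    then have one: "cmod (f 0) = 1" using bd[of 0] by simp
    have "P = fps_const (f 0)"
      by (rule fps_expansion_unique_on_disc[OF zero_less_one P has_fps_expansion_const])
        (rule unimodular_value_constant[OF f bd one])
    then show ?thesis
      by (intro that[of 0 1]) (simp_all add: taylor_coeff_def P_def[symmetric] one x)
  qed
qed

text \<open>The two-parameter maximum behind the sharp estimate, with \<open>a = \<bar>x\<bar>\<close> and \<open>b = \<bar>y\<bar>\<close> for the Schur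
  parameters \<open>x, y\<close>.  For fixed \<open>a\<close> the left-hand side is a concave quadratic in \<open>b\<close> with vertex
  \<open>\<beta> a / (1 - a)\<close>.  If the vertex is at least 1, the maximum is at \<open>b = 1\<close> and is the cubic at \<open>a\<close>.
  Otherwise \<open>a \<le> 1 / (1 + \<beta>)\<close>, and the value at the vertex, \<open>1 + a\<^sup>2 (c a - d)\<close>, is at most 1 or
  increases up to \<open>a = 1 / (1 + \<beta>)\<close>, where it meets the cubic.\<close>
lemma schur_triangle_bound:
  fixes a b \<beta> A K :: real
  assumes \<beta>: "0 < \<beta>" and a: "0 \<le> a" "a \<le> 1" and b: "0 \<le> b" "b \<le> 1" and A: "0 \<le> A" and K: "1 \<le> K"
    and cubic: "\<And>t. 0 \<le> t \<Longrightarrow> t \<le> 1 \<Longrightarrow> (1 + 2 * \<beta>) * (t - t ^ 3) + A * t ^ 3 \<le> K"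
  shows "(1 - a\<^sup>2) * (1 - b\<^sup>2 + a * b\<^sup>2 + 2 * \<beta> * a * b) + A * a ^ 3 \<le> K"
proof (cases "a * (1 + \<beta>) \<le> 1")
  case False
  \<comment> \<open>the quadratic in \<open>b\<close> is increasing on \<open>[0, 1]\<close>\<close>
  have a2: "0 \<le> 1 - a\<^sup>2" using a by (simp add: power_le_one)
  have "1 - b\<^sup>2 + a * b\<^sup>2 + 2 * \<beta> * a * b \<le> a + 2 * \<beta> * a"
  proof -
    have "(1 - a) * (1 + b) \<le> \<beta> * a * 2"
      using mult_mono[of "1 - a" "\<beta> * a" "1 + b" 2] False a b \<beta> by (simp add: algebra_simps)
    then have "0 \<le> (1 - b) * (2 * \<beta> * a - (1 - a) * (1 + b))"
      using b by (intro mult_nonneg_nonneg) (auto simp: algebra_simps)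
    then show ?thesis by (simp add: algebra_simps power2_eq_square)
  qed
  then have "(1 - a\<^sup>2) * (1 - b\<^sup>2 + a * b\<^sup>2 + 2 * \<beta> * a * b) \<le> (1 - a\<^sup>2) * (a + 2 * \<beta> * a)"
    using a2 by (rule mult_left_mono)
  also have "\<dots> = (1 + 2 * \<beta>) * (a - a ^ 3)"
    by (simp add: algebra_simps power2_eq_square power3_eq_cube)
  finally show ?thesis using cubic[OF a] by simp
next
  case True
  \<comment> \<open>complete the square in \<open>b\<close>; the result is monotone where it exceeds 1\<close>
  define c where "c = \<beta>\<^sup>2 + A"
  define d where "d = 1 - \<beta>\<^sup>2"
  have a1: "a < 1" using True mult_pos_pos[OF \<beta>, of a] a(1)
    by (cases "a = 0") (simp_all add: algebra_simps)
  have bound: "(1 - a\<^sup>2) * (1 - b\<^sup>2 + a * b\<^sup>2 + 2 * \<beta> * a * b) + A * a ^ 3 \<le> 1 + a\<^sup>2 * (c * a - d)"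
  proof -
    have "1 + a\<^sup>2 * (c * a - d) - ((1 - a\<^sup>2) * (1 - b\<^sup>2 + a * b\<^sup>2 + 2 * \<beta> * a * b) + A * a ^ 3)
        = (1 + a) * ((1 - a) * b - \<beta> * a)\<^sup>2"
      by (simp add: c_def d_def algebra_simps power2_eq_square power3_eq_cube)
    moreover have "\<dots> \<ge> 0" using a by simp
    ultimately show ?thesis by simp
  qed
  show ?thesis
  proof (cases "c * a - d \<le> 0")
    case True
    then have "a\<^sup>2 * (c * a - d) \<le> 0" by (simp add: mult_nonneg_nonpos)
    then show ?thesis using bound K by simp
  next
    case False
    define e where "e = 1 / (1 + \<beta>)"
    have e: "0 \<le> e" "e \<le> 1" "a \<le> e" using \<beta> True by (auto simp: e_def field_simps)
    have \<beta>e: "\<beta> * e = 1 - e" using \<beta> by (simp add: e_def field_simps)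
    have "c * a \<le> c * e" using A e by (intro mult_left_mono) (auto simp: c_def)
    then have mono: "a\<^sup>2 * (c * a - d) \<le> e\<^sup>2 * (c * e - d)"
      using False a e by (intro mult_mono power_mono) auto
    have "e\<^sup>2 * (c * e - d) = (\<beta> * e)\<^sup>2 * (1 + e) - e\<^sup>2 + A * e ^ 3"
      by (simp add: c_def d_def algebra_simps power2_eq_square power3_eq_cube)
    moreover have "(1 + 2 * \<beta>) * (e - e ^ 3) = (e + 2 * (\<beta> * e)) * (1 - e\<^sup>2)"
      by (simp add: algebra_simps power2_eq_square power3_eq_cube)
    ultimately have "1 + e\<^sup>2 * (c * e - d) = (1 + 2 * \<beta>) * (e - e ^ 3) + A * e ^ 3"
      unfolding \<beta>e by (simp add: algebra_simps power2_eq_square power3_eq_cube)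
    then show ?thesis using bound mono cubic[OF e(1,2)] by simp
  qed
qed

section \<open>Subordination to the sector map\<close>

lemma Re_half_plane_pos:
  assumes "cmod \<zeta> < 1"
  shows "Re ((1 + \<zeta>) / (1 - \<zeta>)) > 0"
proof -
  have "Re ((1 + \<zeta>) * cnj (1 - \<zeta>)) = 1 - (cmod \<zeta>)\<^sup>2"
    unfolding cmod_power2 by (simp add: algebra_simps power2_eq_square)
  moreover have "(cmod \<zeta>)\<^sup>2 < 1" using assms by (simp add: power_less_one_iff abs_square_less_1)
  ultimately show ?thesis by (subst Re_complex_div_gt_0) simp
qed

lemma Ln_exp_strip: "\<bar>Im z\<bar> < pi \<Longrightarrow> Ln (exp z) = z"
  by (rule Ln_exp) (auto simp: abs_less_iff)

lemma Phi_0 [simp]: "\<Phi> \<beta> 0 = 1"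
  by (simp add: \<Phi>_def)

lemma Phi_has_field_derivative:
  assumes \<zeta>: "cmod \<zeta> < 1"
  shows "(\<Phi> \<beta> has_field_derivative 2 * \<beta> * \<Phi> \<beta> \<zeta> / (1 - \<zeta>\<^sup>2)) (at \<zeta>)"
proof -
  define B where "B = (1 + \<zeta>) / (1 - \<zeta>)"
  have ne: "1 - \<zeta> \<noteq> 0" "1 + \<zeta> \<noteq> 0"
    using \<zeta> by (auto simp: add_eq_0_iff)
  have B: "B \<notin> \<real>\<^sub>\<le>\<^sub>0" "B \<noteq> 0"
    using Re_half_plane_pos[OF \<zeta>] unfolding B_def[symmetric] by (auto simp: complex_nonpos_Reals_iff)
  have "((\<lambda>\<zeta>. (1 + \<zeta>) / (1 - \<zeta>)) has_field_derivative 2 / (1 - \<zeta>)\<^sup>2) (at \<zeta>)"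
    using ne by (auto intro!: derivative_eq_intros simp: power2_eq_square)
  then have "(\<Phi> \<beta> has_field_derivative \<beta> * B powr (complex_of_real \<beta> - 1) * (2 / (1 - \<zeta>)\<^sup>2)) (at \<zeta>)"
    unfolding \<Phi>_def B_def
    by (rule DERIV_chain2[where f = "\<lambda>z. z powr complex_of_real \<beta>" and g = "\<lambda>\<zeta>. (1 + \<zeta>) / (1 - \<zeta>)",
          OF has_field_derivative_powr[OF B(1)[unfolded B_def]]])
  moreover have "\<beta> * B powr (complex_of_real \<beta> - 1) * (2 / (1 - \<zeta>)\<^sup>2) = 2 * \<beta> * \<Phi> \<beta> \<zeta> / (1 - \<zeta>\<^sup>2)"
  proof -
    have "1 - \<zeta>\<^sup>2 = (1 - \<zeta>) * (1 + \<zeta>)" by (simp add: algebra_simps power2_eq_square)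
    then have "B * (1 - \<zeta>)\<^sup>2 = 1 - \<zeta>\<^sup>2"
      using ne by (simp add: B_def power2_eq_square)
    then show ?thesis
      using B(2) by (simp add: \<Phi>_def B_def[symmetric] powr_diff)
  qed
  ultimately show ?thesis by simp
qed

lemma Phi_neq_0: "cmod \<zeta> < 1 \<Longrightarrow> \<Phi> \<beta> \<zeta> \<noteq> 0"
  using Re_half_plane_pos[of \<zeta>] by (auto simp: \<Phi>_def)

lemma Phi_Arg_less:
  assumes \<zeta>: "cmod \<zeta> < 1" and \<beta>: "0 < \<beta>" "\<beta> \<le> 1"
  shows "\<bar>Arg (\<Phi> \<beta> \<zeta>)\<bar> < pi / 2 * \<beta>"
proof -
  define B where "B = (1 + \<zeta>) / (1 - \<zeta>)"
  have B: "Re B > 0" using Re_half_plane_pos[OF \<zeta>] by (simp add: B_def)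
  then have B0: "B \<noteq> 0" by auto
  have im: "\<bar>Im (Ln B)\<bar> < pi / 2" using Re_Ln_pos_lt[OF B0] B by blast
  have Phi: "\<Phi> \<beta> \<zeta> = exp (\<beta> * Ln B)" using B0 by (simp add: \<Phi>_def B_def powr_def)
  have lt: "\<bar>\<beta> * Im (Ln B)\<bar> < pi / 2 * \<beta>"
    using im \<beta> by (simp add: abs_mult mult.commute)
  moreover have "pi / 2 * \<beta> < pi"
    using \<beta> mult_mono[of "pi / 2" "pi / 2" \<beta> 1] pi_gt_zero by linarith
  ultimately have "\<bar>\<beta> * Im (Ln B)\<bar> < pi" by linarith
  then have "Ln (exp (\<beta> * Ln B)) = \<beta> * Ln B"
    by (intro Ln_exp_strip) simp
  then have "Arg (\<Phi> \<beta> \<zeta>) = \<beta> * Im (Ln B)"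
    by (simp add: Phi Arg_eq_Im_Ln)
  then show ?thesis using lt by simp
qed

text \<open>The power \<open>p powr (1 / \<beta>)\<close> has positive real part, and the Cayley transform maps the right
  half-plane to the disc.\<close>
lemma subordinate_to_Phi:
  assumes p: "p holomorphic_on ball 0 1" and p0: "p 0 = 1" and \<beta>: "0 < \<beta>" "\<beta> \<le> 1"
    and sector: "\<And>z. z \<in> ball 0 1 \<Longrightarrow> p z \<noteq> 0 \<and> \<bar>Arg (p z)\<bar> < pi / 2 * \<beta>"
  obtains \<omega> where "\<omega> holomorphic_on ball 0 1" "\<omega> 0 = 0" "\<And>z. z \<in> ball 0 1 \<Longrightarrow> cmod (\<omega> z) < 1"
    "\<And>z. z \<in> ball 0 1 \<Longrightarrow> p z = \<Phi> \<beta> (\<omega> z)"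
proof -
  have sector': "p z \<notin> \<real>\<^sub>\<le>\<^sub>0 \<and> \<bar>Im (Ln (p z)) / \<beta>\<bar> < pi / 2" if "z \<in> ball 0 1" for z
  proof -
    have A: "\<bar>Im (Ln (p z))\<bar> < pi / 2 * \<beta>" "p z \<noteq> 0"
      using sector[OF that] by (auto simp: Arg_eq_Im_Ln)
    have "pi / 2 * \<beta> \<le> pi / 2"
      using \<beta> mult_left_mono[of \<beta> 1 "pi / 2"] by simp
    then have "\<bar>Im (Ln (p z))\<bar> < pi / 2" using A by linarith
    then have "Re (p z) > 0" using A(2) Re_Ln_pos_lt by blast
    then show ?thesis
      using A \<beta> by (auto simp: complex_nonpos_Reals_iff abs_divide pos_divide_less_eq)
  qed
  define P where "P z = exp (Ln (p z) / \<beta>)" for z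
  have ReP: "Re (P z) > 0" if "z \<in> ball 0 1" for z
  proof -
    have "cos (Im (Ln (p z)) / \<beta>) > 0"
      using sector'[OF that] unfolding abs_less_iff by (intro cos_gt_zero_pi) linarith+
    then show ?thesis by (simp add: P_def Re_exp)
  qed
  have P1: "P z + 1 \<noteq> 0" if "z \<in> ball 0 1" for z
    using ReP[OF that] by (auto simp: complex_eq_iff)
  define \<omega> where "\<omega> z = (P z - 1) / (P z + 1)" for z
  show ?thesis
  proof (rule that)
    have "P holomorphic_on ball 0 1"
      unfolding P_def using p sector' \<beta> by (intro holomorphic_intros) auto
    then show "\<omega> holomorphic_on ball 0 1"
      unfolding \<omega>_def using P1 by (intro holomorphic_intros) auto
    show "\<omega> 0 = 0" by (simp add: \<omega>_def P_def p0)
    fix z :: complex assume z: "z \<in> ball 0 1"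
    have "(cmod (P z - 1))\<^sup>2 < (cmod (P z + 1))\<^sup>2"
      unfolding cmod_power2 using ReP[OF z] by (simp add: power2_eq_square algebra_simps)
    then have "cmod (P z - 1) < cmod (P z + 1)" by (rule power2_less_imp_less) simp
    then show "cmod (\<omega> z) < 1" using P1[OF z] by (simp add: \<omega>_def norm_divide)
    have "(1 + \<omega> z) / (1 - \<omega> z) = P z"
    proof -
      have "1 + \<omega> z = 2 * P z / (P z + 1)" "1 - \<omega> z = 2 / (P z + 1)"
        using P1[OF z] by (simp_all add: \<omega>_def field_simps)
      then show ?thesis using P1[OF z] by simp
    qed
    moreover have "Ln (P z) = Ln (p z) / \<beta>"
      unfolding P_def
    proof (rule Ln_exp_strip)
      show "\<bar>Im (Ln (p z) / \<beta>)\<bar> < pi"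
        using order_less_trans[OF conjunct2[OF sector'[OF z]], of pi] by simp
    qed
    ultimately show "p z = \<Phi> \<beta> (\<omega> z)"
      using \<beta> sector[OF z] by (simp add: \<Phi>_def powr_def P_def)
  qed
qed

lemma Phi_compose_has_field_derivative:
  assumes "\<omega> holomorphic_on ball 0 1" "\<And>z. z \<in> ball 0 1 \<Longrightarrow> cmod (\<omega> z) < 1" "z \<in> ball 0 1"
  shows "((\<lambda>z. \<Phi> \<beta> (\<omega> z)) has_field_derivative
    2 * \<beta> * \<Phi> \<beta> (\<omega> z) / (1 - (\<omega> z)\<^sup>2) * deriv \<omega> z) (at z)"
  using DERIV_chain2[OF Phi_has_field_derivative holomorphic_derivI[OF assms(1) open_ball assms(3)]]
    assms by blast

lemma Phi_compose_holomorphic: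
  assumes "\<omega> holomorphic_on ball 0 1" "\<And>z. z \<in> ball 0 1 \<Longrightarrow> cmod (\<omega> z) < 1"
  shows "(\<lambda>z. \<Phi> \<beta> (\<omega> z)) holomorphic_on ball 0 1"
  unfolding holomorphic_on_open[OF open_ball]
  by (intro ballI exI) (rule Phi_compose_has_field_derivative[OF assms])

text \<open>Coefficient comparison in \<open>p' (1 - \<omega>\<^sup>2) = 2 \<beta> \<omega>' p\<close> for \<open>p = \<Phi> \<beta> \<circ> \<omega>\<close>.\<close>
lemma Phi_compose_coeffs:
  fixes \<beta> :: real and w c :: "nat \<Rightarrow> complex"
  assumes \<omega>: "\<omega> holomorphic_on ball 0 1" "\<omega> 0 = 0"
    and \<omega>1: "\<And>z. z \<in> ball 0 1 \<Longrightarrow> cmod (\<omega> z) < 1"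
  defines "w \<equiv> taylor_coeff \<omega>" and "c \<equiv> taylor_coeff (\<lambda>z. \<Phi> \<beta> (\<omega> z))"
  shows "c 1 = 2 * \<beta> * w 1"
    and "c 2 = 2 * \<beta> * w 2 + 2 * \<beta>\<^sup>2 * (w 1)\<^sup>2"
    and "c 3 = 2 * \<beta> * w 3 + 4 * \<beta>\<^sup>2 * w 1 * w 2 + (2 * \<beta> / 3 + 4 * \<beta> ^ 3 / 3) * w 1 ^ 3"
proof -
  let ?p = "\<lambda>z. \<Phi> \<beta> (\<omega> z)"
  define W where "W = fps_expansion \<omega> 0"
  define P where "P = fps_expansion ?p 0"
  have W: "\<omega> has_fps_expansion W" unfolding W_def by (rule has_fps_expansion_disc[OF \<omega>(1)]) simp
  have P: "?p has_fps_expansion P"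
    unfolding P_def by (rule has_fps_expansion_disc[OF Phi_compose_holomorphic[OF \<omega>(1) \<omega>1]]) simp_all
  have W0: "fps_nth W 0 = 0" using has_fps_expansion_imp_0_eq_fps_nth_0[OF W] \<omega>(2) by simp
  have P0: "fps_nth P 0 = 1" using has_fps_expansion_imp_0_eq_fps_nth_0[OF P] \<omega>(2) by simp
  have eq: "fps_deriv P * (1 - W * W) = fps_const (2 * of_real \<beta>) * (fps_deriv W * P)"
  proof (rule fps_expansion_unique_on_disc[OF zero_less_one
        has_fps_expansion_mult[OF has_fps_expansion_deriv[OF P]
          has_fps_expansion_diff[OF has_fps_expansion_1 has_fps_expansion_mult[OF W W]]]
        has_fps_expansion_cmult_left[OF has_fps_expansion_mult[OF has_fps_expansion_deriv[OF W] P]]])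
    fix z :: complex assume z: "z \<in> ball 0 1"
    have ne: "1 - (\<omega> z)\<^sup>2 \<noteq> 0"
    proof
      assume "1 - (\<omega> z)\<^sup>2 = 0"
      then have "(cmod (\<omega> z))\<^sup>2 = 1" by (metis norm_one norm_power right_minus_eq)
      then show False using \<omega>1[OF z] by (simp add: abs_square_eq_1)
    qed
    show "deriv ?p z * (1 - \<omega> z * \<omega> z) = 2 * of_real \<beta> * (deriv \<omega> z * ?p z)"
      using DERIV_imp_deriv[OF Phi_compose_has_field_derivative[OF \<omega>(1) \<omega>1 z, of \<beta>]] ne
      by (simp add: power2_eq_square field_simps)
  qed
  note nth = arg_cong[OF eq, of "\<lambda>F. fps_nth F n" for n]
  have P1: "fps_nth P 1 = 2 * \<beta> * fps_nth W 1"
    using nth[of 0] by (simp add: fps_mult_nth P0 W0)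
  have "2 * fps_nth P 2 = 2 * \<beta> * (2 * fps_nth W 2 + fps_nth W 1 * fps_nth P 1)"
    using nth[of 1] by (simp add: fps_mult_nth P0 W0 numeral_2_eq_2 algebra_simps)
  then have "2 * fps_nth P 2 = 2 * (2 * \<beta> * fps_nth W 2 + 2 * \<beta>\<^sup>2 * (fps_nth W 1)\<^sup>2)"
    unfolding P1 by (simp add: algebra_simps power2_eq_square)
  then have P2: "fps_nth P 2 = 2 * \<beta> * fps_nth W 2 + 2 * \<beta>\<^sup>2 * (fps_nth W 1)\<^sup>2"
    by (metis mult_left_cancel zero_neq_numeral)
  have "3 * fps_nth P 3 - fps_nth P 1 * (fps_nth W 1)\<^sup>2
      = 2 * \<beta> * (3 * fps_nth W 3 + 2 * fps_nth W 2 * fps_nth P 1 + fps_nth W 1 * fps_nth P 2)"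
    using nth[of 2]
    by (simp add: fps_mult_nth P0 W0 numeral_2_eq_2 numeral_3_eq_3 algebra_simps power2_eq_square)
  then have P3: "fps_nth P 3 = 2 * \<beta> * fps_nth W 3 + 4 * \<beta>\<^sup>2 * fps_nth W 1 * fps_nth W 2
      + (2 * \<beta> / 3 + 4 * \<beta> ^ 3 / 3) * fps_nth W 1 ^ 3"
    unfolding P1 P2 by (simp add: field_simps power2_eq_square power3_eq_cube)
  show "c 1 = 2 * \<beta> * w 1" "c 2 = 2 * \<beta> * w 2 + 2 * \<beta>\<^sup>2 * (w 1)\<^sup>2"
    "c 3 = 2 * \<beta> * w 3 + 4 * \<beta>\<^sup>2 * w 1 * w 2 + (2 * \<beta> / 3 + 4 * \<beta> ^ 3 / 3) * w 1 ^ 3"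
    using P1 P2 P3 by (simp_all add: c_def w_def taylor_coeff_def W_def P_def)
qed

corollary Phi_compose_functional:
  fixes \<beta> :: real and w c :: "nat \<Rightarrow> complex"
  assumes "\<omega> holomorphic_on ball 0 1" "\<omega> 0 = 0" "\<And>z. z \<in> ball 0 1 \<Longrightarrow> cmod (\<omega> z) < 1"
  defines "w \<equiv> taylor_coeff \<omega>" and "c \<equiv> taylor_coeff (\<lambda>z. \<Phi> \<beta> (\<omega> z))"
  shows "c 3 - c 1 ^ 3 = 2 * \<beta> * (w 3 + 2 * complex_of_real \<beta> * w 1 * w 2 + (1 - 10 * \<beta>\<^sup>2) / 3 * w 1 ^ 3)"
  using Phi_compose_coeffs[OF assms(1-3), of \<beta>] unfolding w_def[symmetric] c_def[symmetric]
  by (simp add: field_simps power2_eq_square power3_eq_cube)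

lemma taylor_coeff_ident: "taylor_coeff (\<lambda>z. z) n = (if n = 1 then 1 else 0)"
proof -
  have "fps_expansion (\<lambda>z. z :: complex) 0 = fps_X"
    using has_fps_expansion_disc[OF holomorphic_on_ident, of 1] has_fps_expansion_fps_X
      fps_expansion_unique_complex by auto
  then show ?thesis by (simp add: taylor_coeff_def)
qed

lemma Phi_coeff_values:
  shows "\<Phi>_coeff \<beta> 1 = 2 * \<beta>" "\<Phi>_coeff \<beta> 2 = 2 * \<beta>\<^sup>2" "\<Phi>_coeff \<beta> 3 = 2 * \<beta> / 3 + 4 * \<beta> ^ 3 / 3"
proof -
  have "\<Phi>_coeff \<beta> n = Re (taylor_coeff (\<lambda>z. \<Phi> \<beta> z) n)" for n
    by (simp add: \<Phi>_coeff_def taylor_coeff_def fps_expansion_def)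
  then show "\<Phi>_coeff \<beta> 1 = 2 * \<beta>" "\<Phi>_coeff \<beta> 2 = 2 * \<beta>\<^sup>2" "\<Phi>_coeff \<beta> 3 = 2 * \<beta> / 3 + 4 * \<beta> ^ 3 / 3"
    using Phi_compose_coeffs[of "\<lambda>z. z" \<beta>] by (simp_all add: taylor_coeff_ident)
qed

lemma q5_eq: "\<beta> \<noteq> 0 \<Longrightarrow> q5 \<beta> = 2 * \<beta>"
  unfolding q5_def Phi_coeff_values by (simp add: power2_eq_square)

lemma q6_eq: "\<beta> \<noteq> 0 \<Longrightarrow> q6 \<beta> = (1 - 10 * \<beta>\<^sup>2) / 3"
  unfolding q6_def Phi_coeff_values by (simp add: field_simps power2_eq_square power3_eq_cube)

text \<open>The coefficients of \<open>\<omega>\<close> are those of the self-map \<open>\<omega> z / z\<close> shifted by one, so the Schur parameters of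
  the latter describe \<open>w 1, w 2, w 3\<close>.\<close>
lemma Schwarz_functional_bound:
  fixes w :: "nat \<Rightarrow> complex" and \<beta> q K :: real
  assumes \<omega>: "\<omega> holomorphic_on ball 0 1" "\<omega> 0 = 0"
    and \<omega>1: "\<And>z. z \<in> ball 0 1 \<Longrightarrow> cmod (\<omega> z) < 1"
    and \<beta>: "0 < \<beta>" and K: "1 \<le> K"
    and cubic: "\<And>t. 0 \<le> t \<Longrightarrow> t \<le> 1 \<Longrightarrow> (1 + 2 * \<beta>) * (t - t ^ 3) + \<bar>q\<bar> * t ^ 3 \<le> K"
  defines "w \<equiv> taylor_coeff \<omega>"
  shows "cmod (w 3 + 2 * complex_of_real \<beta> * w 1 * w 2 + complex_of_real q * w 1 ^ 3) \<le> K"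
proof -
  obtain g where g: "g holomorphic_on ball 0 1" "\<And>z. z \<in> ball 0 1 \<Longrightarrow> cmod (g z) \<le> 1"
    "\<And>z. z \<in> ball 0 1 \<Longrightarrow> \<omega> z = z * g z"
    using schur_step[OF \<omega>(1) less_imp_le[OF \<omega>1]] \<omega>(2) by auto
  have "\<omega> has_fps_expansion fps_expansion \<omega> 0" "g has_fps_expansion fps_expansion g 0"
    using has_fps_expansion_disc[OF \<omega>(1)] has_fps_expansion_disc[OF g(1)] by auto
  then have "fps_expansion \<omega> 0 = fps_X * fps_expansion g 0"
    by (rule fps_expansion_unique_on_disc[OF zero_less_one _
          has_fps_expansion_mult[OF has_fps_expansion_fps_X] g(3)])
  then have w: "w (Suc n) = taylor_coeff g n" for n
    by (simp add: w_def taylor_coeff_def)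
  obtain y s :: complex where ys: "cmod (w 1) \<le> 1" "cmod y \<le> 1" "cmod s \<le> 1 - (cmod y)\<^sup>2"
    "w 2 = (1 - (cmod (w 1))\<^sup>2) * y"
    "w 3 = (1 - (cmod (w 1))\<^sup>2) * (s - cnj (w 1) * y\<^sup>2)"
    using schur_parameters[OF g(1,2)] w by (auto simp: numeral_2_eq_2 numeral_3_eq_3)
  define x where "x = w 1"
  define a where "a = cmod x"
  define b where "b = cmod y"
  have a: "0 \<le> a" "a \<le> 1" and b: "0 \<le> b" "b \<le> 1" using ys by (auto simp: a_def b_def x_def)
  have a2: "0 \<le> 1 - a\<^sup>2" using a by (simp add: power_le_one)
  define S where "S = s + (- cnj x * y\<^sup>2) + 2 * \<beta> * x * y"
  have "cmod S \<le> cmod s + cmod (- cnj x * y\<^sup>2) + cmod (2 * \<beta> * x * y)"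
    unfolding S_def by (intro order_trans[OF norm_triangle_ineq] add_mono norm_triangle_ineq order_refl)
  also have "\<dots> \<le> 1 - b\<^sup>2 + a * b\<^sup>2 + 2 * \<beta> * a * b"
    using ys(3) \<beta> by (simp add: norm_mult norm_power a_def b_def)
  finally have S: "cmod S \<le> 1 - b\<^sup>2 + a * b\<^sup>2 + 2 * \<beta> * a * b" .
  have "w 3 + 2 * complex_of_real \<beta> * w 1 * w 2 + complex_of_real q * w 1 ^ 3
      = complex_of_real (1 - a\<^sup>2) * S + complex_of_real q * x ^ 3"
    unfolding ys(4,5) x_def[symmetric] a_def[symmetric] S_def by (simp add: algebra_simps)
  also have "cmod \<dots> \<le> cmod (complex_of_real (1 - a\<^sup>2) * S) + cmod (complex_of_real q * x ^ 3)"
    by (rule norm_triangle_ineq)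
  also have "\<dots> = \<bar>1 - a\<^sup>2\<bar> * cmod S + \<bar>q\<bar> * a ^ 3"
    by (simp only: norm_mult norm_power norm_of_real a_def)
  also have "\<bar>1 - a\<^sup>2\<bar> * cmod S \<le> (1 - a\<^sup>2) * (1 - b\<^sup>2 + a * b\<^sup>2 + 2 * \<beta> * a * b)"
    using a2 S by (simp add: mult_left_mono)
  finally show ?thesis
    using schur_triangle_bound[OF \<beta> a b abs_ge_zero K cubic] by simp
qed

text \<open>Coefficient comparison in \<open>p g = g + z g'\<close>, which is \<open>p h = z h'\<close> for \<open>h z = z g z\<close>.  The terms with
  \<open>c 2\<close> cancel.\<close>
lemma starlike_coefficient_identity:
  fixes a c :: "nat \<Rightarrow> complex"
  assumes g: "g holomorphic_on ball 0 1" "g 0 = 1" and p: "p holomorphic_on ball 0 1"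
    and eq: "\<And>z. z \<in> ball 0 1 \<Longrightarrow> p z * g z = g z + z * deriv g z"
  defines "a \<equiv> taylor_coeff g" and "c \<equiv> taylor_coeff p"
  shows "a 1 * a 2 - a 3 = (c 1 ^ 3 - c 3) / 3"
proof -
  define G where "G = fps_expansion g 0"
  define P where "P = fps_expansion p 0"
  have G: "g has_fps_expansion G" unfolding G_def by (rule has_fps_expansion_disc[OF g(1)]) simp
  have P: "p has_fps_expansion P" unfolding P_def by (rule has_fps_expansion_disc[OF p]) simp
  have G0: "fps_nth G 0 = 1" using has_fps_expansion_imp_0_eq_fps_nth_0[OF G] g(2) by simp
  have "p 0 = 1" using eq[of 0] g(2) by simp
  then have P0: "fps_nth P 0 = 1" using has_fps_expansion_imp_0_eq_fps_nth_0[OF P] by simp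
  have "P * G = G + fps_X * fps_deriv G"
    by (rule fps_expansion_unique_on_disc[OF zero_less_one has_fps_expansion_mult[OF P G]
          has_fps_expansion_add[OF G has_fps_expansion_mult[OF has_fps_expansion_fps_X
              has_fps_expansion_deriv[OF G]]] eq])
  note nth = arg_cong[OF this, of "\<lambda>F. fps_nth F n" for n]
  have c1: "fps_nth G 1 = fps_nth P 1"
    using nth[of 1] by (simp add: fps_mult_nth P0 G0)
  have "2 * fps_nth G 2 = fps_nth P 2 + fps_nth P 1 * fps_nth G 1"
    using nth[of 2] by (simp add: fps_mult_nth P0 G0 numeral_2_eq_2 algebra_simps)
  then have c2: "fps_nth G 2 = (fps_nth P 2 + fps_nth P 1 * fps_nth P 1) / 2"
    unfolding c1 by (simp add: field_simps)
  have "3 * fps_nth G 3 = fps_nth P 3 + fps_nth P 2 * fps_nth G 1 + fps_nth P 1 * fps_nth G 2"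
    using nth[of 3] by (simp add: fps_mult_nth P0 G0 numeral_2_eq_2 numeral_3_eq_3 algebra_simps)
  then have c3: "fps_nth G 3 = (fps_nth P 3 + fps_nth P 2 * fps_nth P 1
      + fps_nth P 1 * ((fps_nth P 2 + fps_nth P 1 * fps_nth P 1) / 2)) / 3"
    unfolding c1 c2 by (simp add: field_simps)
  have "fps_nth G 1 * fps_nth G 2 - fps_nth G 3 = (fps_nth P 1 ^ 3 - fps_nth P 3) / 3"
    unfolding c1 c2 c3 by (simp add: field_simps power3_eq_cube)
  then show ?thesis
    by (simp add: a_def c_def taylor_coeff_def G_def P_def)
qed

section \<open>Scalar multiples of the identity\<close>

lemma bounded_bilinear_scaleC:
  "bounded_bilinear (\<lambda>c (x::'a::complex_normed_space). c *\<^sub>C x)"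
proof
  show "\<exists>K. \<forall>a b. norm (a *\<^sub>C (b::'a)) \<le> norm a * norm b * K"
    by (rule exI[of _ 1]) (simp add: norm_scaleC)
qed (simp_all add: scaleC_add_left scaleC_add_right scaleR_scaleC scaleC_scaleC scaleC_complex_def mult.commute)

lemma scalar_multiple_map_has_derivative:
  fixes f :: "'a::complex_normed_space \<Rightarrow> complex"
  assumes f: "holomorphic_map f (ball 0 1)" and F: "\<And>z. z \<in> ball 0 1 \<Longrightarrow> F z = f z *\<^sub>C z"
    and z: "z \<in> ball 0 1"
  shows "(F has_derivative (\<lambda>h. f z *\<^sub>C h + blinfun_apply (fderiv f z) h *\<^sub>C z)) (at z)"
proof -
  have "((\<lambda>z. f z *\<^sub>C z) has_derivative (\<lambda>h. f z *\<^sub>C h + blinfun_apply (fderiv f z) h *\<^sub>C z)) (at z)"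
    by (rule bounded_bilinear.FDERIV[OF bounded_bilinear_scaleC
          holomorphic_map_fderiv(1)[OF f z] has_derivative_ident])
  then show ?thesis
    by (rule has_derivative_transform_within_open[OF _ open_ball z]) (simp add: F)
qed

lemma fderiv_scalar_multiple_map:
  fixes f :: "'a::complex_normed_space \<Rightarrow> complex"
  assumes f: "holomorphic_map f (ball 0 1)" and F: "\<And>z. z \<in> ball 0 1 \<Longrightarrow> F z = f z *\<^sub>C z"
    and z: "z \<in> ball 0 1"
  shows "blinfun_apply (fderiv F z) h = f z *\<^sub>C h + blinfun_apply (fderiv f z) h *\<^sub>C z"
  using fun_cong[OF fderiv_eqI[OF scalar_multiple_map_has_derivative[OF f F z]]] .

lemma holomorphic_scalar_multiple_map:
  fixes f :: "'a::complex_normed_space \<Rightarrow> complex"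
  assumes f: "holomorphic_map f (ball 0 1)" and F: "\<And>z. z \<in> ball 0 1 \<Longrightarrow> F z = f z *\<^sub>C z"
  shows "holomorphic_map F (ball 0 1)"
  by (rule holomorphic_mapI[OF open_ball scalar_multiple_map_has_derivative[OF f F]])
    (simp_all add: scaleC_add_right scaleC_scaleC holomorphic_map_fderiv(2)[OF f]
      scaleC_complex_def mult.commute)

text \<open>The factor by which \<open>DF(z)\<close> stretches the direction \<open>z\<close> when \<open>F z = f z *\<^sub>C z\<close>; on the line through
  \<open>z\<close> it is the derivative of \<open>t \<mapsto> t f(t *\<^sub>C z)\<close> at 1.\<close>
definition radial :: "('a::complex_normed_space \<Rightarrow> complex) \<Rightarrow> 'a \<Rightarrow> complex" where
  "radial f z = f z + blinfun_apply (fderiv f z) z"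

lemma fderiv_scalar_multiple_radial:
  fixes f :: "'a::complex_normed_space \<Rightarrow> complex"
  assumes f: "holomorphic_map f (ball 0 1)" and F: "\<And>z. z \<in> ball 0 1 \<Longrightarrow> F z = f z *\<^sub>C z"
    and z: "z \<in> ball 0 1"
  shows "blinfun_apply (fderiv F z) (c *\<^sub>C z) = (c * radial f z) *\<^sub>C z"
proof -
  have "blinfun_apply (fderiv F z) (c *\<^sub>C z)
      = f z *\<^sub>C c *\<^sub>C z + blinfun_apply (fderiv f z) (c *\<^sub>C z) *\<^sub>C z"
    by (rule fderiv_scalar_multiple_map[OF f F z])
  then show ?thesis
    by (simp add: holomorphic_map_fderiv(2)[OF f z] radial_def
        scaleC_scaleC scaleC_complex_def distrib_left scaleC_add_left mult.commute)
qed

lemma inv_fderiv_scalar_multiple_map: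
  fixes f :: "'a::complex_normed_space \<Rightarrow> complex"
  assumes f: "holomorphic_map f (ball 0 1)" and F: "\<And>z. z \<in> ball 0 1 \<Longrightarrow> F z = f z *\<^sub>C z"
    and z: "z \<in> ball 0 1" and inj: "inj (blinfun_apply (fderiv F z))" and r: "radial f z \<noteq> 0"
  shows "inv (blinfun_apply (fderiv F z)) (F z) = (f z / radial f z) *\<^sub>C z"
proof -
  have "blinfun_apply (fderiv F z) ((f z / radial f z) *\<^sub>C z)
      = (f z / radial f z * radial f z) *\<^sub>C z"
    by (rule fderiv_scalar_multiple_radial[OF f F z])
  then have "blinfun_apply (fderiv F z) ((f z / radial f z) *\<^sub>C z) = F z"
    using r by (simp add: F[OF z])
  then show ?thesis using inv_f_f[OF inj, of "(f z / radial f z) *\<^sub>C z"] by simp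
qed

lemma Arg_quotient_flip:
  assumes a: "a \<noteq> 0" and b: "b \<noteq> 0" and r: "r > 0" and c: "c < pi"
  shows "\<bar>Arg (a / b * complex_of_real r)\<bar> < c \<longleftrightarrow> \<bar>Arg (b / a)\<bar> < c"
proof -
  have "\<bar>Arg (a / b)\<bar> = \<bar>Arg (b / a)\<bar>"
  proof -
    have "inverse (a / b) = b / a" by simp
    then show ?thesis using Arg_inverse[of "a / b"] by (metis abs_minus_cancel)
  qed
  then show ?thesis by (simp only: Arg_times_of_real2[OF r])
qed

text \<open>Injectivity of \<open>DF(z)\<close> excludes \<open>radial f z = 0\<close>, and evaluating the starlikeness condition at any
  support functional of \<open>z\<close>, of which there is one by Hahn-Banach, gives the sector condition.\<close>
lemma starlike_product_radial:
  fixes f :: "'a::complex_banach \<Rightarrow> complex"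
  assumes S: "starlike_product \<beta> f F" and \<beta>: "\<beta> \<le> 1" and z: "z \<in> ball 0 1" "z \<noteq> 0"
  shows "f z \<noteq> 0" "radial f z \<noteq> 0" "\<bar>Arg (radial f z / f z)\<bar> < pi / 2 * \<beta>"
proof -
  have f: "holomorphic_map f (ball 0 1)" and F: "\<And>z. z \<in> ball 0 1 \<Longrightarrow> F z = f z *\<^sub>C z"
    and SS: "F \<in> strongly_starlike \<beta>"
    using S by (auto simp: starlike_product_def)
  obtain G :: "'a \<Rightarrow>\<^sub>L 'a" where G: "G o\<^sub>L fderiv F z = id_blinfun"
    using SS z(1) unfolding strongly_starlike_def locally_biholomorphic_def by blast
  have inj: "inj (blinfun_apply (fderiv F z))"
    by (rule inj_on_inverseI[of _ "blinfun_apply G"])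
      (metis G blinfun_apply_blinfun_compose id_blinfun.rep_eq)
  show r: "radial f z \<noteq> 0"
  proof
    assume "radial f z = 0"
    moreover have "blinfun_apply (fderiv F z) (1 *\<^sub>C z) = (1 * radial f z) *\<^sub>C z"
      by (rule fderiv_scalar_multiple_radial[OF f F z(1)])
    ultimately have "blinfun_apply (fderiv F z) z = blinfun_apply (fderiv F z) 0"
      by (simp add: blinfun.zero_right)
    then show False using injD[OF inj] z(2) by blast
  qed
  obtain l where l: "l \<in> support_functionals z"
    using support_functionals_nonempty[OF z(2)] by blast
  have "inv (blinfun_apply (fderiv F z)) (F z) = (f z / radial f z) *\<^sub>C z"
    by (rule inv_fderiv_scalar_multiple_map[OF f F z(1) inj r])
  then have eq: "l (inv (blinfun_apply (fderiv F z)) (F z)) = f z / radial f z * norm z"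
    using l by (simp add: support_functionals_def bounded_clinear_def scaleC_complex_def)
  have w: "f z / radial f z * norm z \<noteq> 0"
    "\<bar>Arg (f z / radial f z * norm z)\<bar> < pi / 2 * \<beta>"
    using SS z l unfolding strongly_starlike_def Let_def eq[symmetric] by blast+
  then show fz: "f z \<noteq> 0" by auto
  have "pi / 2 * \<beta> < pi" 
    using \<beta> mult_left_mono[of \<beta> 1 "pi / 2"] pi_gt_zero by linarith
  then show "\<bar>Arg (radial f z / f z)\<bar> < pi / 2 * \<beta>"
    using w(2) z(2) by (subst (asm) Arg_quotient_flip[OF fz r]) auto
qed

text \<open>\<open>DF(z)\<close> is a nonzero multiple of the identity plus the rank-one operator \<open>h \<mapsto> (Df(z) h) z\<close>, hence
  is inverted explicitly as soon as \<open>radial f z\<close> is nonzero.\<close>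
lemma starlike_productI:
  fixes f :: "'a::complex_banach \<Rightarrow> complex"
  assumes f: "holomorphic_map f (ball 0 1)" and F: "\<And>z. z \<in> ball 0 1 \<Longrightarrow> F z = f z *\<^sub>C z"
    and f0: "f 0 = 1" and \<beta>: "\<beta> \<le> 1"
    and nz: "\<And>z. z \<in> ball 0 1 \<Longrightarrow> f z \<noteq> 0" "\<And>z. z \<in> ball 0 1 \<Longrightarrow> radial f z \<noteq> 0"
    and sector: "\<And>z. z \<in> ball 0 1 \<Longrightarrow> \<bar>Arg (radial f z / f z)\<bar> < pi / 2 * \<beta>"
  shows "starlike_product \<beta> f F"
proof -
  have hol: "holomorphic_map F (ball 0 1)" by (rule holomorphic_scalar_multiple_map[OF f F])
  note zero_right = bounded_bilinear.zero_right[OF bounded_bilinear_scaleC]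
  have "blinfun_apply (fderiv F 0) h = f 0 *\<^sub>C h + blinfun_apply (fderiv f 0) h *\<^sub>C 0" for h
    by (rule fderiv_scalar_multiple_map[OF f F]) simp_all
  then have "normalized_map F"
    unfolding normalized_map_def
    using hol F[of 0] by (auto intro!: blinfun_eqI simp: f0 zero_right)
  moreover have bij: "\<exists>G::'a \<Rightarrow>\<^sub>L 'a. G o\<^sub>L fderiv F z = id_blinfun \<and> fderiv F z o\<^sub>L G = id_blinfun"
    if z: "z \<in> ball 0 1" for z
  proof -
    define b where "b = blinfun_apply (fderiv f z)"
    define a where "a = f z"
    define k where "k = radial f z"
    have b: "bounded_linear b" "\<And>c h. b (c *\<^sub>C h) = c * b h"
      using holomorphic_map_fderiv(2)[OF f z]
      by (auto simp: b_def blinfun.bounded_linear_right scaleC_complex_def)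
    have k: "k = a + b z" "k \<noteq> 0" "a \<noteq> 0"
      using nz[OF z] by (auto simp: k_def radial_def a_def b_def)
    have DF: "blinfun_apply (fderiv F z) h = a *\<^sub>C h + b h *\<^sub>C z" for h
      unfolding a_def b_def by (rule fderiv_scalar_multiple_map[OF f F z])
    \<comment> \<open>Sherman-Morrison formula for \<open>h \<mapsto> a h + b(h) z\<close>\<close>
    define g where "g h = (1 / a) *\<^sub>C (h - (b h / k) *\<^sub>C z)" for h
    have bl: "bounded_linear g"
    proof -
      have "bounded_linear (\<lambda>h. (b h / k) *\<^sub>C z)"
        by (rule bounded_linear_compose[OF bounded_bilinear.bounded_linear_left[OF bounded_bilinear_scaleC]
            bounded_linear_compose[OF bounded_linear_divide b(1)]])
      then show ?thesis
        unfolding g_def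
        by (intro bounded_linear_compose[OF bounded_linear_scaleC] bounded_linear_sub bounded_linear_ident)
    qed
    note lin = linear_add[OF bounded_linear.linear[OF b(1)]] linear_diff[OF bounded_linear.linear[OF b(1)]]
    have b_sub: "b z = k - a" using k by simp
    have left: "g (a *\<^sub>C h + b h *\<^sub>C z) = h" for h
    proof -
      have "b (a *\<^sub>C h + b h *\<^sub>C z) / k = b h"
        using k(2) by (simp add: lin b b_sub algebra_simps)
      then show ?thesis
        using k(3) by (simp add: g_def scaleC_scaleC)
    qed
    have right: "a *\<^sub>C g h + b (g h) *\<^sub>C z = h" for h
    proof -
      have "b (g h) = b h / k"
        using k(2,3) by (simp add: g_def lin b b_sub field_simps)
      then show ?thesis
        using k(3) by (simp add: g_def scaleC_scaleC)
    qed
    have "Blinfun g o\<^sub>L fderiv F z = id_blinfun" "fderiv F z o\<^sub>L Blinfun g = id_blinfun"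
      by (auto intro!: blinfun_eqI simp: bounded_linear_Blinfun_apply[OF bl] DF left right)
    then show ?thesis by blast
  qed
  moreover have "let w = l (inv (blinfun_apply (fderiv F z)) (F z)) in w \<noteq> 0 \<and> \<bar>Arg w\<bar> < pi / 2 * \<beta>"
    if z: "z \<in> ball 0 1 - {0}" and l: "l \<in> support_functionals z" for z l
  proof -
    have z1: "z \<in> ball 0 1" using z by simp
    obtain G :: "'a \<Rightarrow>\<^sub>L 'a" where G: "G o\<^sub>L fderiv F z = id_blinfun"
      using bij[OF z1] by blast
    have inj: "inj (blinfun_apply (fderiv F z))"
      by (rule inj_on_inverseI[of _ "blinfun_apply G"])
        (metis G blinfun_apply_blinfun_compose id_blinfun.rep_eq)
    have "inv (blinfun_apply (fderiv F z)) (F z) = (f z / radial f z) *\<^sub>C z"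
      by (rule inv_fderiv_scalar_multiple_map[OF f F z1 inj nz(2)[OF z1]])
    then have eq: "l (inv (blinfun_apply (fderiv F z)) (F z)) = f z / radial f z * norm z"
      using l by (simp add: support_functionals_def bounded_clinear_def scaleC_complex_def)
    have "pi / 2 * \<beta> < pi"
      using \<beta> mult_left_mono[of \<beta> 1 "pi / 2"] pi_gt_zero by linarith
    then have "\<bar>Arg (f z / radial f z * norm z)\<bar> < pi / 2 * \<beta>"
      using sector[OF z1] z by (subst Arg_quotient_flip[OF nz[OF z1]]) auto
    then show ?thesis
      using nz[OF z1] z unfolding Let_def eq by simp
  qed
  ultimately show ?thesis
    using f f0 F hol by (auto simp: starlike_product_def strongly_starlike_def locally_biholomorphic_def)
qed

section \<open>The coefficients on a slice\<close>

lemma bounded_clinear_eval: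
  assumes "bounded_clinear (l :: 'b::complex_normed_space \<Rightarrow> complex)"
  shows "bounded_clinear (\<lambda>T :: 'a::real_normed_vector \<Rightarrow>\<^sub>L 'b. l (blinfun_apply T v))"
  using assms bounded_linear_compose[OF _ blinfun.bounded_linear_left]
  by (auto simp: bounded_clinear_def)

text \<open>Differentiating along a line trades a scalar derivative for a Frechet derivative evaluated in the
  direction of the line.  Since evaluation at \<open>v\<close> is itself a bounded functional on operators, the rule can
  be applied again to \<open>fderiv F\<close>.\<close>
lemma higher_deriv_slice_Suc:
  assumes F: "holomorphic_map F (ball 0 1)" and l: "bounded_clinear l"
  shows "(deriv ^^ Suc n) (\<lambda>t. l (F (t *\<^sub>C v)) :: complex) 0
    = (deriv ^^ n) (\<lambda>t. l (blinfun_apply (fderiv F (t *\<^sub>C v)) v)) 0"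
proof -
  have "deriv (\<lambda>t. l (F (t *\<^sub>C v))) t = l (blinfun_apply (fderiv F (t *\<^sub>C v)) v)"
    if "t \<in> ball 0 (1 / (1 + norm v))" for t
  proof -
    have "cmod t * norm v \<le> cmod t * (1 + norm v)" by (simp add: mult_left_mono)
    also have "\<dots> < 1" using that by (simp add: less_divide_eq add_pos_nonneg)
    finally have "0 + t *\<^sub>C v \<in> ball 0 1" by (simp add: norm_scaleC)
    from DERIV_imp_deriv[OF holomorphic_map_slice[OF F l this]] show ?thesis by simp
  qed
  then have "\<forall>\<^sub>F t in nhds 0. deriv (\<lambda>t. l (F (t *\<^sub>C v))) t = l (blinfun_apply (fderiv F (t *\<^sub>C v)) v)"
    by (intro eventually_nhds_in_open[of "ball 0 (1 / (1 + norm v))", THEN eventually_mono])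
      (auto simp: add_pos_nonneg)
  then show ?thesis
    unfolding funpow_Suc_right comp_def by (rule higher_deriv_cong_ev) simp
qed

text \<open>The slice \<open>t \<mapsto> l (F (t *\<^sub>C u))\<close> in the unit direction of \<open>z\<close> equals \<open>t g t\<close>, because \<open>l u = 1\<close>; this
  shifts the index of the coefficients of \<open>g\<close> by one.  Homogeneity in \<open>z\<close> removes the powers of \<open>norm z\<close>.\<close>
lemma A_eq_taylor_coeffs:
  fixes F :: "'a::complex_banach \<Rightarrow> 'a" and f :: "'a \<Rightarrow> complex"
  assumes f: "holomorphic_map f (ball 0 1)" and F: "\<And>z. z \<in> ball 0 1 \<Longrightarrow> F z = f z *\<^sub>C z"
    and z: "z \<noteq> 0" and l: "l \<in> support_functionals z" and g: "g holomorphic_on ball 0 1"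
    and fg: "\<And>t. t \<in> ball 0 1 \<Longrightarrow> f (t *\<^sub>C ((1 / norm z) *\<^sub>R z)) = g t"
  shows "A2 l F z = taylor_coeff g 1" "A3 l F z = taylor_coeff g 2" "A4 l F z = taylor_coeff g 3"
proof -
  define u where "u = (1 / norm z) *\<^sub>R z"
  have u: "norm u = 1" "z = norm z *\<^sub>R u" using z by (simp_all add: u_def)
  have bl: "bounded_clinear l" and lz: "l z = norm z" using l by (auto simp: support_functionals_def)
  have l_R: "l (c *\<^sub>R x) = complex_of_real c * l x" for c x
    using linear_scale[OF bounded_linear.linear[OF bounded_clinear_linear(1)[OF bl]]]
    by (simp add: scaleR_conv_of_real)
  have lu: "l u = 1" using lz z by (simp add: u_def l_R)
  have hol: "holomorphic_map F (ball 0 1)" by (rule holomorphic_scalar_multiple_map[OF f F])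
  note hols = hol holomorphic_fderiv[OF hol] holomorphic_fderiv[OF holomorphic_fderiv[OF hol]]
    holomorphic_fderiv[OF holomorphic_fderiv[OF holomorphic_fderiv[OF hol]]]
  define \<phi> where "\<phi> t = l (F (t *\<^sub>C u))" for t
  have 2: "(deriv ^^ 2) \<phi> 0 = l (blinfun_apply (blinfun_apply (fderiv (fderiv F) 0) u) u)"
    unfolding \<phi>_def numeral_2_eq_2 higher_deriv_slice_Suc[OF hols(1) bl]
      higher_deriv_slice_Suc[OF hols(2) bounded_clinear_eval[OF bl]] by simp
  have 3: "(deriv ^^ 3) \<phi> 0
      = l (blinfun_apply (blinfun_apply (blinfun_apply (fderiv (fderiv (fderiv F)) 0) u) u) u)"
    unfolding \<phi>_def numeral_3_eq_3 higher_deriv_slice_Suc[OF hols(1) bl]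
      higher_deriv_slice_Suc[OF hols(2) bounded_clinear_eval[OF bl]]
      higher_deriv_slice_Suc[OF hols(3) bounded_clinear_eval[OF bounded_clinear_eval[OF bl]]] by simp
  have four: "4 = Suc (Suc (Suc (Suc 0)))" by simp
  have 4: "(deriv ^^ 4) \<phi> 0
      = l (blinfun_apply (blinfun_apply (blinfun_apply (blinfun_apply
          (fderiv (fderiv (fderiv (fderiv F))) 0) u) u) u) u)"
    unfolding \<phi>_def four higher_deriv_slice_Suc[OF hols(1) bl]
      higher_deriv_slice_Suc[OF hols(2) bounded_clinear_eval[OF bl]]
      higher_deriv_slice_Suc[OF hols(3) bounded_clinear_eval[OF bounded_clinear_eval[OF bl]]]
      higher_deriv_slice_Suc[OF hols(4) bounded_clinear_eval[OF bounded_clinear_eval[OF bounded_clinear_eval[OF bl]]]]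
    by simp
  define G where "G = fps_expansion g 0"
  have G: "g has_fps_expansion G" unfolding G_def by (rule has_fps_expansion_disc[OF g]) simp
  have "\<phi> t = t * g t" if "t \<in> ball 0 1" for t
  proof -
    have "t *\<^sub>C u \<in> ball 0 1" using that u by (simp add: norm_scaleC)
    then have "\<phi> t = l ((g t * t) *\<^sub>C u)"
      using fg[OF that] by (simp add: \<phi>_def F u_def scaleC_scaleC)
    then show ?thesis
      using bounded_clinear_linear(2)[OF bl] lu by (simp add: scaleC_complex_def mult.commute)
  qed
  then have ev: "\<forall>\<^sub>F t in nhds 0. t * g t = \<phi> t"
    by (intro eventually_nhds_in_open[of "ball 0 1", THEN eventually_mono]) auto
  have \<phi>: "\<phi> has_fps_expansion fps_X * G"
    using has_fps_expansion_mult[OF has_fps_expansion_fps_X G] has_fps_expansion_cong[OF ev refl] by simp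
  have coeff: "(deriv ^^ Suc n) \<phi> 0 = fact (Suc n) * taylor_coeff g n" for n
    using fps_nth_fps_expansion[OF \<phi>, of "Suc n"] by (simp add: taylor_coeff_def G_def del: fact_Suc funpow.simps)
  have nz: "complex_of_real (norm z) \<noteq> 0" using z by simp
  show "A2 l F z = taylor_coeff g 1"
    unfolding A2_def using coeff[of 1] 2 nz
    by (subst (1 2) u(2)) (simp add: blinfun.scaleR_right blinfun.scaleR_left l_R numeral_2_eq_2 power2_eq_square field_simps)
  show "A3 l F z = taylor_coeff g 2"
    unfolding A3_def using coeff[of 2] 3 nz
    by (subst (1 2 3) u(2)) (simp add: blinfun.scaleR_right blinfun.scaleR_left l_R numeral_3_eq_3 field_simps)
  show "A4 l F z = taylor_coeff g 3"
    unfolding A4_def using coeff[of 3] 4 nz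
    by (subst (1 2 3 4) u(2)) (simp add: blinfun.scaleR_right blinfun.scaleR_left l_R power4_eq_xxxx field_simps)
qed

lemma slice_has_field_derivative:
  assumes "holomorphic_map (f :: 'a::complex_normed_space \<Rightarrow> complex) (ball 0 1)"
    "norm u = 1" "t \<in> ball 0 1"
  shows "((\<lambda>t. f (t *\<^sub>C u)) has_field_derivative blinfun_apply (fderiv f (t *\<^sub>C u)) u) (at t)"
  using holomorphic_map_slice[OF assms(1), of "\<lambda>x. x" 0 t u] assms
  by (simp add: bounded_clinear_def norm_scaleC)

lemma radial_slice:
  assumes f: "holomorphic_map (f :: 'a::complex_normed_space \<Rightarrow> complex) (ball 0 1)"
    and u: "norm u = 1" and t: "t \<in> ball 0 1"
  shows "radial f (t *\<^sub>C u) = f (t *\<^sub>C u) + t * deriv (\<lambda>t. f (t *\<^sub>C u)) t"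
proof -
  have "t *\<^sub>C u \<in> ball 0 1" using u t by (simp add: norm_scaleC)
  from holomorphic_map_fderiv(2)[OF f this] show ?thesis
    unfolding radial_def DERIV_imp_deriv[OF slice_has_field_derivative[OF f u t]]
    by (simp add: scaleC_complex_def)
qed

text \<open>The common core of the estimate and of the sharpness results: everything depends only on the
  first three coefficients of the subordinating function \<open>\<omega>\<close> on the slice through \<open>z\<close>.\<close>
lemma A_functional_eq:
  fixes f :: "'a::complex_banach \<Rightarrow> complex"
  assumes f: "holomorphic_map f (ball 0 1)" "f 0 = 1" and F: "\<And>z. z \<in> ball 0 1 \<Longrightarrow> F z = f z *\<^sub>C z"
    and z: "z \<noteq> 0" and l: "l \<in> support_functionals z" and \<beta>: "0 < \<beta>"
    and \<omega>: "\<omega> holomorphic_on ball 0 1" "\<omega> 0 = 0" "\<And>t. t \<in> ball 0 1 \<Longrightarrow> cmod (\<omega> t) < 1"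
    and p: "\<And>t. t \<in> ball 0 1 \<Longrightarrow>
      radial f (t *\<^sub>C ((1 / norm z) *\<^sub>R z)) = \<Phi> \<beta> (\<omega> t) * f (t *\<^sub>C ((1 / norm z) *\<^sub>R z))"
  defines "w \<equiv> taylor_coeff \<omega>"
  shows "cmod (A2 l F z * A3 l F z - A4 l F z)
    = 2 * \<beta> / 3 * cmod (w 3 + 2 * complex_of_real \<beta> * w 1 * w 2 + complex_of_real ((1 - 10 * \<beta>\<^sup>2) / 3) * w 1 ^ 3)"
proof -
  define u where "u = (1 / norm z) *\<^sub>R z"
  have u: "norm u = 1" using z by (simp add: u_def)
  define g where "g t = f (t *\<^sub>C u)" for t
  have g: "g holomorphic_on ball 0 1"
    unfolding holomorphic_on_open[OF open_ball] g_def
    by (intro ballI exI) (rule slice_has_field_derivative[OF f(1) u])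
  have g0: "g 0 = 1" by (simp add: g_def f(2))
  define c where "c = taylor_coeff (\<lambda>t. \<Phi> \<beta> (\<omega> t))"
  have "A2 l F z = taylor_coeff g 1 \<and> A3 l F z = taylor_coeff g 2 \<and> A4 l F z = taylor_coeff g 3"
    by (intro conjI A_eq_taylor_coeffs[OF f(1) F z l g]) (simp_all add: g_def u_def)
  moreover have "taylor_coeff g 1 * taylor_coeff g 2 - taylor_coeff g 3 = (c 1 ^ 3 - c 3) / 3"
    unfolding c_def
  proof (rule starlike_coefficient_identity[OF g g0 Phi_compose_holomorphic[OF \<omega>(1,3)]])
    fix t :: complex assume t: "t \<in> ball 0 1"
    show "\<Phi> \<beta> (\<omega> t) * g t = g t + t * deriv g t"
      using p[OF t] radial_slice[OF f(1) u t] unfolding g_def u_def by simp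
  qed
  ultimately have "A2 l F z * A3 l F z - A4 l F z = - ((c 3 - c 1 ^ 3) / 3)"
    by (simp add: field_simps)
  also have "c 3 - c 1 ^ 3
      = 2 * \<beta> * (w 3 + 2 * complex_of_real \<beta> * w 1 * w 2 + complex_of_real ((1 - 10 * \<beta>\<^sup>2) / 3) * w 1 ^ 3)"
    using Phi_compose_functional[OF \<omega>, of \<beta>] by (simp add: c_def w_def)
  also have "- (2 * \<beta> * X / 3) = complex_of_real (- (2 * \<beta> / 3)) * X" for X :: complex
    by simp
  finally show ?thesis using \<beta> by (simp add: norm_mult)
qed

text \<open>Along the unit direction \<open>u\<close> of \<open>z\<close> the quotient \<open>p t = radial f (t *\<^sub>C u) / f (t *\<^sub>C u)\<close> stays in
  the sector, hence is subordinate to \<open>\<Phi> \<beta>\<close>, and \<open>Schwarz_functional_bound\<close> applies to the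
  subordinating function.  At \<open>t = 0\<close>, where starlikeness says nothing, \<open>p 0 = 1\<close>.\<close>
theorem starlike_product_functional_bound:
  fixes f :: "'a::complex_banach \<Rightarrow> complex"
  assumes S: "starlike_product \<beta> f F" and z: "z \<noteq> 0" and l: "l \<in> support_functionals z"
    and \<beta>: "0 < \<beta>" "\<beta> \<le> 1" and K: "1 \<le> K"
    and cubic: "\<And>t. 0 \<le> t \<Longrightarrow> t \<le> 1 \<Longrightarrow>
      (1 + 2 * \<beta>) * (t - t ^ 3) + \<bar>(1 - 10 * \<beta>\<^sup>2) / 3\<bar> * t ^ 3 \<le> K"
  shows "cmod (A2 l F z * A3 l F z - A4 l F z) \<le> 2 * \<beta> / 3 * K"
proof -
  have f: "holomorphic_map f (ball 0 1)" "f 0 = 1" and F: "\<And>z. z \<in> ball 0 1 \<Longrightarrow> F z = f z *\<^sub>C z"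
    using S by (auto simp: starlike_product_def)
  define u where "u = (1 / norm z) *\<^sub>R z"
  have u: "norm u = 1" using z by (simp add: u_def)
  define g where "g t = f (t *\<^sub>C u)" for t
  define p where "p t = (g t + t * deriv g t) / g t" for t
  have g: "g holomorphic_on ball 0 1"
    unfolding holomorphic_on_open[OF open_ball] g_def
    by (intro ballI exI) (rule slice_has_field_derivative[OF f(1) u])
  have sector: "g t \<noteq> 0 \<and> p t \<noteq> 0 \<and> \<bar>Arg (p t)\<bar> < pi / 2 * \<beta>" if t: "t \<in> ball 0 1" for t
  proof (cases "t = 0")
    case True
    then show ?thesis using \<beta> by (simp add: p_def g_def f(2))
  next
    case False
    then have "t *\<^sub>C u \<in> ball 0 1" "t *\<^sub>C u \<noteq> 0"
      using t u norm_scaleC[of t u] by auto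
    note R = starlike_product_radial[OF S \<beta>(2) this]
    have "p t = radial f (t *\<^sub>C u) / f (t *\<^sub>C u)"
      by (simp add: p_def g_def[abs_def] radial_slice[OF f(1) u t])
    then show ?thesis using R by (simp add: g_def)
  qed
  have p: "p holomorphic_on ball 0 1"
    unfolding p_def using sector by (intro holomorphic_intros holomorphic_deriv g) auto
  have "p 0 = 1" by (simp add: p_def g_def f(2))
  then obtain \<omega> where \<omega>: "\<omega> holomorphic_on ball 0 1" "\<omega> 0 = 0"
    "\<And>z. z \<in> ball 0 1 \<Longrightarrow> cmod (\<omega> z) < 1" "\<And>z. z \<in> ball 0 1 \<Longrightarrow> p z = \<Phi> \<beta> (\<omega> z)"
    using subordinate_to_Phi[OF p _ \<beta>] sector by metis
  have "radial f (t *\<^sub>C u) = \<Phi> \<beta> (\<omega> t) * f (t *\<^sub>C u)" if "t \<in> ball 0 1" for t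
    using \<omega>(4)[OF that] sector[OF that]
    by (simp add: p_def g_def[abs_def] radial_slice[OF f(1) u that] divide_eq_eq)
  then have "cmod (A2 l F z * A3 l F z - A4 l F z)
    = 2 * \<beta> / 3 * cmod (taylor_coeff \<omega> 3 + 2 * complex_of_real \<beta> * taylor_coeff \<omega> 1 * taylor_coeff \<omega> 2
        + complex_of_real ((1 - 10 * \<beta>\<^sup>2) / 3) * taylor_coeff \<omega> 1 ^ 3)"
    unfolding u_def by (intro A_functional_eq[OF f F z l \<beta>(1) \<omega>(1-3)]) auto
  then show ?thesis
    using mult_left_mono[OF Schwarz_functional_bound[OF \<omega>(1-3) \<beta>(1) K cubic], of "2 * \<beta> / 3"] \<beta>
    by simp
qed

section \<open>Exponential integral maps\<close>

text \<open>The integrand \<open>(q t - 1) / t\<close> agrees off 0 with a holomorphic function, so its integrals are given by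
  a primitive \<open>Q\<close>; the point 0 does not affect the contour integral.\<close>
lemma integral_primitive:
  assumes p: "p holomorphic_on ball 0 1" "p 0 = 1"
    and pq: "\<And>t. t \<in> ball 0 1 \<Longrightarrow> q t = p t"
  obtains Q where "Q 0 = 0"
    "\<And>t. t \<in> ball 0 1 \<Longrightarrow> contour_integral (linepath 0 t) (\<lambda>t. 1 / t * (q t - 1)) = Q t"
    "\<And>t. t \<in> ball 0 1 \<Longrightarrow> (Q has_field_derivative deriv Q t) (at t)"
    "\<And>t. t \<in> ball 0 1 \<Longrightarrow> t * deriv Q t = p t - 1"
proof -
  have "(\<lambda>t. p t - 1) holomorphic_on ball 0 1" using p by (intro holomorphic_intros)
  then obtain h where h: "h holomorphic_on ball 0 1" "\<And>t. cmod t < 1 \<Longrightarrow> p t - 1 = t * h t"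
    using Schwarz3[of "\<lambda>t. p t - 1" 1] p(2) by auto
  obtain P where P: "\<And>t. t \<in> ball 0 1 \<Longrightarrow> (P has_field_derivative h t) (at t within ball 0 1)"
    using holomorphic_convex_primitive'[OF convex_ball open_ball h(1)] by blast
  define Q where "Q t = P t - P 0" for t
  have Q: "(Q has_field_derivative h t) (at t)" if "t \<in> ball 0 1" for t
    unfolding Q_def using P[OF that] at_within_open[OF that open_ball]
    by (auto intro!: derivative_eq_intros)
  show ?thesis
  proof
    show "Q 0 = 0" by (simp add: Q_def)
    fix t :: complex assume t: "t \<in> ball 0 1"
    show "(Q has_field_derivative deriv Q t) (at t)"
      using Q[OF t] DERIV_imp_deriv[OF Q[OF t]] by simp
    show "t * deriv Q t = p t - 1"
      using h(2)[of t] t DERIV_imp_deriv[OF Q[OF t]] by simp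
    show "contour_integral (linepath 0 t) (\<lambda>t. 1 / t * (q t - 1)) = Q t"
    proof (cases "t = 0")
      case True
      then show ?thesis by (simp add: Q_def)
    next
      case False
      have seg: "path_image (linepath 0 t) \<subseteq> ball 0 1"
        using t by (simp add: closed_segment_subset)
      have "contour_integral (linepath 0 t) (\<lambda>t. 1 / t * (q t - 1)) = contour_integral (linepath 0 t) h"
      proof (rule contour_integral_spike_finite_simple_path[of "{0}"])
        show "simple_path (linepath 0 t)" using False by (intro simple_path_linepath) simp
        fix x assume "x \<in> path_image (linepath 0 t) - {0}"
        then show "1 / x * (q x - 1) = h x"
          using seg h(2)[of x] pq[of x] by auto
      qed auto
      also have "\<dots> = Q t"
        using contour_integral_primitive[OF DERIV_subset[OF Q subset_UNIV] valid_path_linepath seg]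
        by (simp add: contour_integral_unique Q_def)
      finally show ?thesis .
    qed
  qed
qed

text \<open>For \<open>f z = exp (Q (l z))\<close> with \<open>t Q' t = p t - 1\<close> the quotient \<open>radial f z / f z\<close> is \<open>p (l z)\<close>.
  Along \<open>u\<close>, where \<open>l (t *\<^sub>C u) = t\<close>, it is \<open>p t = \<Phi> \<beta> (\<omega> t)\<close>, and the value of the functional follows
  from the coefficients of \<open>\<omega>\<close>.\<close>
theorem exp_integral_map_equality:
  fixes u :: "'a::complex_banach"
  assumes u: "norm u = 1" and l: "l \<in> support_functionals u" and \<beta>: "0 < \<beta>" "\<beta> \<le> 1"
    and \<omega>: "\<omega> holomorphic_on ball 0 1" "\<omega> 0 = 0" "\<And>t. t \<in> ball 0 1 \<Longrightarrow> cmod (\<omega> t) < 1"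
    and q: "\<And>t. t \<in> ball 0 1 \<Longrightarrow> q t = \<Phi> \<beta> (\<omega> t)"
    and M: "2 * \<beta> / 3 * cmod (taylor_coeff \<omega> 3 + 2 * complex_of_real \<beta> * taylor_coeff \<omega> 1 * taylor_coeff \<omega> 2
        + complex_of_real ((1 - 10 * \<beta>\<^sup>2) / 3) * taylor_coeff \<omega> 1 ^ 3) = M"
  shows "equality_attained_by \<beta> M u (exp_integral_map q l)"
proof -
  define p where "p t = \<Phi> \<beta> (\<omega> t)" for t
  have p: "p holomorphic_on ball 0 1" "p 0 = 1"
    unfolding p_def using Phi_compose_holomorphic[OF \<omega>(1,3)] \<omega>(2) by auto
  obtain Q where Q: "Q 0 = 0"
    "\<And>t. t \<in> ball 0 1 \<Longrightarrow> contour_integral (linepath 0 t) (\<lambda>t. 1 / t * (q t - 1)) = Q t"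
    "\<And>t. t \<in> ball 0 1 \<Longrightarrow> (Q has_field_derivative deriv Q t) (at t)"
    "\<And>t. t \<in> ball 0 1 \<Longrightarrow> t * deriv Q t = p t - 1"
    using integral_primitive[OF p, of q] q by (auto simp: p_def)
  define F where "F = exp_integral_map q l"
  define f where "f z = exp (contour_integral (linepath 0 (l z)) (\<lambda>t. 1 / t * (q t - 1)))" for z
  have F: "F z = f z *\<^sub>C z" for z by (simp add: F_def f_def exp_integral_map_def)
  have bl: "bounded_clinear l" and lu: "l u = 1" using l u by (auto simp: support_functionals_def)
  have lz: "l z \<in> ball 0 1" if "z \<in> ball 0 1" for z
    using support_functional_norm_le[OF l, of z] that by simp
  have fz: "f z = exp (Q (l z))" if "z \<in> ball 0 1" for z
    using Q(2)[OF lz[OF that]] by (simp add: f_def)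
  have der: "(f has_derivative (\<lambda>h. f z * deriv Q (l z) * l h)) (at z)" if z: "z \<in> ball 0 1" for z
  proof -
    have "((\<lambda>t. exp (Q t)) has_field_derivative exp (Q (l z)) * deriv Q (l z)) (at (l z))"
      by (rule DERIV_chain2[OF DERIV_exp Q(3)[OF lz[OF z]]])
    then have "((\<lambda>z. exp (Q (l z))) has_derivative (\<lambda>h. exp (Q (l z)) * deriv Q (l z) * l h)) (at z)"
      using has_derivative_compose[OF bounded_linear_imp_has_derivative[OF bounded_clinear_linear(1)[OF bl]]]
      unfolding has_field_derivative_def by blast
    then show ?thesis
      unfolding fz[OF z] by (rule has_derivative_transform_within_open[OF _ open_ball z]) (simp add: fz)
  qed
  have f: "holomorphic_map f (ball 0 1)"
    by (rule holomorphic_mapI[OF open_ball der])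
      (simp_all add: bounded_clinear_linear(2)[OF bl] scaleC_complex_def)
  have f0: "f 0 = 1" using Q(1) linear_0[OF bounded_linear.linear[OF bounded_clinear_linear(1)[OF bl]]]
    by (simp add: fz)
  have radial: "radial f z = p (l z) * f z" if z: "z \<in> ball 0 1" for z
  proof -
    have "f z * deriv Q (l z) * l z = f z * (p (l z) - 1)"
      using Q(4)[OF lz[OF z]] by (simp add: mult.assoc mult.commute)
    then show ?thesis
      by (simp add: radial_def fderiv_eqI[OF der[OF z]] algebra_simps)
  qed
  have nz: "f z \<noteq> 0" for z by (simp add: f_def)
  have pz: "p (l z) \<noteq> 0 \<and> \<bar>Arg (p (l z))\<bar> < pi / 2 * \<beta>" if "z \<in> ball 0 1" for z
    unfolding p_def using Phi_neq_0 Phi_Arg_less[OF _ \<beta>] \<omega>(3)[OF lz[OF that]] by blast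
  have "starlike_product \<beta> f F"
    by (rule starlike_productI[OF f F f0 \<beta>(2)]) (use nz pz in \<open>simp_all add: radial\<close>)
  moreover have "support_functionals (r *\<^sub>R u) \<noteq> {} \<and> (\<forall>l\<in>support_functionals (r *\<^sub>R u).
      cmod (A2 l F (r *\<^sub>R u) * A3 l F (r *\<^sub>R u) - A4 l F (r *\<^sub>R u)) = M)"
    if r: "r \<in> {0<..<1}" for r :: real
  proof (intro conjI ballI)
    have ru: "r *\<^sub>R u \<noteq> 0" using r u by auto
    then show "support_functionals (r *\<^sub>R u) \<noteq> {}" by (rule support_functionals_nonempty)
    fix k assume k: "k \<in> support_functionals (r *\<^sub>R u)"
    have dir: "(1 / norm (r *\<^sub>R u)) *\<^sub>R r *\<^sub>R u = u" using r u by simp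
    have "radial f (t *\<^sub>C u) = \<Phi> \<beta> (\<omega> t) * f (t *\<^sub>C u)" if t: "t \<in> ball 0 1" for t
    proof -
      have "t *\<^sub>C u \<in> ball 0 1" using t u by (simp add: norm_scaleC)
      from radial[OF this] show ?thesis
        using bounded_clinear_linear(2)[OF bl] lu by (simp add: p_def scaleC_complex_def)
    qed
    then show "cmod (A2 k F (r *\<^sub>R u) * A3 k F (r *\<^sub>R u) - A4 k F (r *\<^sub>R u)) = M"
      unfolding M[symmetric] by (intro A_functional_eq[OF f f0 F ru k \<beta>(1) \<omega>]) (simp_all only: dir)
  qed
  ultimately show ?thesis unfolding equality_attained_by_def F_def by blast
qed

section \<open>The breakpoints\<close>

text \<open>The polynomial defining \<open>\<beta>\<^sub>1\<close>.  Its sign decides whether the interior maximum of the cubic in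
  \<open>schur_triangle_bound\<close> exceeds 1, and equally on which side of the common boundary curve of \<open>\<Theta>2\<close> and
  \<open>\<Theta>8\<close> the point \<open>(q5 \<beta>, q6 \<beta>)\<close> lies.\<close>
definition breakpoint_cubic :: "real \<Rightarrow> real" where
  "breakpoint_cubic b = 16 * b ^ 3 + 69 * b\<^sup>2 - 15 * b - 16"

lemma beta1_root: "breakpoint_cubic \<beta>\<^sub>1 = 0" and beta1_gt: "559 < 1000 * \<beta>\<^sub>1"
proof -
  have "16 * \<beta>\<^sub>1 ^ 3 + 69 * \<beta>\<^sub>1\<^sup>2 - 15 * \<beta>\<^sub>1 - 16 = 0 \<and> \<bar>\<beta>\<^sub>1 - 0.559376\<bar> < 1 / 10 ^ 6"
    unfolding \<beta>\<^sub>1_def by (rule theI'[OF ex1_\<beta>\<^sub>1])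
  then show "breakpoint_cubic \<beta>\<^sub>1 = 0" "559 < 1000 * \<beta>\<^sub>1"
    by (auto simp: breakpoint_cubic_def abs_if split: if_splits)
qed

lemma breakpoint_cubic_sign:
  assumes "0 < b"
  shows "breakpoint_cubic b \<le> 0 \<longleftrightarrow> b \<le> \<beta>\<^sub>1"
proof -
  define C where "C = 16 * (b * b + b * \<beta>\<^sub>1 + \<beta>\<^sub>1 * \<beta>\<^sub>1) + 69 * (b + \<beta>\<^sub>1) - 15"
  have "breakpoint_cubic b = breakpoint_cubic b - breakpoint_cubic \<beta>\<^sub>1" by (simp add: beta1_root)
  also have "\<dots> = (b - \<beta>\<^sub>1) * C"
    by (simp add: C_def breakpoint_cubic_def algebra_simps power2_eq_square power3_eq_cube)
  finally have eq: "breakpoint_cubic b = (b - \<beta>\<^sub>1) * C" .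
  have "b * b + b * \<beta>\<^sub>1 + \<beta>\<^sub>1 * \<beta>\<^sub>1 > 0" using assms beta1_gt by (intro add_pos_pos mult_pos_pos) auto
  moreover have "69 * (b + \<beta>\<^sub>1) > 15" using assms beta1_gt by argo
  ultimately have "C > 0" unfolding C_def by argo
  then show ?thesis unfolding eq by (simp add: mult_le_0_iff)
qed

text \<open>For \<open>b < 1\<close> the quadratic is nonpositive exactly when \<open>\<rho> b \<le> 1\<close>, that is, when the critical point
  of the cubic \<open>(1 + 2 b) (t - t^3) + (10 b\<^sup>2 - 1) / 3 * t^3\<close> lies in \<open>[0, 1]\<close>.\<close>
lemma upper_breakpoint_quadratic_sign:
  assumes "0 < b"
  shows "10 * b\<^sup>2 - 4 * b - 3 \<le> 0 \<longleftrightarrow> b \<le> (2 + sqrt 34) / 10"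
proof -
  define s where "s = sqrt 34"
  have s: "s * s = 34" "s > 2" by (auto simp: s_def intro: real_less_rsqrt)
  have "10 * (10 * b\<^sup>2 - 4 * b - 3) = (10 * b - (2 + s)) * (10 * b + (s - 2))"
    using s(1) by (simp add: algebra_simps power2_eq_square)
  moreover have pos: "10 * b + (s - 2) > 0" using assms s by simp
  ultimately have "10 * (10 * b\<^sup>2 - 4 * b - 3) \<le> 0 \<longleftrightarrow> 10 * b \<le> 2 + s"
    using mult_le_cancel_right_pos[OF pos, of "10 * b - (2 + s)" 0] by simp
  then have "10 * b\<^sup>2 - 4 * b - 3 \<le> 0 \<longleftrightarrow> 10 * b \<le> 2 + s"
    by (simp only: mult_le_0_iff) simp
  then show ?thesis unfolding s_def[symmetric] by (simp add: pos_le_divide_eq mult.commute)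
qed

lemma upper_breakpoint_less_1: "(2 + sqrt 34) / 10 < (1::real)"
proof -
  have "sqrt 34 < (6::real)" by (rule real_less_lsqrt) simp_all
  then show ?thesis by simp
qed

lemma upper_breakpoint_gt: "7 < 10 * ((2 + sqrt 34) / 10 :: real)"
proof -
  have "sqrt 34 > (5::real)" by (rule real_less_rsqrt) simp_all
  then show ?thesis by simp
qed

context
  fixes \<beta> D :: real
  assumes \<beta>0: "0 < \<beta>" and \<beta>1: "\<beta> < 1"
  defines "D \<equiv> 4 + 6 * \<beta> - 10 * \<beta>\<^sup>2"
begin

lemma rho_denominator_pos: "D > 0"
proof -
  have "D = 2 * (1 - \<beta>) * (2 + 5 * \<beta>)" by (simp add: D_def algebra_simps power2_eq_square)
  then show ?thesis using \<beta>0 \<beta>1 by simp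
qed

lemma rho_pos: "\<rho> \<beta> > 0" and rho_sq: "D * (\<rho> \<beta>)\<^sup>2 = 1 + 2 * \<beta>"
  using rho_denominator_pos \<beta>0 by (auto simp: \<rho>_def D_def[symmetric])

text \<open>The critical point of the cubic is \<open>\<rho> \<beta>\<close>; the difference to the maximum has the double zero
  \<open>\<rho> \<beta>\<close> and the simple zero \<open>-2 \<rho> \<beta>\<close>.\<close>
lemma cubic_le_rho:
  assumes t: "0 \<le> t"
  shows "(1 + 2 * \<beta>) * (t - t ^ 3) + (10 * \<beta>\<^sup>2 - 1) / 3 * t ^ 3 \<le> 2 / 3 * (1 + 2 * \<beta>) * \<rho> \<beta>"
proof -
  define r where "r = \<rho> \<beta>"
  have r: "r > 0" "1 + 2 * \<beta> = D * (r * r)" using rho_pos rho_sq by (auto simp: r_def power2_eq_square)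
  have "(1 + 2 * \<beta>) * (t - t ^ 3) + (10 * \<beta>\<^sup>2 - 1) / 3 * t ^ 3 = (1 + 2 * \<beta>) * t - D / 3 * t ^ 3"
    by (simp add: D_def field_simps)
  also have "\<dots> = 2 / 3 * (1 + 2 * \<beta>) * r - D / 3 * ((t - r)\<^sup>2 * (t + 2 * r))"
    unfolding r(2) by (simp add: field_simps power2_eq_square power3_eq_cube)
  also have "\<dots> \<le> 2 / 3 * (1 + 2 * \<beta>) * r"
    using rho_denominator_pos r(1) t by simp
  finally show ?thesis unfolding r_def .
qed

lemma cubic_at_rho:
  "(1 + 2 * \<beta>) * (\<rho> \<beta> - \<rho> \<beta> ^ 3) + (10 * \<beta>\<^sup>2 - 1) / 3 * \<rho> \<beta> ^ 3 = 2 / 3 * (1 + 2 * \<beta>) * \<rho> \<beta>"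
proof -
  define r where "r = \<rho> \<beta>"
  have r: "1 + 2 * \<beta> = D * (r * r)" using rho_sq by (auto simp: r_def power2_eq_square)
  have "(1 + 2 * \<beta>) * (r - r ^ 3) + (10 * \<beta>\<^sup>2 - 1) / 3 * r ^ 3 = (1 + 2 * \<beta>) * r - D / 3 * r ^ 3"
    by (simp add: D_def field_simps)
  also have "\<dots> = 2 / 3 * (1 + 2 * \<beta>) * r"
    unfolding r by (simp add: field_simps power3_eq_cube)
  finally show ?thesis unfolding r_def .
qed

lemma rho_value_sq: "9 * D * (2 / 3 * (1 + 2 * \<beta>) * \<rho> \<beta>)\<^sup>2 = 4 * (1 + 2 * \<beta>) ^ 3"
proof -
  have "9 * D * (2 / 3 * x * r)\<^sup>2 = 4 * x\<^sup>2 * (D * r\<^sup>2)" for x r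
    by (simp add: power2_eq_square)
  from this[of "1 + 2 * \<beta>" "\<rho> \<beta>"]
  have "9 * D * (2 / 3 * (1 + 2 * \<beta>) * \<rho> \<beta>)\<^sup>2 = 4 * (1 + 2 * \<beta>)\<^sup>2 * (D * (\<rho> \<beta>)\<^sup>2)" .
  then show ?thesis unfolding rho_sq by (simp add: power2_eq_square power3_eq_cube)
qed

lemma four_cube_minus_denominator: "4 * (1 + 2 * \<beta>) ^ 3 - 9 * D = 2 * breakpoint_cubic \<beta>"
  by (simp add: D_def breakpoint_cubic_def algebra_simps power2_eq_square power3_eq_cube)

lemma rho_value_le_1: "\<beta> \<le> \<beta>\<^sub>1 \<Longrightarrow> 2 / 3 * (1 + 2 * \<beta>) * \<rho> \<beta> \<le> 1"
  and rho_value_ge_1: "\<beta>\<^sub>1 \<le> \<beta> \<Longrightarrow> 1 \<le> 2 / 3 * (1 + 2 * \<beta>) * \<rho> \<beta>"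
proof -
  define K where "K = 2 / 3 * (1 + 2 * \<beta>) * \<rho> \<beta>"
  have K: "K > 0" using rho_pos \<beta>0 by (simp add: K_def)
  have eq: "9 * D * (K\<^sup>2 - 1) = 2 * breakpoint_cubic \<beta>"
    using rho_value_sq four_cube_minus_denominator unfolding K_def[symmetric] by (simp add: algebra_simps)
  show "K \<le> 1" if "\<beta> \<le> \<beta>\<^sub>1"
  proof -
    have "D * (K\<^sup>2 - 1) \<le> 0" using eq breakpoint_cubic_sign[OF \<beta>0] that by simp
    then have "K\<^sup>2 \<le> 1\<^sup>2" using rho_denominator_pos by (simp add: mult_le_0_iff)
    then show ?thesis by (rule power2_le_imp_le) simp
  qed
  show "1 \<le> K" if "\<beta>\<^sub>1 \<le> \<beta>"
  proof -
    have "breakpoint_cubic \<beta> \<ge> 0"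
      using that breakpoint_cubic_sign[OF \<beta>0] beta1_root by (cases "\<beta> = \<beta>\<^sub>1") auto
    then have "0 \<le> D * (K\<^sup>2 - 1)" using eq by simp
    then have "1\<^sup>2 \<le> K\<^sup>2" using rho_denominator_pos by (simp add: zero_le_mult_iff)
    then show ?thesis by (rule power2_le_imp_le) (use K in simp)
  qed
qed

lemma rho_le_1:
  assumes "\<beta> \<le> (2 + sqrt 34) / 10"
  shows "\<rho> \<beta> \<le> 1"
proof -
  have "1 + 2 * \<beta> \<le> D"
    using assms upper_breakpoint_quadratic_sign[OF \<beta>0] by (simp add: D_def)
  then show ?thesis using rho_denominator_pos \<beta>0 by (simp add: \<rho>_def D_def[symmetric])
qed

lemma M2_eq: "M2 \<beta> = 2 * \<beta> / 3 * (2 / 3 * (1 + 2 * \<beta>) * \<rho> \<beta>)"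
proof -
  define E where "E = 2 + 3 * \<beta> - 5 * \<beta>\<^sup>2"
  have E: "E > 0" "D = 2 * E" using rho_denominator_pos by (auto simp: E_def D_def)
  have "(2 * \<beta> + 1) powr (3 / 2) = (1 + 2 * \<beta>) powr (1 + 1 / 2)" by (simp add: add.commute)
  also have "\<dots> = (1 + 2 * \<beta>) * sqrt (1 + 2 * \<beta>)"
    using \<beta>0 by (simp only: powr_add) (simp add: powr_half_sqrt)
  finally have "M2 \<beta> = 2 * sqrt 2 * \<beta> * ((1 + 2 * \<beta>) * sqrt (1 + 2 * \<beta>)) / (9 * sqrt E)"
    unfolding M2_def E_def by simp
  also have "\<dots> = 4 * \<beta> / 9 * (1 + 2 * \<beta>) * (sqrt (1 + 2 * \<beta>) / (sqrt 2 * sqrt E))"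
  proof -
    have two: "2 * sqrt 2 = 4 / sqrt (2::real)" by (simp add: field_simps)
    show ?thesis unfolding two by simp
  qed
  also have "sqrt (1 + 2 * \<beta>) / (sqrt 2 * sqrt E) = \<rho> \<beta>"
    by (simp only: \<rho>_def D_def[symmetric] E(2) real_sqrt_divide real_sqrt_mult)
  finally show ?thesis by simp
qed

end

text \<open>For \<open>10 \<beta>\<^sup>2 \<le> 1\<close> the coefficient \<open>q6\<close> is nonnegative and crude bounds suffice; otherwise
  \<open>cubic_le_rho\<close> applies.\<close>
lemma cubic_le_1:
  assumes \<beta>: "0 < \<beta>" "\<beta> \<le> \<beta>\<^sub>1" and t: "0 \<le> t" "t \<le> 1"
  shows "(1 + 2 * \<beta>) * (t - t ^ 3) + \<bar>(1 - 10 * \<beta>\<^sup>2) / 3\<bar> * t ^ 3 \<le> 1"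
proof (cases "10 * \<beta>\<^sup>2 \<le> 1")
  case True
  \<comment> \<open>tangent to \<open>t ^ 3\<close> at \<open>7 / 12\<close>, a rational point close to the maximum point \<open>1 / sqrt 3\<close> of \<open>t - t ^ 3\<close>\<close>
  have "0 \<le> (12 * t - 7)\<^sup>2 * (12 * t + 14)" using t by simp
  also have "\<dots> = 1728 * t ^ 3 - 1764 * t + 686"
    by (simp add: power2_eq_square power3_eq_cube algebra_simps)
  finally have "864 * (t - t ^ 3) \<le> 343" using t by (simp add: algebra_simps)
  then have tt: "t - t ^ 3 \<le> 343 / 864" by (simp add: pos_le_divide_eq mult.commute)
  have "\<beta>\<^sup>2 \<le> (1 / 3)\<^sup>2" using True by (simp add: power2_eq_square)
  then have b: "\<beta> \<le> 1 / 3" by (rule power2_le_imp_le) simp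
  have t3: "t ^ 3 \<le> t" using t power_decreasing[of 1 3 t] by simp
  have "(1 + 2 * \<beta>) * (t - t ^ 3) \<le> 5 / 3 * (343 / 864)"
    using b tt t t3 \<beta> by (intro mult_mono) auto
  moreover have "\<bar>(1 - 10 * \<beta>\<^sup>2) / 3\<bar> * t ^ 3 \<le> 1 / 3 * 1"
    using True t by (intro mult_mono) (auto simp: power_le_one)
  ultimately show ?thesis by simp
next
  case False
  have "\<beta> < 1" using \<beta> beta1_root breakpoint_cubic_sign[of 1] by (force simp: breakpoint_cubic_def)
  then show ?thesis
    using cubic_le_rho[OF \<beta>(1) _ t(1)] rho_value_le_1[OF \<beta>(1) _ \<beta>(2)] False by auto
qed

text \<open>From the upper breakpoint on, \<open>2 (1 + 2 \<beta>) \<le> 10 \<beta>\<^sup>2 - 1\<close>, which makes the derivative of the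
  cubic nonnegative on \<open>[0, 1]\<close>; so the maximum is the value at 1.\<close>
lemma cubic_le_abs_q6:
  assumes \<beta>: "(2 + sqrt 34) / 10 \<le> \<beta>" and t: "0 \<le> t" "t \<le> 1"
  shows "(1 + 2 * \<beta>) * (t - t ^ 3) + (10 * \<beta>\<^sup>2 - 1) / 3 * t ^ 3 \<le> (10 * \<beta>\<^sup>2 - 1) / 3"
    and "1 \<le> (10 * \<beta>\<^sup>2 - 1) / 3"
proof -
  have b: "7 < 10 * \<beta>" "0 < \<beta>" using \<beta> upper_breakpoint_gt by linarith+
  define A where "A = (10 * \<beta>\<^sup>2 - 1) / 3"
  have nn: "10 * \<beta>\<^sup>2 - 4 * \<beta> - 3 \<ge> 0"
  proof (cases "\<beta> = (2 + sqrt 34) / 10")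
    case True
    show ?thesis unfolding True by (simp add: power2_eq_square field_simps)
  next
    case False
    then show ?thesis using upper_breakpoint_quadratic_sign[OF b(2)] \<beta> by linarith
  qed
  then have A: "2 * (1 + 2 * \<beta>) \<le> 3 * A" by (simp add: A_def)
  then show "1 \<le> (10 * \<beta>\<^sup>2 - 1) / 3" using b unfolding A_def[symmetric] by argo
  have t2: "t + t\<^sup>2 \<le> 2" using t power_le_one[of t 2] by simp
  have "(1 + 2 * \<beta>) * (3 * (t + t\<^sup>2)) \<le> (1 + 2 * \<beta>) * (2 * (1 + t + t\<^sup>2))"
    using t2 b by (intro mult_left_mono) auto
  also have "\<dots> \<le> 3 * A * (1 + t + t\<^sup>2)"
    using mult_right_mono[OF A, of "1 + t + t\<^sup>2"] t by (simp add: algebra_simps)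
  finally have "0 \<le> (1 - t) * (A * (1 + t + t\<^sup>2) - (1 + 2 * \<beta>) * (t + t\<^sup>2))"
    using t by (intro mult_nonneg_nonneg) (simp_all add: algebra_simps)
  also have "\<dots> = A - ((1 + 2 * \<beta>) * (t - t ^ 3) + A * t ^ 3)"
    by (simp add: algebra_simps power2_eq_square power3_eq_cube)
  finally show "(1 + 2 * \<beta>) * (t - t ^ 3) + (10 * \<beta>\<^sup>2 - 1) / 3 * t ^ 3 \<le> (10 * \<beta>\<^sup>2 - 1) / 3"
    unfolding A_def by simp
qed

section \<open>The three ranges\<close>

lemma one_le_ten_sq: assumes "\<beta>\<^sub>1 \<le> \<beta>" shows "1 \<le> 10 * \<beta>\<^sup>2"
proof -
  have "1 < 2 * \<beta>" using assms beta1_gt by argo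
  then have "1\<^sup>2 \<le> (2 * \<beta>)\<^sup>2" by (intro power_mono) simp_all
  then have "1 \<le> 4 * \<beta>\<^sup>2" by (simp add: power_mult_distrib)
  then show ?thesis by argo
qed

lemma breakpoints_ordered: "\<beta>\<^sub>1 < (2 + sqrt 34) / 10"
proof -
  have "breakpoint_cubic (7 / 10) > 0" by (simp add: breakpoint_cubic_def power2_eq_square power3_eq_cube)
  then have "\<beta>\<^sub>1 < 7 / 10" using breakpoint_cubic_sign[of "7 / 10"] by auto
  then show ?thesis using upper_breakpoint_gt by argo
qed

lemma functional_bounds:
  fixes f :: "'a::complex_banach \<Rightarrow> complex"
  assumes S: "starlike_product \<beta> f F" "z \<noteq> 0" "l \<in> support_functionals z" and \<beta>: "0 < \<beta>" "\<beta> \<le> 1"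
  shows "\<beta> \<le> \<beta>\<^sub>1 \<Longrightarrow> cmod (A2 l F z * A3 l F z - A4 l F z) \<le> M1 \<beta>"
    and "\<beta>\<^sub>1 \<le> \<beta> \<Longrightarrow> \<beta> \<le> (2 + sqrt 34) / 10 \<Longrightarrow> cmod (A2 l F z * A3 l F z - A4 l F z) \<le> M2 \<beta>"
    and "(2 + sqrt 34) / 10 \<le> \<beta> \<Longrightarrow> cmod (A2 l F z * A3 l F z - A4 l F z) \<le> M3 \<beta>"
proof -
  note bound = starlike_product_functional_bound[OF S \<beta>]
  show "cmod (A2 l F z * A3 l F z - A4 l F z) \<le> M1 \<beta>" if "\<beta> \<le> \<beta>\<^sub>1"
    using bound[OF order_refl cubic_le_1[OF \<beta>(1) that]] by (simp add: M1_def)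
  show "cmod (A2 l F z * A3 l F z - A4 l F z) \<le> M2 \<beta>"
    if b: "\<beta>\<^sub>1 \<le> \<beta>" "\<beta> \<le> (2 + sqrt 34) / 10"
  proof -
    have \<beta>1: "\<beta> < 1" using b upper_breakpoint_less_1 by linarith
    have q: "\<bar>(1 - 10 * \<beta>\<^sup>2) / 3\<bar> = (10 * \<beta>\<^sup>2 - 1) / 3" using one_le_ten_sq[OF b(1)] by simp
    show ?thesis
      unfolding M2_eq[OF \<beta>(1) \<beta>1]
      by (rule bound[OF rho_value_ge_1[OF \<beta>(1) \<beta>1 b(1)]]) (simp only: q cubic_le_rho[OF \<beta>(1) \<beta>1])
  qed
  show "cmod (A2 l F z * A3 l F z - A4 l F z) \<le> M3 \<beta>" if b: "(2 + sqrt 34) / 10 \<le> \<beta>"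
  proof -
    have q: "\<bar>(1 - 10 * \<beta>\<^sup>2) / 3\<bar> = (10 * \<beta>\<^sup>2 - 1) / 3"
      using one_le_ten_sq[of \<beta>] b breakpoints_ordered by simp
    have "cmod (A2 l F z * A3 l F z - A4 l F z) \<le> 2 * \<beta> / 3 * ((10 * \<beta>\<^sup>2 - 1) / 3)"
      by (rule bound[OF cubic_le_abs_q6(2)[OF b order_refl zero_le_one]])
        (simp only: q cubic_le_abs_q6(1)[OF b])
    then show ?thesis by (simp add: M3_def)
  qed
qed

lemma parameter_regions:
  assumes \<beta>: "0 < \<beta>" "\<beta> \<le> 1"
  shows "\<beta> \<le> \<beta>\<^sub>1 \<Longrightarrow> (q5 \<beta>, q6 \<beta>) \<in> \<Theta>1 \<union> \<Theta>2"
    and "\<beta>\<^sub>1 \<le> \<beta> \<Longrightarrow> \<beta> \<le> (2 + sqrt 34) / 10 \<Longrightarrow> (q5 \<beta>, q6 \<beta>) \<in> \<Theta>8"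
    and "(2 + sqrt 34) / 10 \<le> \<beta> \<Longrightarrow> (q5 \<beta>, q6 \<beta>) \<in> \<Theta>4"
proof -
  have q: "q5 \<beta> = 2 * \<beta>" "q6 \<beta> = (1 - 10 * \<beta>\<^sup>2) / 3" using q5_eq q6_eq \<beta> by auto
  have q6_le: "(1 - 10 * \<beta>\<^sup>2) / 3 \<le> 1" using zero_le_power2[of \<beta>] by argo
  have cubic: "27 * ((1 - 10 * \<beta>\<^sup>2) / 3 - (4 / 27 * (2 * \<beta> + 1) ^ 3 - (2 * \<beta> + 1)))
      = - 2 * breakpoint_cubic \<beta>"
    by (simp add: breakpoint_cubic_def field_simps power2_eq_square power3_eq_cube)
  have line: "3 * ((1 - 10 * \<beta>\<^sup>2) / 3 + 2 / 3 * (2 * \<beta> + 1)) = - (10 * \<beta>\<^sup>2 - 4 * \<beta> - 3)"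
    by (simp add: field_simps)
  show "(q5 \<beta>, q6 \<beta>) \<in> \<Theta>1 \<union> \<Theta>2" if b: "\<beta> \<le> \<beta>\<^sub>1"
  proof (cases "4 * \<beta> \<le> 1")
    case True
    then have "\<beta>\<^sup>2 \<le> (1 / 4)\<^sup>2" using \<beta> by (intro power_mono) auto
    then have "- 1 \<le> (1 - 10 * \<beta>\<^sup>2) / 3" by (simp add: power2_eq_square)
    then show ?thesis using True \<beta> q6_le by (simp add: q \<Theta>1_def abs_le_iff)
  next
    case False
    have "breakpoint_cubic \<beta> \<le> 0" using breakpoint_cubic_sign[OF \<beta>(1)] b by simp
    then have "4 / 27 * (2 * \<beta> + 1) ^ 3 - (2 * \<beta> + 1) \<le> (1 - 10 * \<beta>\<^sup>2) / 3"
      using cubic by argo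
    then show ?thesis using False \<beta> q6_le by (simp add: q \<Theta>2_def)
  qed
  show "(q5 \<beta>, q6 \<beta>) \<in> \<Theta>8" if b: "\<beta>\<^sub>1 \<le> \<beta>" "\<beta> \<le> (2 + sqrt 34) / 10"
  proof -
    have "breakpoint_cubic \<beta> \<ge> 0"
      using breakpoint_cubic_sign[OF \<beta>(1)] b(1) beta1_root by (cases "\<beta> = \<beta>\<^sub>1") auto
    then have "(1 - 10 * \<beta>\<^sup>2) / 3 \<le> 4 / 27 * (2 * \<beta> + 1) ^ 3 - (2 * \<beta> + 1)"
      using cubic by argo
    moreover have "- (2 / 3) * (2 * \<beta> + 1) \<le> (1 - 10 * \<beta>\<^sup>2) / 3"
      using line upper_breakpoint_quadratic_sign[OF \<beta>(1)] b(2) by argo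
    moreover have "1 < 2 * \<beta>" using b(1) beta1_gt by argo
    ultimately show ?thesis using \<beta> by (simp add: q \<Theta>8_def)
  qed
  show "(q5 \<beta>, q6 \<beta>) \<in> \<Theta>4" if b: "(2 + sqrt 34) / 10 \<le> \<beta>"
  proof -
    have "2 * (1 + 2 * \<beta>) \<le> 10 * \<beta>\<^sup>2 - 1"
    proof (cases "\<beta> = (2 + sqrt 34) / 10")
      case True
      show ?thesis unfolding True by (simp add: power2_eq_square field_simps)
    next
      case False
      then show ?thesis using upper_breakpoint_quadratic_sign[OF \<beta>(1)] b by argo
    qed
    then have "(1 - 10 * \<beta>\<^sup>2) / 3 \<le> - (2 / 3) * (2 * \<beta> + 1)" by argo
    moreover have "1 < 2 * \<beta>" using b upper_breakpoint_gt by argo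
    ultimately show ?thesis using \<beta> by (simp add: q \<Theta>4_def)
  qed
qed

lemma blaschke_factor:
  fixes r :: real
  assumes r: "0 < r" "r \<le> 1" and t: "cmod t < 1"
  shows "1 - of_real r * t \<noteq> 0" and "cmod ((of_real r - t) / (1 - of_real r * t)) \<le> 1"
proof -
  have "cmod (of_real r * t) < 1"
    using r t mult_mono[of r 1 "cmod t" "cmod t"] by (simp add: norm_mult)
  then show ne: "1 - of_real r * t \<noteq> 0" by auto
  have "cmod (of_real r - t) \<le> cmod (1 - of_real r * t)"
    using cmod_moebius_le[of "of_real r" t] r t by (simp add: norm_minus_commute)
  then show "cmod ((of_real r - t) / (1 - of_real r * t)) \<le> 1" using ne by (simp add: norm_divide)
qed

lemma F1_equality:
  fixes u :: "'a::complex_banach"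
  assumes u: "norm u = 1" "l \<in> support_functionals u" and \<beta>: "0 < \<beta>" "\<beta> \<le> 1"
  shows "equality_attained_by \<beta> (M1 \<beta>) u (F1 \<beta> l)"
  unfolding F1_def
proof (rule exp_integral_map_equality[OF u \<beta>, where \<omega> = "\<lambda>t. t ^ 3"])
  have "taylor_coeff (\<lambda>t. t ^ 3) n = (if n = 3 then 1 else 0)" for n
    using taylor_coeff_eq_fps_nth[OF has_fps_expansion_fps_X_power[of 3]] by (simp add: fps_X_power_nth)
  then show "2 * \<beta> / 3 * cmod (taylor_coeff (\<lambda>t. t ^ 3) 3
      + 2 * complex_of_real \<beta> * taylor_coeff (\<lambda>t. t ^ 3) 1 * taylor_coeff (\<lambda>t. t ^ 3) 2
      + complex_of_real ((1 - 10 * \<beta>\<^sup>2) / 3) * taylor_coeff (\<lambda>t. t ^ 3) 1 ^ 3) = M1 \<beta>"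
    by (simp add: M1_def)
qed (auto intro!: holomorphic_intros simp: \<Phi>_def norm_power power_less_one_iff)

text \<open>For \<open>\<omega> = t\<close> the functional has the value \<open>q6\<close>, whose modulus is \<open>- q6\<close> because \<open>10 \<beta>\<^sup>2 \<ge> 1\<close>.\<close>
lemma F2_equality:
  fixes u :: "'a::complex_banach"
  assumes u: "norm u = 1" "l \<in> support_functionals u" and \<beta>: "0 < \<beta>" "\<beta> \<le> 1" and b: "1 \<le> 10 * \<beta>\<^sup>2"
  shows "equality_attained_by \<beta> (M3 \<beta>) u (F2 \<beta> l)"
  unfolding F2_def
proof (rule exp_integral_map_equality[OF u \<beta>, where \<omega> = "\<lambda>t. t"])
  show "2 * \<beta> / 3 * cmod (taylor_coeff (\<lambda>t. t) 3
      + 2 * complex_of_real \<beta> * taylor_coeff (\<lambda>t. t) 1 * taylor_coeff (\<lambda>t. t) 2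
      + complex_of_real ((1 - 10 * \<beta>\<^sup>2) / 3) * taylor_coeff (\<lambda>t. t) 1 ^ 3) = M3 \<beta>"
    unfolding taylor_coeff_ident using b by (simp del: of_real_divide of_real_diff add: M3_def)
qed (auto intro!: holomorphic_intros simp: \<Phi>_def)

text \<open>The base of the power in \<open>F3\<close> is the Cayley transform of the Blaschke product
  \<open>\<omega> t = t (\<rho> - t) / (1 - \<rho> t)\<close>.  Its coefficients \<open>\<rho>\<close>, \<open>\<rho>\<^sup>2 - 1\<close>, \<open>\<rho> (\<rho>\<^sup>2 - 1)\<close> make all three
  terms of the functional nonpositive, so the modulus is the cubic at its critical point.\<close>
lemma F3_equality:
  fixes u :: "'a::complex_banach"
  assumes u: "norm u = 1" "l \<in> support_functionals u" and \<beta>: "0 < \<beta>"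
    and b: "\<beta>\<^sub>1 \<le> \<beta>" "\<beta> \<le> (2 + sqrt 34) / 10"
  shows "equality_attained_by \<beta> (M2 \<beta>) u (F3 \<beta> l)"
proof -
  have \<beta>1: "\<beta> < 1" using b upper_breakpoint_less_1 by linarith
  define r where "r = \<rho> \<beta>"
  have r: "0 < r" "r \<le> 1" using rho_pos[OF \<beta> \<beta>1] rho_le_1[OF \<beta> \<beta>1 b(2)] by (auto simp: r_def)
  define R where "R = complex_of_real r"
  define \<omega> where "\<omega> t = t * ((R - t) / (1 - R * t))" for t
  have ne: "1 - R * t \<noteq> 0" if "t \<in> ball 0 1" for t
    using blaschke_factor(1)[OF r] that by (simp add: R_def)
  have \<omega>: "\<omega> holomorphic_on ball 0 1"
    unfolding \<omega>_def using ne by (intro holomorphic_intros) auto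
  have \<omega>1: "cmod (\<omega> t) < 1" if "t \<in> ball 0 1" for t
  proof -
    have "cmod (\<omega> t) \<le> cmod t * 1"
      unfolding \<omega>_def norm_mult
      using blaschke_factor(2)[OF r, of t] that by (intro mult_left_mono) (simp_all add: R_def)
    then show ?thesis using that by simp
  qed
  have Phi: "((1 - t\<^sup>2) / (1 + t\<^sup>2 - 2 * R * t)) powr complex_of_real \<beta> = \<Phi> \<beta> (\<omega> t)"
    if t: "t \<in> ball 0 1" for t
  proof -
    have "1 + \<omega> t = (1 - t\<^sup>2) / (1 - R * t)" "1 - \<omega> t = (1 + t\<^sup>2 - 2 * R * t) / (1 - R * t)"
      using ne[OF t] by (simp_all add: \<omega>_def field_simps power2_eq_square)
    then show ?thesis using ne[OF t] by (simp add: \<Phi>_def)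
  qed
  define W where "W = fps_expansion \<omega> 0"
  have W: "\<omega> has_fps_expansion W" unfolding W_def by (rule has_fps_expansion_disc[OF \<omega>]) simp
  have "W * (1 - fps_const R * fps_X) = fps_X * (fps_const R - fps_X)"
  proof (rule fps_expansion_unique_on_disc[OF zero_less_one
        has_fps_expansion_mult[OF W has_fps_expansion_diff[OF has_fps_expansion_1
            has_fps_expansion_cmult_left[OF has_fps_expansion_fps_X]]]
        has_fps_expansion_mult[OF has_fps_expansion_fps_X
          has_fps_expansion_diff[OF has_fps_expansion_const has_fps_expansion_fps_X]]])
    fix t :: complex assume "t \<in> ball 0 1"
    then show "\<omega> t * (1 - R * t) = t * (R - t)" using ne by (simp add: \<omega>_def)
  qed
  note nth = arg_cong[OF this, of "\<lambda>F. fps_nth F n" for n]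
  have W0: "fps_nth W 0 = 0" using has_fps_expansion_imp_0_eq_fps_nth_0[OF W] by (simp add: \<omega>_def)
  have W1: "fps_nth W 1 = R" using nth[of 1] W0 by (simp add: fps_mult_nth)
  have W2: "fps_nth W 2 = R\<^sup>2 - 1"
    using nth[of 2] W0 W1 by (simp add: fps_mult_nth numeral_2_eq_2 algebra_simps)
  have "fps_nth W 3 = R * fps_nth W 2"
    using nth[of 3] W0 by (simp add: fps_mult_nth numeral_2_eq_2 numeral_3_eq_3 algebra_simps)
  then have W3: "fps_nth W 3 = R * (R\<^sup>2 - 1)" unfolding W2 .
  have "equality_attained_by \<beta> (M2 \<beta>) u
      (exp_integral_map (\<lambda>t. ((1 - t\<^sup>2) / (1 + t\<^sup>2 - 2 * R * t)) powr complex_of_real \<beta>) l)"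
  proof (rule exp_integral_map_equality[OF u \<beta> less_imp_le[OF \<beta>1] \<omega> _ \<omega>1 Phi])
    have "taylor_coeff \<omega> 3 + 2 * complex_of_real \<beta> * taylor_coeff \<omega> 1 * taylor_coeff \<omega> 2
        + complex_of_real ((1 - 10 * \<beta>\<^sup>2) / 3) * taylor_coeff \<omega> 1 ^ 3
        = complex_of_real (- ((1 + 2 * \<beta>) * (r - r ^ 3) + (10 * \<beta>\<^sup>2 - 1) / 3 * r ^ 3))"
      unfolding taylor_coeff_eq_fps_nth[OF W] W1 W2 W3
      by (simp add: R_def field_simps power2_eq_square power3_eq_cube)
    also have "\<dots> = complex_of_real (- (2 / 3 * (1 + 2 * \<beta>) * r))"
      unfolding r_def cubic_at_rho[OF \<beta> \<beta>1] ..
    finally show "2 * \<beta> / 3 * cmod (taylor_coeff \<omega> 3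
        + 2 * complex_of_real \<beta> * taylor_coeff \<omega> 1 * taylor_coeff \<omega> 2
        + complex_of_real ((1 - 10 * \<beta>\<^sup>2) / 3) * taylor_coeff \<omega> 1 ^ 3) = M2 \<beta>"
      using r \<beta> unfolding M2_eq[OF \<beta> \<beta>1] r_def[symmetric] by (simp only: norm_of_real) simp
  qed (simp_all add: \<omega>_def)
  then show ?thesis by (simp add: F3_def R_def r_def)
qed

lemma equality_attained_byE:
  assumes "equality_attained_by \<beta> M u F" and u: "norm u = 1"
  obtains f z l where "starlike_product \<beta> f F" "z \<noteq> 0" "l \<in> support_functionals z"
    "cmod (A2 l F z * A3 l F z - A4 l F z) = M"
proof -
  obtain f where f: "starlike_product \<beta> f F" using assms(1) by (auto simp: equality_attained_by_def)
  define z where "z = (1 / 2 :: real) *\<^sub>R u"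
  have "support_functionals z \<noteq> {} \<and>
      (\<forall>l\<in>support_functionals z. cmod (A2 l F z * A3 l F z - A4 l F z) = M)"
    using assms(1) unfolding equality_attained_by_def z_def by simp
  moreover have "z \<noteq> 0" using u by (auto simp: z_def)
  ultimately show ?thesis using that[OF f] by blast
qed

theorem corollary7p3:
  fixes \<beta> :: real
  assumes nonzero: "\<exists>x::'a::complex_banach. x \<noteq> 0"
    and \<beta>: "\<beta> \<in> {0<..1}"
  shows
    "(\<forall>(f::'a \<Rightarrow> complex) F z l.
        starlike_product \<beta> f F \<and> z \<noteq> 0 \<and> l \<in> support_functionals z \<longrightarrow>
          (\<beta> \<in> {0<..\<beta>\<^sub>1} \<longrightarrow> cmod (A2 l F z * A3 l F z - A4 l F z) \<le> M1 \<beta>) \<and>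
          (\<beta> \<in> {\<beta>\<^sub>1..(2 + sqrt 34) / 10} \<longrightarrow> cmod (A2 l F z * A3 l F z - A4 l F z) \<le> M2 \<beta>) \<and>
          (\<beta> \<in> {(2 + sqrt 34) / 10..1} \<longrightarrow> cmod (A2 l F z * A3 l F z - A4 l F z) \<le> M3 \<beta>))
     \<and>
     (\<beta> \<in> {0<..\<beta>\<^sub>1} \<longrightarrow> (q5 \<beta>, q6 \<beta>) \<in> \<Theta>1 \<union> \<Theta>2) \<and>
     (\<beta> \<in> {\<beta>\<^sub>1..(2 + sqrt 34) / 10} \<longrightarrow> (q5 \<beta>, q6 \<beta>) \<in> \<Theta>8) \<and>
     (\<beta> \<in> {(2 + sqrt 34) / 10..1} \<longrightarrow> (q5 \<beta>, q6 \<beta>) \<in> \<Theta>4)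
     \<and>
     (\<forall>(u::'a) l. norm u = 1 \<and> l \<in> support_functionals u \<longrightarrow>
          (\<beta> \<in> {0<..\<beta>\<^sub>1} \<longrightarrow> equality_attained_by \<beta> (M1 \<beta>) u (F1 \<beta> l)) \<and>
          (\<beta> \<in> {\<beta>\<^sub>1..(2 + sqrt 34) / 10} \<longrightarrow> equality_attained_by \<beta> (M2 \<beta>) u (F3 \<beta> l)) \<and>
          (\<beta> \<in> {(2 + sqrt 34) / 10..1} \<longrightarrow> equality_attained_by \<beta> (M3 \<beta>) u (F2 \<beta> l)))
     \<and>
     (\<exists>(f::'a \<Rightarrow> complex) F z l.
        starlike_product \<beta> f F \<and> z \<noteq> 0 \<and> l \<in> support_functionals z \<and>
          (\<beta> \<in> {0<..\<beta>\<^sub>1} \<longrightarrow> cmod (A2 l F z * A3 l F z - A4 l F z) = M1 \<beta>) \<and>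
          (\<beta> \<in> {\<beta>\<^sub>1..(2 + sqrt 34) / 10} \<longrightarrow> cmod (A2 l F z * A3 l F z - A4 l F z) = M2 \<beta>) \<and>
          (\<beta> \<in> {(2 + sqrt 34) / 10..1} \<longrightarrow> cmod (A2 l F z * A3 l F z - A4 l F z) = M3 \<beta>))"
proof -
  have \<beta>0: "0 < \<beta>" "\<beta> \<le> 1" using \<beta> by auto
  note bounds = functional_bounds[OF _ _ _ \<beta>0]
  have "1 \<le> 10 * \<beta>\<^sup>2" if "(2 + sqrt 34) / 10 \<le> \<beta>"
    using one_le_ten_sq[of \<beta>] breakpoints_ordered that by simp
  note F2_eq = F2_equality[OF _ _ \<beta>0 this]
  obtain u :: 'a where u: "norm u = 1"
  proof -
    obtain x :: 'a where "x \<noteq> 0" using nonzero by blast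
    then show ?thesis by (intro that[of "(1 / norm x) *\<^sub>R x"]) simp
  qed
  then obtain l where l: "l \<in> support_functionals u"
    using support_functionals_nonempty[of u] by fastforce
  define N where "N = (\<lambda>l F (z :: 'a). cmod (A2 l F z * A3 l F z - A4 l F z))"
  \<comment> \<open>At a breakpoint both adjacent bounds apply to both adjacent extremal maps, so the two bounds coincide;
    a single map then serves both ranges.\<close>
  have "\<exists>(f::'a \<Rightarrow> complex) F z l. starlike_product \<beta> f F \<and> z \<noteq> 0 \<and> l \<in> support_functionals z \<and>
      (\<beta> \<in> {0<..\<beta>\<^sub>1} \<longrightarrow> N l F z = M1 \<beta>) \<and>
      (\<beta> \<in> {\<beta>\<^sub>1..(2 + sqrt 34) / 10} \<longrightarrow> N l F z = M2 \<beta>) \<and>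
      (\<beta> \<in> {(2 + sqrt 34) / 10..1} \<longrightarrow> N l F z = M3 \<beta>)"
  proof -
    have 12: "M1 \<beta> = M2 \<beta>" if "\<beta> = \<beta>\<^sub>1"
    proof (rule antisym)
      have b: "\<beta>\<^sub>1 \<le> \<beta>" "\<beta> \<le> (2 + sqrt 34) / 10" "\<beta> \<le> \<beta>\<^sub>1" using that breakpoints_ordered by auto
      show "M1 \<beta> \<le> M2 \<beta>"
        using equality_attained_byE[OF F1_equality[OF u l \<beta>0] u] bounds(2)[OF _ _ _ b(1,2)] by metis
      show "M2 \<beta> \<le> M1 \<beta>"
        using equality_attained_byE[OF F3_equality[OF u l \<beta>0(1) b(1,2)] u] bounds(1)[OF _ _ _ b(3)] by metis
    qed
    have 23: "M2 \<beta> = M3 \<beta>" if "\<beta> = (2 + sqrt 34) / 10"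
    proof (rule antisym)
      have b: "\<beta>\<^sub>1 \<le> \<beta>" "\<beta> \<le> (2 + sqrt 34) / 10" "(2 + sqrt 34) / 10 \<le> \<beta>"
        using that breakpoints_ordered by auto
      show "M2 \<beta> \<le> M3 \<beta>"
        using equality_attained_byE[OF F3_equality[OF u l \<beta>0(1) b(1,2)] u] bounds(3)[OF _ _ _ b(3)] by metis
      show "M3 \<beta> \<le> M2 \<beta>"
        using equality_attained_byE[OF F2_eq[OF u l b(3)] u] bounds(2)[OF _ _ _ b(1,2)] by metis
    qed
    consider "\<beta> \<le> \<beta>\<^sub>1" | "\<beta>\<^sub>1 < \<beta>" "\<beta> \<le> (2 + sqrt 34) / 10" | "(2 + sqrt 34) / 10 < \<beta>" by linarith
    then show ?thesis
    proof cases
      case 1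
      obtain f z k where "starlike_product \<beta> f (F1 \<beta> l)" "z \<noteq> 0" "k \<in> support_functionals z"
        "N k (F1 \<beta> l) z = M1 \<beta>"
        unfolding N_def by (rule equality_attained_byE[OF F1_equality[OF u l \<beta>0] u])
      then show ?thesis
        using 1 12 breakpoints_ordered
        by (intro exI[of _ f] exI[of _ "F1 \<beta> l"] exI[of _ z] exI[of _ k]) auto
    next
      case 2
      obtain f z k where "starlike_product \<beta> f (F3 \<beta> l)" "z \<noteq> 0" "k \<in> support_functionals z"
        "N k (F3 \<beta> l) z = M2 \<beta>"
        unfolding N_def by (rule equality_attained_byE[OF F3_equality[OF u l \<beta>0(1) less_imp_le[OF 2(1)] 2(2)] u])
      then show ?thesis
        using 2 23
        by (intro exI[of _ f] exI[of _ "F3 \<beta> l"] exI[of _ z] exI[of _ k]) auto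
    next
      case 3
      obtain f z k where "starlike_product \<beta> f (F2 \<beta> l)" "z \<noteq> 0" "k \<in> support_functionals z"
        "N k (F2 \<beta> l) z = M3 \<beta>"
        unfolding N_def by (rule equality_attained_byE[OF F2_eq[OF u l less_imp_le[OF 3]] u])
      then show ?thesis
        using 3 breakpoints_ordered
        by (intro exI[of _ f] exI[of _ "F2 \<beta> l"] exI[of _ z] exI[of _ k]) auto
    qed
  qed
  note sharp = this[unfolded N_def]
  have I: "\<beta> \<in> {0<..\<beta>\<^sub>1} \<longleftrightarrow> \<beta> \<le> \<beta>\<^sub>1" "\<beta> \<in> {(2 + sqrt 34) / 10..1} \<longleftrightarrow> (2 + sqrt 34) / 10 \<le> \<beta>"
    "\<beta> \<in> {\<beta>\<^sub>1..(2 + sqrt 34) / 10} \<longleftrightarrow> \<beta>\<^sub>1 \<le> \<beta> \<and> \<beta> \<le> (2 + sqrt 34) / 10"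
    using \<beta>0 by simp_all
  show ?thesis
  proof (rule conjI, goal_cases)
    case 1
    show ?case unfolding I by (intro allI impI conjI; elim conjE; rule bounds)
  next
    case 2
    show ?case
    proof (intro conjI, goal_cases)
      case 1
      show ?case unfolding I using parameter_regions(1)[OF \<beta>0] by blast
    next
      case 2
      show ?case unfolding I using parameter_regions(2)[OF \<beta>0] by blast
    next
      case 3
      show ?case unfolding I using parameter_regions(3)[OF \<beta>0] by blast
    next
      case 4
      show ?case unfolding I
        by (intro allI impI conjI; elim conjE) (rule F1_equality[OF _ _ \<beta>0] F3_equality[OF _ _ \<beta>0(1)] F2_eq; assumption)+
    next
      case 5
      show ?case by (rule sharp)
    qed
  qed
qed

end
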